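(* Let $f_0,f_1$ be probability densities on $\mathbb{R}$ with $0<\mathbf{I}(f_1\|f_0)<\infty$ and $0<\mathbf{I}(f_0\|f_1)<\infty$. Let $0<\epsilon\le 1$, $a_1>0$ and $\epsilon_1\in\mathcal{E}^*(a_1,\epsilon)$. For $\zeta\ge 1$ with $\ln\zeta>a_1$, let $T_c(\ln\zeta)$ and $\Psi$ be the stopping time and censoring policy of the CuSum-AC algorithm with parameters $a=\ln\zeta$, $a_1$, $\epsilon_1$. Then the average-run-length constraint and the communication rate constraint are satisfied: $$\mathbb{E}_\infty[T_c(\ln\zeta)]\ge\zeta,\qquad r(\Psi)\le\epsilon .$$ Furthermore, the CuSum-AC algorithm is asymptotically optimal, as $\zeta\to\infty$, for the problem of minimizing $d_L(T,\Psi)$ over $(T,\Psi)$ subject to $\mathbb{E}_\infty[T]\ge\zeta$ and $r(\Psi)\le\epsilon$; i.e., as $\zeta\to\infty$, $$d_L(T_c(\ln\zeta),\Psi)=\frac{\ln\zeta}{\mathbf{I}(f_1\|f_0)}\,(1+o(1)).$$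
   Context: Observation model. For $\nu\in\mathbb{N}_+=\{1,2,\dots\}$, under $\mathbb{P}_\nu$ the real random variables $X_1,X_2,\dots$ are independent, $X_1,\dots,X_{\nu-1}$ have density $f_0$ and $X_\nu,X_{\nu+1},\dots$ have density $f_1$; under $\mathbb{P}_\infty$ all $X_k$ have density $f_0$. $\mathbb{E}_\nu,\mathbb{E}_\infty$ are the expectations. $\mathbf{I}(f\|g)=\int_{\mathbb{R}} f\ln(f/g)\,dx$ is the Kullback–Leibler divergence, $\ell(x)=\ln\frac{f_1(x)}{f_0(x)}$, and $(x)^+=\max(0,x)$. Censoring strategies. A censoring strategy is a (measurable) map $\psi:\mathbb{R}\to\{0,1\}$; at time $k$ a strategy $\psi_k$ is used and $\gamma_k=\psi_k(X_k)$; $X_k$ is transmitted iff $\gamma_k=1$. A censoring policy $\Psi=(\psi_1,\psi_2,\dots)$ is such that $\psi_k$ is determined by $\mathcal{I}_{k-1}$, where $\mathcal{I}_k=\{(1,\gamma_1,\gamma_1X_1),\dots,(k,\gamma_k,\gamma_kX_k)\}$, $\mathcal{I}_0=\emptyset$. The log-likelihood ratio under strategy $\psi$ is $$\ell^{\psi}(\gamma,x)=\gamma\ln\frac{f_1(x)}{f_0(x)}+(1-\gamma)\ln\frac{\mathbb{P}_1\{\psi(X_1)=0\}}{\mathbb{P}_\infty\{\psi(X_1)=0\}},$$ and $\mathbf{I}^{\psi}(f_1\|f_0)=\mathbb{E}_1[\ell^{\psi}(\psi(X_1),X_1)]$. For $0<e\le 1$, $\psi^*(e)$ is a (fixed) maximizer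 of $\mathbf{I}^{\psi}(f_1\|f_0)$ over all $\psi$ with $\mathbb{P}_\infty\{\psi(X_1)=1\}=e$; $\psi^*(1)\equiv 1$ (everything is transmitted). CuSum-AC algorithm with parameters $a,a_1,\epsilon_1$ ($a_1<a$, $0<\epsilon_1\le1$). Put $s_0=0$ and for $k\ge 1$: $\psi_k=\psi^*(1)$ if $s_{k-1}\ge a_1$, and $\psi_k=\psi^*(\epsilon_1)$ if $s_{k-1}<a_1$; $\gamma_k=\psi_k(X_k)$; $\tilde s_k=\max\{0,s_{k-1}+\ell^{\psi_k}(\gamma_k,X_k)\}$; $s_k=a_1$ if $s_{k-1}<a_1$ and $\tilde s_k\ge a_1$, and $s_k=\tilde s_k$ otherwise. The censoring policy is $\Psi=(\psi_1,\psi_2,\dots)$ and the stopping time is $T_c(a)=\inf\{k\ge 1:s_k\ge a\}$. Performance indices of a pair $(T,\Psi)$, $T$ a stopping time with respect to $\sigma(\mathcal{I}_k)$: the average run length to false alarm $\mathbb{E}_\infty[T]$; the pre-change communication rate $$r(\Psi)=\limsup_{n\to\infty}\frac1n\,\mathbb{E}_\infty\Big[\sum_{k=1}^n\gamma_k\,\Big|\,T\ge n\Big];$$ and Lorden's detection delay $$d_L(T,\Psi)=\sup_{1\le\nu<\infty}\Big\{\operatorname*{ess\,sup}_{\mathcal{I}_{\nu-1}}\mathbb{E}_\nu[(T-\nu+1)^+\mid\mathcal{I}_{\nu-1}]\Big\}.$$ The set $\mathcal{E}^*(a_1,\epsilon)$. Let $\mathcal{E}(a_1,\epsilon)$ be the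 set of $\epsilon_1\in(0,1]$ such that, for every $a\in(a_1,+\infty]$, the CuSum-AC algorithm with parameters $a,a_1,\epsilon_1$ satisfies $r(\Psi)\le\epsilon$. For $a>a_1$ let $\eta(0)=\inf\{n\ge1:\sum_{k=1}^n\ell(X_k)\notin[0,a-a_1]\}$ and $\hat s_{\eta(0)}=\big(a_1+\sum_{k=1}^{\eta(0)}\ell(X_k)\big)^+$. For $0\le z<a_1$ let $\breve s_0(z)=z$, $\breve s_k(z)=\big(\breve s_{k-1}(z)+\ell^{\psi^*(\epsilon_1)}(\gamma_k,X_k)\big)^+$ with $\gamma_k=\psi^*(\epsilon_1)(X_k)$, and $\phi(z)=\inf\{k\ge1:\breve s_k(z)\ge a_1\}$; in $\phi(\hat s_{\eta(0)})$ the recursion started at $\hat s_{\eta(0)}$ uses fresh observations, i.e. those following time $\eta(0)$. Let $T(a_1)=\inf\{k\ge1:c_k>a_1\}$ with $c_0=0$, $c_k=(c_{k-1}+\ell(X_k))^+$ (the CuSum stopping time). Let $\mathcal{E}'(a_1,\epsilon)$ be the set of $\epsilon_1\in(0,1]$ such that $$\mathbb{E}_\infty\big[\phi(\hat s_{\eta(0)})\,\big|\,\hat s_{\eta(0)}<a_1\big]\ge\mathbb{E}_\infty[T(a_1)]\quad\text{for all }a>a_1 .$$ Then $\mathcal{E}^*(a_1,\epsilon)=\mathcal{E}(a_1,\epsilon)\cap\mathcal{E}'(a_1,\epsilon)$. *)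

theory Defs
  imports "HOL-Probability.Probability"
begin

section \<open>Observation model\<close>

definition prob_density :: "(real \<Rightarrow> real) \<Rightarrow> bool" where
  "prob_density f \<longleftrightarrow>
     f \<in> borel_measurable borel \<and> (\<forall>x. 0 \<le> f x) \<and> (\<integral>\<^sup>+x. ennreal (f x) \<partial>lborel) = 1"

text \<open>
  The negative part of \<open>f ln (f/g)\<close> is integrable for all densities \<open>f\<close>, \<open>g\<close>, so failure of
  integrability means that the integral is \<open>\<infinity>\<close>.  The first condition is the convention
  \<open>p ln (p/0) = \<infinity>\<close> for \<open>p > 0\<close>, which \<open>x / 0 = 0\<close> and \<open>ln 0 = 0\<close> would otherwise hide.
\<close>
definition KL :: "(real \<Rightarrow> real) \<Rightarrow> (real \<Rightarrow> real) \<Rightarrow> ereal" where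
  "KL f g =
     (if (AE x in lborel. g x = 0 \<longrightarrow> f x = 0) \<and> integrable lborel (\<lambda>x. f x * ln (f x / g x))
      then ereal (\<integral>x. f x * ln (f x / g x) \<partial>lborel) else \<infinity>)"

text \<open>
  The observations are the coordinates of the canonical space \<open>nat \<Rightarrow> real\<close>; coordinate \<open>i\<close>
  carries the observation at time \<open>i + 1\<close>, as times are counted from \<open>1\<close>.
  The change point \<open>\<nu>\<close> is an extended natural number, \<open>\<infinity>\<close> meaning that no change occurs.
\<close>
definition X :: "nat \<Rightarrow> (nat \<Rightarrow> real) \<Rightarrow> real" where
  "X k \<omega> = \<omega> (k - 1)"

definition P :: "(real \<Rightarrow> real) \<Rightarrow> (real \<Rightarrow> real) \<Rightarrow> enat \<Rightarrow> (nat \<Rightarrow> real) measure" where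
  "P f0 f1 \<nu> = (\<Pi>\<^sub>M i\<in>UNIV. density lborel (\<lambda>x. ennreal (if enat (i + 1) < \<nu> then f0 x else f1 x)))"

lemma observations:
  assumes "prob_density f0" "prob_density f1"
  shows "prob_space (P f0 f1 \<nu>)"
    and "prob_space.indep_vars (P f0 f1 \<nu>) (\<lambda>_. borel) X {1..}"
    and "k \<ge> 1 \<Longrightarrow> distributed (P f0 f1 \<nu>) lborel (X k)
                     (\<lambda>x. ennreal (if enat k < \<nu> then f0 x else f1 x))"
proof -
  define D where "D i = density lborel (\<lambda>x. ennreal (if enat (i + 1) < \<nu> then f0 x else f1 x))" for i :: nat
  have P: "P f0 f1 \<nu> = PiM UNIV D"
    unfolding P_def D_def ..
  have [measurable]: "f0 \<in> borel_measurable borel" "f1 \<in> borel_measurable borel"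
    using assms by (auto simp: prob_density_def)
  have D: "prob_space (D i)" for i
    using assms
    by (cases "enat (i + 1) < \<nu>") (auto simp: D_def prob_density_def emeasure_density intro!: prob_spaceI)
  have sets_D [measurable_cong]: "sets (D i) = sets borel" for i
    by (simp add: D_def)
  show ps: "prob_space (P f0 f1 \<nu>)"
    unfolding P by (rule prob_space_PiM) (rule D)
  have coord: "distr (PiM UNIV D) borel (\<lambda>\<omega>. \<omega> i) = D i" for i
    using distr_PiM_component[of UNIV D i] D by (simp add: sets_D cong: distr_cong)
  have X: "X k \<in> measurable (PiM UNIV D) borel" for k
    unfolding X_def [abs_def] by measurable
  show "prob_space.indep_vars (P f0 f1 \<nu>) (\<lambda>_. borel) X {1..}"
  proof (subst prob_space.indep_vars_iff_distr_eq_PiM[OF ps])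
    have "distr (PiM UNIV D) (PiM {1..} (\<lambda>_. borel)) (\<lambda>\<omega>. \<lambda>k\<in>{1..}. X k \<omega>)
        = distr (PiM UNIV D) (PiM {1..} (\<lambda>k. D (k - 1))) (\<lambda>\<omega>. \<lambda>k\<in>{1..}. \<omega> (k - 1))"
      by (rule distr_cong) (auto simp: X_def sets_D intro!: sets_PiM_cong)
    also have "\<dots> = PiM {1..} (\<lambda>k. D (k - 1))"
      by (rule distr_PiM_reindex) (auto simp: D inj_on_def)
    also have "\<dots> = PiM {1..} (\<lambda>k. distr (PiM UNIV D) borel (X k))"
      by (simp add: X_def [abs_def] coord)
    finally show "distr (P f0 f1 \<nu>) (PiM {1..} (\<lambda>_. borel)) (\<lambda>\<omega>. \<lambda>k\<in>{1..}. X k \<omega>)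
        = PiM {1..} (\<lambda>k. distr (P f0 f1 \<nu>) borel (X k))"
      unfolding P .
  qed (use X P in auto)
  show "distributed (P f0 f1 \<nu>) lborel (X k) (\<lambda>x. ennreal (if enat k < \<nu> then f0 x else f1 x))"
    if "k \<ge> 1"
  proof -
    have "distr (PiM UNIV D) lborel (X k) = distr (PiM UNIV D) borel (\<lambda>\<omega>. \<omega> (k - 1))"
      by (rule distr_cong) (auto simp: X_def)
    also have "\<dots> = density lborel (\<lambda>x. ennreal (if enat k < \<nu> then f0 x else f1 x))"
      using that unfolding coord D_def by simp
    finally show ?thesis
      unfolding distributed_def P using X[of k] by (cases "enat k < \<nu>") auto
  qed
qed

text \<open>Elementary conditional expectation given an event (\<open>0\<close> if the event is null).\<close>
definition cond_expect :: "'a measure \<Rightarrow> ('a \<Rightarrow> ennreal) \<Rightarrow> 'a set \<Rightarrow> ennreal" where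
  "cond_expect M Y A = (\<integral>\<^sup>+\<omega>\<in>A. Y \<omega> \<partial>M) / emeasure M A"

text \<open>\<open>inf {k \<ge> 1. Q k}\<close>, with value \<open>\<infinity>\<close> for the empty set.\<close>
definition first_time :: "(nat \<Rightarrow> bool) \<Rightarrow> enat" where
  "first_time Q = (INF k\<in>{k. 1 \<le> k \<and> Q k}. enat k)"

section \<open>Censoring strategies and policies\<close>

text \<open>Strategies take values in \<open>bool\<close> instead of \<open>{0, 1}\<close>: \<open>True\<close> means \<^emph>\<open>transmit\<close>.\<close>
type_synonym strategy = "real \<Rightarrow> bool"

definition llr :: "(real \<Rightarrow> real) \<Rightarrow> (real \<Rightarrow> real) \<Rightarrow> real \<Rightarrow> real" where
  "llr f0 f1 x = ln (f1 x / f0 x)"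

definition censored_llr ::
  "(real \<Rightarrow> real) \<Rightarrow> (real \<Rightarrow> real) \<Rightarrow> strategy \<Rightarrow> bool \<Rightarrow> real \<Rightarrow> real" where
  "censored_llr f0 f1 \<psi> \<gamma> x =
     of_bool \<gamma> * ln (f1 x / f0 x) +
     (1 - of_bool \<gamma>) * ln (\<P>(\<omega> in P f0 f1 1. \<not> \<psi> (X 1 \<omega>)) / \<P>(\<omega> in P f0 f1 \<infinity>. \<not> \<psi> (X 1 \<omega>)))"

definition censored_KL :: "(real \<Rightarrow> real) \<Rightarrow> (real \<Rightarrow> real) \<Rightarrow> strategy \<Rightarrow> real" where
  "censored_KL f0 f1 \<psi> = (\<integral>\<omega>. censored_llr f0 f1 \<psi> (\<psi> (X 1 \<omega>)) (X 1 \<omega>) \<partial>P f0 f1 1)"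

definition strategies_of_rate ::
  "(real \<Rightarrow> real) \<Rightarrow> (real \<Rightarrow> real) \<Rightarrow> real \<Rightarrow> strategy set" where
  "strategies_of_rate f0 f1 e =
     {\<psi>. Measurable.pred borel \<psi> \<and> \<P>(\<omega> in P f0 f1 \<infinity>. \<psi> (X 1 \<omega>)) = e}"

definition optimal_strategy ::
  "(real \<Rightarrow> real) \<Rightarrow> (real \<Rightarrow> real) \<Rightarrow> real \<Rightarrow> strategy \<Rightarrow> bool" where
  "optimal_strategy f0 f1 e \<psi> \<longleftrightarrow>
     \<psi> \<in> strategies_of_rate f0 f1 e \<and>
     (\<forall>\<psi>'\<in>strategies_of_rate f0 f1 e. censored_KL f0 f1 \<psi>' \<le> censored_KL f0 f1 \<psi>)"

text \<open>
  A policy assigns to each time \<open>k \<ge> 1\<close> and each outcome \<open>\<omega>\<close> the strategy \<open>\<psi>\<^sub>k\<close> used at time \<open>k\<close>.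
  That \<open>\<psi>\<^sub>k\<close> is determined by the information at time \<open>k - 1\<close> is expressed by joint measurability
  of \<open>(\<omega>, x) \<mapsto> \<psi>\<^sub>k(x)\<close> with respect to the \<open>\<sigma>\<close>-algebra \<open>info \<Psi> (k - 1)\<close> in the first argument.
\<close>
type_synonym policy = "nat \<Rightarrow> (nat \<Rightarrow> real) \<Rightarrow> strategy"

definition transmit :: "policy \<Rightarrow> nat \<Rightarrow> (nat \<Rightarrow> real) \<Rightarrow> bool" where
  "transmit \<Psi> k \<omega> = \<Psi> k \<omega> (X k \<omega>)"

text \<open>
  The \<open>\<sigma>\<close>-algebra generated by all \<open>(k, \<gamma>\<^sub>k, \<gamma>\<^sub>k X\<^sub>k)\<close> with \<open>1 \<le> k \<le> t\<close>.  The time \<open>t\<close> is an extended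
  natural number so that \<^const>\<open>stopping_time\<close> applies to stopping times that may be infinite.
\<close>
definition info :: "policy \<Rightarrow> enat \<Rightarrow> (nat \<Rightarrow> real) measure" where
  "info \<Psi> t =
     vimage_algebra UNIV
       (\<lambda>\<omega>. \<lambda>k\<in>{k. 1 \<le> k \<and> enat k \<le> t}. (transmit \<Psi> k \<omega>, of_bool (transmit \<Psi> k \<omega>) * X k \<omega>))
       (\<Pi>\<^sub>M k\<in>{k. 1 \<le> k \<and> enat k \<le> t}. count_space UNIV \<Otimes>\<^sub>M borel)"

definition censoring_policy :: "policy \<Rightarrow> bool" where
  "censoring_policy \<Psi> \<longleftrightarrow>
     (\<forall>k\<ge>1. Measurable.pred (info \<Psi> (enat (k - 1)) \<Otimes>\<^sub>M borel) (\<lambda>(\<omega>, x). \<Psi> k \<omega> x))"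

section \<open>Performance indices\<close>

type_synonym detection_time = "(nat \<Rightarrow> real) \<Rightarrow> enat"

definition arl :: "(real \<Rightarrow> real) \<Rightarrow> (real \<Rightarrow> real) \<Rightarrow> detection_time \<Rightarrow> ennreal" where
  "arl f0 f1 T = (\<integral>\<^sup>+\<omega>. ennreal_of_enat (T \<omega>) \<partial>P f0 f1 \<infinity>)"

definition comm_rate ::
  "(real \<Rightarrow> real) \<Rightarrow> (real \<Rightarrow> real) \<Rightarrow> detection_time \<Rightarrow> policy \<Rightarrow> ennreal" where
  "comm_rate f0 f1 T \<Psi> =
     limsup (\<lambda>n. cond_expect (P f0 f1 \<infinity>) (\<lambda>\<omega>. \<Sum>k=1..n. of_bool (transmit \<Psi> k \<omega>))
                   {\<omega>. enat n \<le> T \<omega>} / of_nat n)"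

text \<open>Subtraction on \<open>enat\<close> truncates at \<open>0\<close>, so \<open>T + 1 - \<nu>\<close> is the positive part \<open>(T - \<nu> + 1)\<^sup>+\<close>.\<close>
definition lorden_delay ::
  "(real \<Rightarrow> real) \<Rightarrow> (real \<Rightarrow> real) \<Rightarrow> detection_time \<Rightarrow> policy \<Rightarrow> ennreal" where
  "lorden_delay f0 f1 T \<Psi> =
     (SUP \<nu>\<in>{1::nat..}.
        esssup (P f0 f1 (enat \<nu>))
          (nn_cond_exp (P f0 f1 (enat \<nu>)) (info \<Psi> (enat (\<nu> - 1)))
             (\<lambda>\<omega>. ennreal_of_enat (T \<omega> + 1 - enat \<nu>))))"

definition feasible ::
  "(real \<Rightarrow> real) \<Rightarrow> (real \<Rightarrow> real) \<Rightarrow> real \<Rightarrow> real \<Rightarrow> (detection_time \<times> policy) set" where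
  "feasible f0 f1 \<epsilon> \<zeta> =
     {(T, \<Psi>). censoring_policy \<Psi> \<and> stopping_time (info \<Psi>) T \<and>
              ennreal \<zeta> \<le> arl f0 f1 T \<and> comm_rate f0 f1 T \<Psi> \<le> ennreal \<epsilon>}"

definition asymptotically_optimal ::
  "(real \<Rightarrow> real) \<Rightarrow> (real \<Rightarrow> real) \<Rightarrow> real \<Rightarrow> (real \<Rightarrow> detection_time \<times> policy) \<Rightarrow> bool" where
  "asymptotically_optimal f0 f1 \<epsilon> D \<longleftrightarrow>
     (\<forall>\<^sub>F \<zeta> in at_top. D \<zeta> \<in> feasible f0 f1 \<epsilon> \<zeta>) \<and>
     ((\<lambda>\<zeta>. case_prod (lorden_delay f0 f1) (D \<zeta>) /
            (INF (T, \<Psi>)\<in>feasible f0 f1 \<epsilon> \<zeta>. lorden_delay f0 f1 T \<Psi>)) \<longlongrightarrow> 1) at_top"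

section \<open>The CuSum-AC algorithm\<close>

text \<open>The argument \<open>\<psi>s\<close> is the fixed selection \<open>e \<mapsto> \<psi>\<^sup>*(e)\<close> of optimal strategies.\<close>

definition ac_strategy :: "(real \<Rightarrow> strategy) \<Rightarrow> real \<Rightarrow> real \<Rightarrow> real \<Rightarrow> strategy" where
  "ac_strategy \<psi>s a1 \<epsilon>1 s = (if s \<ge> a1 then \<psi>s 1 else \<psi>s \<epsilon>1)"

primrec ac_stat ::
  "(real \<Rightarrow> real) \<Rightarrow> (real \<Rightarrow> real) \<Rightarrow> (real \<Rightarrow> strategy) \<Rightarrow> real \<Rightarrow> real \<Rightarrow>
     nat \<Rightarrow> (nat \<Rightarrow> real) \<Rightarrow> real" where
  "ac_stat f0 f1 \<psi>s a1 \<epsilon>1 0 \<omega> = 0"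
| "ac_stat f0 f1 \<psi>s a1 \<epsilon>1 (Suc k) \<omega> =
     (let s = ac_stat f0 f1 \<psi>s a1 \<epsilon>1 k \<omega>;
          \<psi> = ac_strategy \<psi>s a1 \<epsilon>1 s;
          \<gamma> = \<psi> (X (Suc k) \<omega>);
          s' = max 0 (s + censored_llr f0 f1 \<psi> \<gamma> (X (Suc k) \<omega>))
      in if s < a1 \<and> s' \<ge> a1 then a1 else s')"

definition ac_policy ::
  "(real \<Rightarrow> real) \<Rightarrow> (real \<Rightarrow> real) \<Rightarrow> (real \<Rightarrow> strategy) \<Rightarrow> real \<Rightarrow> real \<Rightarrow> policy" where
  "ac_policy f0 f1 \<psi>s a1 \<epsilon>1 k \<omega> = ac_strategy \<psi>s a1 \<epsilon>1 (ac_stat f0 f1 \<psi>s a1 \<epsilon>1 (k - 1) \<omega>)"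

definition ac_time ::
  "(real \<Rightarrow> real) \<Rightarrow> (real \<Rightarrow> real) \<Rightarrow> (real \<Rightarrow> strategy) \<Rightarrow> real \<Rightarrow> real \<Rightarrow> ereal \<Rightarrow>
     detection_time" where
  "ac_time f0 f1 \<psi>s a1 \<epsilon>1 a \<omega> = first_time (\<lambda>k. ereal (ac_stat f0 f1 \<psi>s a1 \<epsilon>1 k \<omega>) \<ge> a)"

section \<open>Admissible choices of the censoring parameter\<close>

definition E_comm ::
  "(real \<Rightarrow> real) \<Rightarrow> (real \<Rightarrow> real) \<Rightarrow> (real \<Rightarrow> strategy) \<Rightarrow> real \<Rightarrow> real \<Rightarrow> real set" where
  "E_comm f0 f1 \<psi>s a1 \<epsilon> =
     {\<epsilon>1. 0 < \<epsilon>1 \<and> \<epsilon>1 \<le> 1 \<and>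
       (\<forall>a::ereal. ereal a1 < a \<longrightarrow>
          comm_rate f0 f1 (ac_time f0 f1 \<psi>s a1 \<epsilon>1 a) (ac_policy f0 f1 \<psi>s a1 \<epsilon>1) \<le> ennreal \<epsilon>)}"

definition exit_time ::
  "(real \<Rightarrow> real) \<Rightarrow> (real \<Rightarrow> real) \<Rightarrow> real \<Rightarrow> real \<Rightarrow> (nat \<Rightarrow> real) \<Rightarrow> enat" where
  "exit_time f0 f1 a1 a \<omega> = first_time (\<lambda>n. (\<Sum>k=1..n. llr f0 f1 (X k \<omega>)) \<notin> {0..a - a1})"

text \<open>Only meaningful where \<^const>\<open>exit_time\<close> is finite.\<close>
definition exit_stat ::
  "(real \<Rightarrow> real) \<Rightarrow> (real \<Rightarrow> real) \<Rightarrow> real \<Rightarrow> real \<Rightarrow> (nat \<Rightarrow> real) \<Rightarrow> real" where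
  "exit_stat f0 f1 a1 a \<omega> =
     max 0 (a1 + (\<Sum>k=1..the_enat (exit_time f0 f1 a1 a \<omega>). llr f0 f1 (X k \<omega>)))"

primrec low_stat ::
  "(real \<Rightarrow> real) \<Rightarrow> (real \<Rightarrow> real) \<Rightarrow> strategy \<Rightarrow> real \<Rightarrow> nat \<Rightarrow> (nat \<Rightarrow> real) \<Rightarrow> real" where
  "low_stat f0 f1 \<psi> z 0 \<omega> = z"
| "low_stat f0 f1 \<psi> z (Suc k) \<omega> =
     max 0 (low_stat f0 f1 \<psi> z k \<omega> + censored_llr f0 f1 \<psi> (\<psi> (X (Suc k) \<omega>)) (X (Suc k) \<omega>))"

definition return_time ::
  "(real \<Rightarrow> real) \<Rightarrow> (real \<Rightarrow> real) \<Rightarrow> strategy \<Rightarrow> real \<Rightarrow> real \<Rightarrow> (nat \<Rightarrow> real) \<Rightarrow> enat" where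
  "return_time f0 f1 \<psi> a1 z \<omega> = first_time (\<lambda>k. low_stat f0 f1 \<psi> z k \<omega> \<ge> a1)"

text \<open>\<open>shift n \<omega>\<close> is the sequence of the observations following time \<open>n\<close>.\<close>
definition shift :: "nat \<Rightarrow> (nat \<Rightarrow> real) \<Rightarrow> nat \<Rightarrow> real" where
  "shift n \<omega> i = \<omega> (n + i)"

primrec cusum :: "(real \<Rightarrow> real) \<Rightarrow> (real \<Rightarrow> real) \<Rightarrow> nat \<Rightarrow> (nat \<Rightarrow> real) \<Rightarrow> real" where
  "cusum f0 f1 0 \<omega> = 0"
| "cusum f0 f1 (Suc k) \<omega> = max 0 (cusum f0 f1 k \<omega> + llr f0 f1 (X (Suc k) \<omega>))"

definition cusum_time :: "(real \<Rightarrow> real) \<Rightarrow> (real \<Rightarrow> real) \<Rightarrow> real \<Rightarrow> detection_time" where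
  "cusum_time f0 f1 a1 \<omega> = first_time (\<lambda>k. cusum f0 f1 k \<omega> > a1)"

definition E_arl ::
  "(real \<Rightarrow> real) \<Rightarrow> (real \<Rightarrow> real) \<Rightarrow> (real \<Rightarrow> strategy) \<Rightarrow> real \<Rightarrow> real set" where
  "E_arl f0 f1 \<psi>s a1 =
     {\<epsilon>1. 0 < \<epsilon>1 \<and> \<epsilon>1 \<le> 1 \<and>
       (\<forall>a>a1.
          cond_expect (P f0 f1 \<infinity>)
            (\<lambda>\<omega>. ennreal_of_enat
                   (return_time f0 f1 (\<psi>s \<epsilon>1) a1 (exit_stat f0 f1 a1 a \<omega>)
                      (shift (the_enat (exit_time f0 f1 a1 a \<omega>)) \<omega>)))
            {\<omega>. exit_time f0 f1 a1 a \<omega> < \<infinity> \<and> exit_stat f0 f1 a1 a \<omega> < a1}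
          \<ge> arl f0 f1 (cusum_time f0 f1 a1))}"

definition E_star ::
  "(real \<Rightarrow> real) \<Rightarrow> (real \<Rightarrow> real) \<Rightarrow> (real \<Rightarrow> strategy) \<Rightarrow> real \<Rightarrow> real \<Rightarrow> real set" where
  "E_star f0 f1 \<psi>s a1 \<epsilon> = E_comm f0 f1 \<psi>s a1 \<epsilon> \<inter> E_arl f0 f1 \<psi>s a1"

end

theory Submission
  imports Defs "HOL-Real_Asymp.Real_Asymp"
begin

text \<open>
  False alarms.  Started at \<open>a1\<close>, the statistic is a random walk with steps \<open>llr\<close> until it leaves
  \<open>[a1, a)\<close>; a change of measure shows that it leaves upwards with probability at most \<open>exp (a1 - a)\<close>.
  Every excursion below \<open>a1\<close> lasts, on average and by the choice of \<open>\<epsilon>1\<close>, at least as long as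
  the CuSum time of level \<open>a1\<close>, hence at least \<open>exp a1\<close>.  By the strong Markov property at the ends of
  these excursions the run length is at least \<open>exp a1 * exp (a - a1)\<close>.

  Delay, upper bound.  Conditionally on the past, the delay is the hitting time of \<open>a\<close> from some state
  in \<open>[0, a)\<close> under the post-change law, and a Foster--Lyapunov function bounds it by
  \<open>(a + B) / J + K\<close>, where \<open>J\<close> is the mean of \<open>min llr B\<close> and \<open>K\<close> does not depend on \<open>a\<close>.

  Delay, lower bound.  If the mean time to false alarm is at least \<open>\<zeta>\<close>, some window of length \<open>m\<close> catches a
  false alarm with conditional probability at most \<open>2 * m / \<zeta>\<close>.  A change that happens at the start of this window
  is detected inside it with small probability as long as the log-likelihood ratio accumulated over the
  window stays well below \<open>ln \<zeta>\<close>, which the weak law of large numbers ensures for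
  \<open>m\<close> slightly less than \<open>ln \<zeta> / I\<close>.
\<close>

section \<open>First passage times\<close>

text \<open>Two features of the hypotheses shape the proof. Only first moments of \<open>llr\<close>
  are available, so the weak law needs clamping, and the delay bound truncates the drift at a level
  \<open>B\<close> that stays fixed while \<open>a\<close> grows. And \<open>E_arl\<close> bounds
  only the average length of an excursion below \<open>a1\<close>, not its length from each state.
  The average suffices because every return resets the statistic to exactly \<open>a1\<close>,
  whatever the overshoot. With \<open>p\<close> the probability of leaving downwards,
  \<open>t\<close> the mean CuSum time and \<open>V s\<close> the mean run length from
  \<open>s\<close>, this gives V a1 >= p * (t + V a1) and V 0 >= t + V a1, hence V 0 >= t / (1 - p).
  The second inequality uses that the return from 0 takes longest, so the average also bounds the
  first climb. The exit interval in \<open>E_arl\<close> is closed, while the alarm is raised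
  already at \<open>a\<close>; therefore the argument runs with a width \<open>b < a - a1\<close>,
  which then tends to \<open>a - a1\<close>. Independence of past and future is Fubini for spliced
  sequences, and random times are treated by summing over their values. The communication rate bound
  is built into \<open>E_comm\<close>.\<close>

lemma less_first_time_iff: "enat n < first_time Q \<longleftrightarrow> (\<forall>k\<in>{1..n}. \<not> Q k)"
proof -
  have "first_time Q \<le> enat n \<longleftrightarrow> (\<exists>k\<in>{1..n}. Q k)"
  proof
    assume "first_time Q \<le> enat n"
    then have "{k. 1 \<le> k \<and> Q k} \<noteq> {}"
      by (auto simp only: first_time_def image_empty Inf_empty top_enat_def)
    then obtain m where "m \<in> {k. 1 \<le> k \<and> Q k}" by blast
    then have "first_time Q \<in> enat ` {k. 1 \<le> k \<and> Q k}"
      unfolding first_time_def by (intro wellorder_InfI[of "enat m"] imageI)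
    then show "\<exists>k\<in>{1..n}. Q k"
      using \<open>first_time Q \<le> enat n\<close> by auto
  next
    assume "\<exists>k\<in>{1..n}. Q k"
    then show "first_time Q \<le> enat n"
      unfolding first_time_def by (auto intro: INF_lower2)
  qed
  then show ?thesis by (auto simp: not_le[symmetric])
qed

lemma first_time_le_iff: "first_time Q \<le> enat n \<longleftrightarrow> (\<exists>k\<in>{1..n}. Q k)"
  using less_first_time_iff[of n Q] by (auto simp: not_le[symmetric])

lemma first_time_eq_iff:
  "first_time Q = enat n \<longleftrightarrow> 1 \<le> n \<and> Q n \<and> (\<forall>k\<in>{1..<n}. \<not> Q k)"
proof -
  have "first_time Q = enat n \<longleftrightarrow> first_time Q \<le> enat n \<and> (n = 0 \<or> enat (n - 1) < first_time Q)"
    by (cases "first_time Q") auto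
  also have "\<dots> \<longleftrightarrow> 1 \<le> n \<and> Q n \<and> (\<forall>k\<in>{1..<n}. \<not> Q k)"
  proof (cases n)
    case (Suc m)
    then show ?thesis
      unfolding first_time_le_iff less_first_time_iff by (auto simp: atLeastAtMostSuc_conv le_Suc_eq)
  qed (simp add: first_time_le_iff)
  finally show ?thesis .
qed

lemma first_time_shift:
  assumes "\<forall>k\<in>{1..n}. \<not> Q k"
  shows "first_time Q = enat n + first_time (\<lambda>k. Q (n + k))"
proof (rule antisym)
  show "first_time Q \<le> enat n + first_time (\<lambda>k. Q (n + k))"
  proof (cases "first_time (\<lambda>k. Q (n + k))")
    case (enat m)
    then have "first_time Q \<le> enat (n + m)"
      unfolding first_time_le_iff by (intro bexI[of _ "n + m"]) (auto simp: first_time_eq_iff)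
    then show ?thesis by (simp add: enat)
  qed auto
  show "enat n + first_time (\<lambda>k. Q (n + k)) \<le> first_time Q"
  proof (cases "first_time Q")
    case (enat m)
    then have m: "1 \<le> m" "Q m" by (auto simp: first_time_eq_iff)
    then have "n < m" using assms by (metis atLeastAtMost_iff not_less)
    then have "first_time (\<lambda>k. Q (n + k)) \<le> enat (m - n)"
      using m by (auto simp: first_time_le_iff intro!: bexI[of _ "m - n"])
    then have "enat n + first_time (\<lambda>k. Q (n + k)) \<le> enat n + enat (m - n)"
      by (rule add_left_mono)
    then show ?thesis using \<open>n < m\<close> enat by simp
  qed auto
qed

text \<open>Tail-sum form. It turns mean times into sums of the probabilities of
  \<open>enat j < T\<close>, and gives measurability of times from that of these events.\<close>

lemma ennreal_of_enat_eq_suminf: "ennreal_of_enat T = (\<Sum>j. of_bool (enat j < T))"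
proof (cases T)
  case (enat n)
  have "(\<Sum>j. of_bool (enat j < T)) = (\<Sum>j<n. of_bool (enat j < T) :: ennreal)"
    by (rule suminf_finite) (auto simp: enat)
  then show ?thesis
    by (simp add: enat)
next
  case infinity
  have "(\<Sum>j. 1::ennreal) = top"
    by (auto intro!: suminf_eq_SUP[THEN trans] simp: ennreal_SUP_of_nat_eq_top)
  then show ?thesis by (simp add: infinity)
qed

lemma ennreal_of_enat_add: "ennreal_of_enat (enat n + T) = of_nat n + ennreal_of_enat T"
  by (cases T) auto

section \<open>Sequences of independent observations\<close>

lemma nn_integral_of_bool:
  assumes [measurable]: "Measurable.pred M Q"
  shows "(\<integral>\<^sup>+x. of_bool (Q x) \<partial>M) = emeasure M {x \<in> space M. Q x}"
proof -
  have "(\<integral>\<^sup>+x. of_bool (Q x) \<partial>M) = (\<integral>\<^sup>+x. indicator {x \<in> space M. Q x} x \<partial>M)"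
    by (intro nn_integral_cong) (auto simp: indicator_def)
  then show ?thesis by simp
qed

text \<open>For splitting an integrand by the value of a random time, where at most one summand is
  active.\<close>

lemma suminf_of_bool_unique:
  assumes "\<And>n. Q n \<Longrightarrow> n = m"
  shows "(\<Sum>n. of_bool (Q n) * (h n :: ennreal)) = of_bool (Q m) * h m"
proof -
  have "(\<Sum>n. of_bool (Q n) * h n) = (\<Sum>n\<in>{m}. of_bool (Q n) * h n)"
    using assms by (intro suminf_finite) auto
  then show ?thesis by simp
qed

text \<open>A pointwise substitute for measurability with respect to the first \<open>n\<close>
  coordinates, that is, the observations up to time \<open>n\<close>. Together with product
  measurability it lets Fubini take the place of conditioning.\<close>

definition depends_on_first :: "nat \<Rightarrow> ((nat \<Rightarrow> real) \<Rightarrow> 'a) \<Rightarrow> bool" where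
  "depends_on_first n F \<longleftrightarrow> (\<forall>\<omega> \<omega>'. (\<forall>i<n. \<omega> i = \<omega>' i) \<longrightarrow> F \<omega> = F \<omega>')"

lemma depends_on_firstD:
  "depends_on_first n F \<Longrightarrow> (\<And>i. i < n \<Longrightarrow> \<omega> i = \<omega>' i) \<Longrightarrow> F \<omega> = F \<omega>'"
  by (auto simp: depends_on_first_def)

lemma depends_on_first_map2:
  "depends_on_first n F \<Longrightarrow> depends_on_first n G \<Longrightarrow> depends_on_first n (\<lambda>\<omega>. h (F \<omega>) (G \<omega>))"
  unfolding depends_on_first_def by (intro allI impI arg_cong2[where f = h]) simp_all

lemma depends_on_first_comb_seq: "depends_on_first n F \<Longrightarrow> F (comb_seq n \<omega> \<omega>') = F \<omega>"
  by (erule depends_on_firstD) (simp add: comb_seq_def)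

lemma shift_comb_seq: "shift n (comb_seq n \<omega> \<omega>') = \<omega>'"
  by (auto simp: shift_def comb_seq_def)

lemma measurable_shift [measurable]:
  "shift n \<in> PiM UNIV (\<lambda>_. M) \<rightarrow>\<^sub>M PiM UNIV (\<lambda>_. M)"
proof -
  have "(\<lambda>\<omega>. \<lambda>i. \<omega> (n + i)) \<in> PiM UNIV (\<lambda>_. M) \<rightarrow>\<^sub>M PiM UNIV (\<lambda>_. M)"
    by (rule measurable_PiM_single') (auto simp: space_PiM)
  then show ?thesis
    by (simp add: shift_def[abs_def])
qed

text \<open>Splicing \<open>n\<close> coordinates of one i.i.d. sequence onto an independent
  sequence with another law; for \<open>n = \<nu> - 1\<close> this is the law with change point
  \<open>\<nu>\<close>. Both sides are compared on finite-dimensional cylinders.\<close>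

lemma PiM_comb_seq_two:
  assumes "prob_space M" "prob_space N" and MN: "sets M = sets N"
  shows "distr (PiM UNIV (\<lambda>_. M) \<Otimes>\<^sub>M PiM UNIV (\<lambda>_. N)) (PiM UNIV (\<lambda>_. M)) (\<lambda>(\<omega>, \<omega>'). comb_seq n \<omega> \<omega>')
       = PiM UNIV (\<lambda>i. if i < n then M else N)" (is "?D = _")
proof -
  interpret M: prob_space M by fact
  interpret N: prob_space N by fact
  interpret MN: product_prob_space "\<lambda>i::nat. if i < n then M else N" UNIV
    by (intro product_prob_spaceI) (auto intro: assms)
  interpret MS: sequence_space M by standard
  interpret NS: product_prob_space "\<lambda>_::nat. N" UNIV by standard
  have sp: "space M = space N" by (rule sets_eq_imp_space_eq) fact
  let ?I = "UNIV::nat set"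
  let ?f = "\<lambda>(\<omega>, \<omega>'). comb_seq n \<omega> \<omega>'"
  have setsMN: "sets (PiM ?I (\<lambda>_. M)) = sets (PiM ?I (\<lambda>_. N))"
    by (intro sets_PiM_cong) (simp_all add: MN)
  have m: "?f \<in> PiM ?I (\<lambda>_. M) \<Otimes>\<^sub>M PiM ?I (\<lambda>_. N) \<rightarrow>\<^sub>M PiM ?I (\<lambda>_. M)"
    using measurable_comb_seq[of n M]
    by (simp add: measurable_cong_sets[OF sets_pair_measure_cong[OF refl setsMN] refl])
  show ?thesis
  proof (rule MN.PiM_eq)
    show "sets ?D = sets (PiM UNIV (\<lambda>i. if i < n then M else N))"
      by (simp, intro sets_PiM_cong) (simp_all add: MN)
    fix J E assume J: "finite J" "J \<subseteq> ?I" "\<And>j. j \<in> J \<Longrightarrow> E j \<in> sets (if j < n then M else N)"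
    have JM: "E j \<in> sets M" if "j \<in> J" for j using J(3)[OF that] by (simp add: MN split: if_splits)
    have JN: "E j \<in> sets N" if "j \<in> J" for j using JM[OF that] by (simp add: MN)
    let ?X = "prod_emb ?I (\<lambda>i. if i < n then M else N) J (\<Pi>\<^sub>E j\<in>J. E j)"
    have X: "?X = prod_emb ?I (\<lambda>_. M) J (\<Pi>\<^sub>E j\<in>J. E j)"
      by (auto simp: prod_emb_def sp split: if_splits)
    have "\<And>j x. j \<in> J \<Longrightarrow> x \<in> E j \<Longrightarrow> x \<in> space M"
      using JM[THEN sets.sets_into_space] by auto
    \<comment> \<open>The preimage of a cylinder is a rectangle: indices below \<open>n\<close>
      constrain the first sequence, the others, moved back by \<open>n\<close>, the second.\<close>
    with J(1,2) have *: "?f -` ?X \<inter> space (PiM ?I (\<lambda>_. M) \<Otimes>\<^sub>M PiM ?I (\<lambda>_. N)) =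
      (prod_emb ?I (\<lambda>_. M) (J \<inter> {..<n}) (\<Pi>\<^sub>E j\<in>J \<inter> {..<n}. E j)) \<times>
      (prod_emb ?I (\<lambda>_. N) (((+) n) -` J) (\<Pi>\<^sub>E j\<in>((+) n) -` J. E (n + j)))" (is "_ = ?E \<times> ?F")
      unfolding X
      by (auto simp: space_pair_measure space_PiM prod_emb_def all_conj_distrib PiE_iff sp
               split: split_comb_seq split_comb_seq_asm)
    have "emeasure ?D ?X = emeasure (PiM ?I (\<lambda>_. M) \<Otimes>\<^sub>M PiM ?I (\<lambda>_. N)) (?E \<times> ?F)"
      unfolding *[symmetric] by (rule emeasure_distr[OF m]) (unfold X, intro sets_PiM_I[OF J(1,2)] ballI JM)
    also have "\<dots> = emeasure (PiM ?I (\<lambda>_. M)) ?E * emeasure (PiM ?I (\<lambda>_. N)) ?F"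
      using J(1) JM JN by (intro NS.P.emeasure_pair_measure_Times)
        (auto intro!: sets_PiM_I finite_vimageI simp: inj_on_def)
    also have "emeasure (PiM ?I (\<lambda>_. N)) ?F = (\<Prod>j\<in>((+) n) -` J. emeasure N (E (n + j)))"
      using J(1) JN by (intro NS.emeasure_PiM_emb) (simp_all add: finite_vimageI inj_on_def)
    also have "\<dots> = (\<Prod>j\<in>J - (J \<inter> {..<n}). emeasure (if j < n then M else N) (E j))"
      by (rule prod.reindex_cong [of "\<lambda>x. x - n"])
        (auto simp: image_iff ac_simps MS.nat_eq_diff_eq cong: conj_cong intro!: inj_onI)
    also have "emeasure (PiM ?I (\<lambda>_. M)) ?E = (\<Prod>j\<in>J \<inter> {..<n}. emeasure M (E j))"
      using J(1) JM by (intro MS.emeasure_PiM_emb) simp_all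
    also have "\<dots> = (\<Prod>j\<in>J \<inter> {..<n}. emeasure (if j < n then M else N) (E j))"
      by (intro prod.cong) auto
    also have "\<dots> * (\<Prod>j\<in>J - (J \<inter> {..<n}). emeasure (if j < n then M else N) (E j))
        = (\<Prod>j\<in>J. emeasure (if j < n then M else N) (E j))"
      by (subst mult.commute, rule prod.subset_diff[symmetric]) (auto simp: J(1))
    finally show "emeasure ?D ?X = (\<Prod>j\<in>J. emeasure (if j < n then M else N) (E j))" .
  qed
qed

locale iid = prob_space M for M :: "real measure" +
  assumes sets_M [measurable_cong]: "sets M = sets borel"
begin

lemma prob_space_M: "prob_space M"
  by (rule prob_space_axioms)

lemma finite_measure_M: "finite_measure M"
  by (rule prob_space.axioms(1)[OF prob_space_M])

lemma sigma_finite_measure_M: "sigma_finite_measure M"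
  by (rule prob_space_imp_sigma_finite[OF prob_space_M])

lemma emeasure_M: "emeasure M A = ennreal (measure M A)"
  by (rule finite_measure.emeasure_eq_measure[OF finite_measure_M])

lemma measure_M_UNIV: "measure M UNIV = 1"
  using prob_space.prob_space[OF prob_space_M] sets_eq_imp_space_eq[OF sets_M] by simp

lemma integrable_const_M: "integrable M (\<lambda>_. c :: real)"
  by (rule finite_measure.integrable_const[OF finite_measure_M])

sublocale sequence_space M ..

lemma space_M [simp]: "space M = UNIV"
  using sets_eq_imp_space_eq[OF sets_M] by simp

lemma space_S [simp]: "space S = UNIV"
  by (simp add: space_PiM)

text \<open>Markov property at a fixed time: the first \<open>n\<close> coordinates are independent
  of the shifted sequence, so the future may be replaced by an independent copy.\<close>

lemma nn_integral_shift:
  assumes h: "case_prod h \<in> borel_measurable (S \<Otimes>\<^sub>M S)"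
    and dep: "\<And>\<omega>'. depends_on_first n (\<lambda>\<omega>. h \<omega> \<omega>')"
  shows "(\<integral>\<^sup>+\<omega>. h \<omega> (shift n \<omega>) \<partial>S) = (\<integral>\<^sup>+\<omega>. (\<integral>\<^sup>+\<omega>'. h \<omega> \<omega>' \<partial>S) \<partial>S)"
proof -
  note [measurable] = h measurable_comb_seq
  have "(\<integral>\<^sup>+\<omega>. h \<omega> (shift n \<omega>) \<partial>S) =
      (\<integral>\<^sup>+\<omega>. h \<omega> (shift n \<omega>) \<partial>distr (S \<Otimes>\<^sub>M S) S (\<lambda>(\<omega>, \<omega>'). comb_seq n \<omega> \<omega>'))"
    by (simp add: PiM_comb_seq)
  also have "\<dots> = (\<integral>\<^sup>+z. case_prod h z \<partial>(S \<Otimes>\<^sub>M S))"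
    by (subst nn_integral_distr)
      (auto simp: shift_comb_seq depends_on_first_comb_seq[OF dep] split_beta' intro!: nn_integral_cong)
  also have "\<dots> = (\<integral>\<^sup>+\<omega>. (\<integral>\<^sup>+\<omega>'. h \<omega> \<omega>' \<partial>S) \<partial>S)"
    by (subst P.nn_integral_fst[symmetric]) auto
  finally show ?thesis .
qed

lemma distr_component: "distr S M (\<lambda>\<omega>. \<omega> i) = M"
  by (rule distr_PiM_component) (auto intro: prob_space_M)

lemma nn_integral_component:
  assumes [measurable]: "h \<in> borel_measurable borel"
  shows "(\<integral>\<^sup>+\<omega>. h (\<omega> i) \<partial>S) = (\<integral>\<^sup>+x. h x \<partial>M)"
  by (subst (2) distr_component[of i, symmetric], subst nn_integral_distr) auto

text \<open>Coordinate \<open>n\<close> carries the observation at time \<open>n + 1\<close>, which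
  is independent of everything decided by the first \<open>n\<close> coordinates.\<close>

lemma nn_integral_next:
  assumes h [measurable]: "case_prod h \<in> borel_measurable (S \<Otimes>\<^sub>M borel)"
    and dep: "\<And>x. depends_on_first n (\<lambda>\<omega>. h \<omega> x)"
  shows "(\<integral>\<^sup>+\<omega>. h \<omega> (\<omega> n) \<partial>S) = (\<integral>\<^sup>+\<omega>. (\<integral>\<^sup>+x. h \<omega> x \<partial>M) \<partial>S)"
proof -
  have "(\<integral>\<^sup>+\<omega>. h \<omega> (\<omega> n) \<partial>S) = (\<integral>\<^sup>+\<omega>. (\<lambda>\<omega> \<omega>'. h \<omega> (\<omega>' 0)) \<omega> (shift n \<omega>) \<partial>S)"
    by (simp add: shift_def)
  also have "\<dots> = (\<integral>\<^sup>+\<omega>. (\<integral>\<^sup>+\<omega>'. h \<omega> (\<omega>' 0) \<partial>S) \<partial>S)"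
    by (subst nn_integral_shift) (auto simp: dep)
  also have "\<dots> = (\<integral>\<^sup>+\<omega>. (\<integral>\<^sup>+x. h \<omega> x \<partial>M) \<partial>S)"
    by (intro nn_integral_cong nn_integral_component) auto
  finally show ?thesis .
qed

end

section \<open>Markov recursions and their hitting times\<close>

text \<open>CuSum, the random walk, the statistic below \<open>a1\<close> and the CuSum-AC statistic
  are all of this form, so measurability, the Markov property and the drift criteria are proved
  once. In \<open>hit\<close> the starting state does not count, as \<open>first_time\<close> begins
  at 1.\<close>

primrec run :: "(real \<Rightarrow> real \<Rightarrow> real) \<Rightarrow> real \<Rightarrow> nat \<Rightarrow> (nat \<Rightarrow> real) \<Rightarrow> real" where
  "run f s 0 \<omega> = s"
| "run f s (Suc k) \<omega> = f (run f s k \<omega>) (\<omega> k)"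

definition hit :: "(real \<Rightarrow> real \<Rightarrow> real) \<Rightarrow> real set \<Rightarrow> real \<Rightarrow> (nat \<Rightarrow> real) \<Rightarrow> enat" where
  "hit f B s \<omega> = first_time (\<lambda>k. run f s k \<omega> \<in> B)"

lemma run_add: "run f s (n + k) \<omega> = run f (run f s n \<omega>) k (shift n \<omega>)"
  by (induction k) (auto simp: shift_def)

lemma depends_on_first_run: "depends_on_first n (run f s n)"
  unfolding depends_on_first_def
proof (induction n)
  case (Suc n)
  show ?case
  proof (intro allI impI)
    fix \<omega> \<omega>' :: "nat \<Rightarrow> real" assume "\<forall>i<Suc n. \<omega> i = \<omega>' i"
    moreover from this have "run f s n \<omega> = run f s n \<omega>'" using Suc.IH by (metis less_SucI)
    ultimately show "run f s (Suc n) \<omega> = run f s (Suc n) \<omega>'" by simp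
  qed
qed simp

lemma run_cong: "(\<And>i. i < n \<Longrightarrow> \<omega> i = \<omega>' i) \<Longrightarrow> run f s n \<omega> = run f s n \<omega>'"
  using depends_on_first_run[of n f s] by (auto simp: depends_on_first_def)

lemma depends_on_first_less_hit: "depends_on_first n (\<lambda>\<omega>. enat n < hit f B s \<omega>)"
  unfolding depends_on_first_def hit_def less_first_time_iff
proof (intro allI impI ball_cong refl)
  fix \<omega> \<omega>' :: "nat \<Rightarrow> real" and k assume "\<forall>i<n. \<omega> i = \<omega>' i" "k \<in> {1..n}"
  then have "run f s k \<omega> = run f s k \<omega>'" by (intro run_cong) auto
  then show "(run f s k \<omega> \<notin> B) = (run f s k \<omega>' \<notin> B)" by simp
qed

lemma depends_on_first_hit_eq: "depends_on_first n (\<lambda>\<omega>. hit f B s \<omega> = enat n)"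
  unfolding depends_on_first_def hit_def first_time_eq_iff
proof (intro allI impI conj_cong ball_cong refl)
  fix \<omega> \<omega>' :: "nat \<Rightarrow> real" assume *: "\<forall>i<n. \<omega> i = \<omega>' i"
  then show "(run f s n \<omega> \<in> B) = (run f s n \<omega>' \<in> B)" using run_cong[of n \<omega> \<omega>' f s] by simp
  fix k assume "k \<in> {1..<n}"
  with * have "run f s k \<omega> = run f s k \<omega>'" by (intro run_cong) auto
  then show "(run f s k \<omega> \<notin> B) = (run f s k \<omega>' \<notin> B)" by simp
qed

lemma hit_shift:
  assumes "enat n < hit f B s \<omega>"
  shows "hit f B s \<omega> = enat n + hit f B (run f s n \<omega>) (shift n \<omega>)"
  using assms unfolding hit_def less_first_time_iff
  by (subst first_time_shift) (auto simp: run_add)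

context iid
begin

lemma measurable_run [measurable (raw)]:
  assumes [measurable]: "case_prod f \<in> borel_measurable (borel \<Otimes>\<^sub>M borel)"
    and g [measurable]: "g \<in> borel_measurable N" "w \<in> N \<rightarrow>\<^sub>M S"
  shows "(\<lambda>x. run f (g x) k (w x)) \<in> borel_measurable N"
proof (induction k)
  case (Suc k)
  have "(\<lambda>x. w x k) \<in> N \<rightarrow>\<^sub>M M"
    by (rule measurable_compose[OF g(2) measurable_component_singleton]) simp
  then have [measurable]: "(\<lambda>x. w x k) \<in> borel_measurable N"
    by (simp add: measurable_cong_sets[OF refl sets_M])
  note [measurable] = Suc.IH
  have "(\<lambda>x. case_prod f (run f (g x) k (w x), w x k)) \<in> borel_measurable N"
    by measurable
  then show ?case by simp
qed simp

lemma measurable_less_hit [measurable (raw)]: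
  assumes [measurable]: "case_prod f \<in> borel_measurable (borel \<Otimes>\<^sub>M borel)" "B \<in> sets borel"
    and g [measurable]: "g \<in> borel_measurable N" "w \<in> N \<rightarrow>\<^sub>M S"
  shows "Measurable.pred N (\<lambda>x. enat n < hit f B (g x) (w x))"
  unfolding hit_def less_first_time_iff by measurable

lemma less_hit_sets [measurable]:
  assumes [measurable]: "case_prod f \<in> borel_measurable (borel \<Otimes>\<^sub>M borel)" "B \<in> sets borel"
  shows "{\<omega>. enat n < hit f B s \<omega>} \<in> sets S"
proof -
  have "{\<omega> \<in> space S. enat n < hit f B s \<omega>} \<in> sets S" by measurable
  then show ?thesis by simp
qed

lemma measurable_hit_eq [measurable (raw)]:
  assumes [measurable]: "case_prod f \<in> borel_measurable (borel \<Otimes>\<^sub>M borel)" "B \<in> sets borel"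
    and g [measurable]: "g \<in> borel_measurable N" "w \<in> N \<rightarrow>\<^sub>M S"
  shows "Measurable.pred N (\<lambda>x. hit f B (g x) (w x) = enat n)"
  unfolding hit_def first_time_eq_iff by measurable

lemma measurable_hit [measurable (raw)]:
  assumes [measurable]: "case_prod f \<in> borel_measurable (borel \<Otimes>\<^sub>M borel)" "B \<in> sets borel"
    and g [measurable]: "g \<in> borel_measurable N" "w \<in> N \<rightarrow>\<^sub>M S"
  shows "(\<lambda>x. ennreal_of_enat (hit f B (g x) (w x))) \<in> borel_measurable N"
  unfolding ennreal_of_enat_eq_suminf by measurable

lemma expected_hit:
  assumes [measurable]: "case_prod f \<in> borel_measurable (borel \<Otimes>\<^sub>M borel)" "B \<in> sets borel"
  shows "(\<integral>\<^sup>+\<omega>. ennreal_of_enat (hit f B s \<omega>) \<partial>S) = (\<Sum>j. emeasure S {\<omega>. enat j < hit f B s \<omega>})"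
  unfolding ennreal_of_enat_eq_suminf by (subst nn_integral_suminf) (simp_all add: nn_integral_of_bool)

text \<open>The event of not having hit by time \<open>n\<close> is decided by the first
  \<open>n\<close> coordinates and factors out of the integral over the fresh one. Both drift
  criteria below iterate this step.\<close>

lemma run_next:
  assumes [measurable]: "case_prod f \<in> borel_measurable (borel \<Otimes>\<^sub>M borel)" "B \<in> sets borel"
    "g \<in> borel_measurable borel"
  shows "(\<integral>\<^sup>+\<omega>. g (run f s (Suc n) \<omega>) * of_bool (enat n < hit f B s \<omega>) \<partial>S)
       = (\<integral>\<^sup>+\<omega>. (\<integral>\<^sup>+x. g (f (run f s n \<omega>) x) \<partial>M) * of_bool (enat n < hit f B s \<omega>) \<partial>S)"
proof -
  have m: "(\<lambda>z. f (run f s n (fst z)) (snd z)) \<in> borel_measurable (S \<Otimes>\<^sub>M borel)"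
  proof -
    have "(\<lambda>z. case_prod f (run f s n (fst z), snd z)) \<in> borel_measurable (S \<Otimes>\<^sub>M borel)"
      by measurable
    then show ?thesis by simp
  qed
  note [measurable] = m
  have "(\<integral>\<^sup>+\<omega>. g (run f s (Suc n) \<omega>) * of_bool (enat n < hit f B s \<omega>) \<partial>S)
     = (\<integral>\<^sup>+\<omega>. (\<lambda>\<omega> x. g (f (run f s n \<omega>) x) * of_bool (enat n < hit f B s \<omega>)) \<omega> (\<omega> n) \<partial>S)"
    by simp
  also have "\<dots> = (\<integral>\<^sup>+\<omega>. (\<integral>\<^sup>+x. g (f (run f s n \<omega>) x) * of_bool (enat n < hit f B s \<omega>) \<partial>M) \<partial>S)"
  proof (rule nn_integral_next)
    show "(\<lambda>(\<omega>, x). g (f (run f s n \<omega>) x) * of_bool (enat n < hit f B s \<omega>))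
        \<in> borel_measurable (S \<Otimes>\<^sub>M borel)"
      unfolding split_beta' by measurable
    show "depends_on_first n (\<lambda>\<omega>. g (f (run f s n \<omega>) x) * of_bool (enat n < hit f B s \<omega>))" for x
      by (rule depends_on_first_map2[OF depends_on_first_run depends_on_first_less_hit, where h = "\<lambda>t u. g (f t x) * of_bool u"])
  qed
  also have "\<dots> = (\<integral>\<^sup>+\<omega>. (\<integral>\<^sup>+x. g (f (run f s n \<omega>) x) \<partial>M) * of_bool (enat n < hit f B s \<omega>) \<partial>S)"
    by (intro nn_integral_cong) (auto simp: of_bool_def)
  finally show ?thesis .
qed

text \<open>Foster--Lyapunov: \<open>g\<close> decreases by one on average at each step outside \<open>B\<close>.\<close>
lemma expected_hit_le:
  assumes f [measurable]: "case_prod f \<in> borel_measurable (borel \<Otimes>\<^sub>M borel)"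
    and B [measurable]: "B \<in> sets borel" and g [measurable]: "g \<in> borel_measurable borel"
    and drift: "\<And>s. s \<notin> B \<Longrightarrow> 1 + (\<integral>\<^sup>+x. g (f s x) * of_bool (f s x \<notin> B) \<partial>M) \<le> g s"
    and s: "s \<notin> B"
  shows "(\<integral>\<^sup>+\<omega>. ennreal_of_enat (hit f B s \<omega>) \<partial>S) \<le> g s"
proof -
  define A where "A n = (\<integral>\<^sup>+\<omega>. g (run f s n \<omega>) * of_bool (enat n < hit f B s \<omega>) \<partial>S)" for n
  have step: "A (Suc n) + emeasure S {\<omega>. enat n < hit f B s \<omega>} \<le> A n" for n
  proof -
    let ?g = "\<lambda>x. g x * of_bool (x \<notin> B)"
    \<comment> \<open>Not having hit by time \<open>n + 1\<close> means not having hit by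
      \<open>n\<close> and a new state outside \<open>B\<close>; the second condition is absorbed
      into \<open>g\<close>, so values of \<open>g\<close> on \<open>B\<close> never enter.\<close>
    have "A (Suc n) = (\<integral>\<^sup>+\<omega>. ?g (run f s (Suc n) \<omega>) * of_bool (enat n < hit f B s \<omega>) \<partial>S)"
      unfolding A_def hit_def less_first_time_iff
      by (intro nn_integral_cong) (auto simp: atLeastAtMostSuc_conv of_bool_def simp del: run.simps)
    also have "\<dots> = (\<integral>\<^sup>+\<omega>. (\<integral>\<^sup>+x. ?g (f (run f s n \<omega>) x) \<partial>M) * of_bool (enat n < hit f B s \<omega>) \<partial>S)"
      by (rule run_next) measurable
    finally have "A (Suc n) + emeasure S {\<omega>. enat n < hit f B s \<omega>}
       = (\<integral>\<^sup>+\<omega>. (\<integral>\<^sup>+x. ?g (f (run f s n \<omega>) x) \<partial>M) * of_bool (enat n < hit f B s \<omega>) \<partial>S)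
         + (\<integral>\<^sup>+\<omega>. of_bool (enat n < hit f B s \<omega>) \<partial>S)"
      by (subst nn_integral_of_bool) simp_all
    also have "\<dots> = (\<integral>\<^sup>+\<omega>. (\<integral>\<^sup>+x. ?g (f (run f s n \<omega>) x) \<partial>M) * of_bool (enat n < hit f B s \<omega>)
        + of_bool (enat n < hit f B s \<omega>) \<partial>S)"
    proof (rule nn_integral_add[symmetric])
      have m: "(\<lambda>z. f (run f s n (fst z)) (snd z)) \<in> borel_measurable (S \<Otimes>\<^sub>M M)"
      proof -
        have "(\<lambda>z. case_prod f (run f s n (fst z), snd z)) \<in> borel_measurable (S \<Otimes>\<^sub>M M)"
          by measurable
        then show ?thesis by simp
      qed
      note [measurable] = m
      have [measurable]: "(\<lambda>\<omega>. \<integral>\<^sup>+x. ?g (f (run f s n \<omega>) x) \<partial>M) \<in> borel_measurable S"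
        by (rule sigma_finite_measure.borel_measurable_nn_integral[OF sigma_finite_measure_M]) (unfold split_beta', measurable)
      show "(\<lambda>\<omega>. (\<integral>\<^sup>+x. ?g (f (run f s n \<omega>) x) \<partial>M) * of_bool (enat n < hit f B s \<omega>)) \<in> borel_measurable S"
        by measurable
      show "(\<lambda>\<omega>. of_bool (enat n < hit f B s \<omega>)) \<in> borel_measurable S"
        by measurable
    qed
    also have "\<dots> \<le> A n"
      unfolding A_def
    proof (rule nn_integral_mono)
      fix \<omega>
      have "run f s n \<omega> \<notin> B" if "enat n < hit f B s \<omega>"
        using that s unfolding hit_def less_first_time_iff by (cases n) (auto simp del: run.simps(2))
      then show "(\<integral>\<^sup>+x. ?g (f (run f s n \<omega>) x) \<partial>M) * of_bool (enat n < hit f B s \<omega>)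
        + of_bool (enat n < hit f B s \<omega>) \<le> g (run f s n \<omega>) * of_bool (enat n < hit f B s \<omega>)"
        using drift[of "run f s n \<omega>"] by (auto simp: of_bool_def add.commute)
    qed
    finally show ?thesis .
  qed
  have "A 0 \<le> g s"
  proof -
    have "A 0 \<le> (\<integral>\<^sup>+\<omega>. g s \<partial>S)"
      unfolding A_def by (intro nn_integral_mono) (auto simp: of_bool_def)
    then show ?thesis using P.emeasure_space_1 by simp
  qed
  \<comment> \<open>Telescoping \<open>step\<close>; the sum converges to the expected hitting
    time.\<close>
  moreover have "(\<Sum>j<n. emeasure S {\<omega>. enat j < hit f B s \<omega>}) + A n \<le> A 0" for n
  proof (induction n)
    case (Suc n)
    have "(\<Sum>j<Suc n. emeasure S {\<omega>. enat j < hit f B s \<omega>}) + A (Suc n)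
        = (\<Sum>j<n. emeasure S {\<omega>. enat j < hit f B s \<omega>}) + (A (Suc n) + emeasure S {\<omega>. enat n < hit f B s \<omega>})"
      by (simp add: ac_simps)
    also have "\<dots> \<le> (\<Sum>j<n. emeasure S {\<omega>. enat j < hit f B s \<omega>}) + A n"
      by (intro add_left_mono step)
    also have "\<dots> \<le> A 0" by (rule Suc)
    finally show ?case .
  qed simp
  ultimately have "(\<Sum>j<n. emeasure S {\<omega>. enat j < hit f B s \<omega>}) + A n \<le> g s" for n
    by (rule order_trans[rotated])
  then have "(\<Sum>j<n. emeasure S {\<omega>. enat j < hit f B s \<omega>}) \<le> g s" for n
    using order_trans[OF add_increasing2[OF zero_le order_refl]] by blast
  then show ?thesis
    unfolding expected_hit[OF f B] by (intro suminf_le_const) auto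
qed

text \<open>Optional stopping for \<open>y\<close> of the state minus the elapsed time, a
  supermartingale that starts at 0: at the hitting time \<open>y\<close> is at least
  \<open>A\<close>, so the mean time is at least \<open>A\<close>. An infinite mean is trivial, and
  a finite one makes the hitting time almost surely finite.\<close>

lemma le_expected_hit:
  assumes f [measurable]: "case_prod f \<in> borel_measurable (borel \<Otimes>\<^sub>M borel)"
    and B [measurable]: "B \<in> sets borel" and y [measurable]: "y \<in> borel_measurable borel"
    and drift: "\<And>s. s \<notin> B \<Longrightarrow> (\<integral>\<^sup>+x. y (f s x) \<partial>M) \<le> 1 + y s"
    and large: "\<And>s. s \<in> B \<Longrightarrow> ennreal A \<le> y s" and A: "0 \<le> A"
    and s: "s \<notin> B" "y s = 0"
  shows "ennreal A \<le> (\<integral>\<^sup>+\<omega>. ennreal_of_enat (hit f B s \<omega>) \<partial>S)"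
proof (cases "(\<integral>\<^sup>+\<omega>. ennreal_of_enat (hit f B s \<omega>) \<partial>S) = top")
  case False
  define p where "p n = measure S {\<omega>. enat n < hit f B s \<omega>}" for n
  have ep: "emeasure S {\<omega>. enat n < hit f B s \<omega>} = ennreal (p n)" for n
    by (simp add: p_def P.emeasure_eq_measure)
  have p: "0 \<le> p n" "p n \<le> 1" for n by (auto simp: p_def)
  define Y where "Y n = (\<integral>\<^sup>+\<omega>. y (run f s n \<omega>) * of_bool (enat n < hit f B s \<omega>) \<partial>S)" for n
  have Suc_less: "enat (Suc n) < hit f B s \<omega> \<longleftrightarrow> enat n < hit f B s \<omega> \<and> run f s (Suc n) \<omega> \<notin> B" for n \<omega>
    unfolding hit_def less_first_time_iff by (auto simp: atLeastAtMostSuc_conv simp del: run.simps)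
  have mono: "p (Suc n) \<le> p n" for n
    unfolding p_def Suc_less by (intro P.finite_measure_mono) auto
  \<comment> \<open>\<open>Y n\<close> collects \<open>y\<close> over the paths that have not hit.
    Those hitting at time \<open>n + 1\<close> have probability \<open>p n - p (Suc n)\<close>, and
    there \<open>y\<close> is at least \<open>A\<close>.\<close>
  have step: "Y (Suc n) + ennreal (A * (p n - p (Suc n))) \<le> Y n + ennreal (p n)" for n
  proof -
    have "p n - p (Suc n) = measure S {\<omega>. enat n < hit f B s \<omega> \<and> run f s (Suc n) \<omega> \<in> B}"
      unfolding p_def by (subst P.finite_measure_Diff[symmetric])
        (auto simp: Suc_less simp del: run.simps intro!: arg_cong[where f = "measure S"] less_hit_sets[OF f B, of "Suc n" s, unfolded Suc_less])
    then have "ennreal (A * (p n - p (Suc n))) = (\<integral>\<^sup>+\<omega>. ennreal A * of_bool (enat n < hit f B s \<omega> \<and> run f s (Suc n) \<omega> \<in> B) \<partial>S)"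
      using A by (subst nn_integral_cmult) (auto simp: ennreal_mult P.emeasure_eq_measure nn_integral_of_bool
         simp del: run.simps)
    then have "Y (Suc n) + ennreal (A * (p n - p (Suc n)))
       = (\<integral>\<^sup>+\<omega>. y (run f s (Suc n) \<omega>) * of_bool (enat (Suc n) < hit f B s \<omega>)
           + ennreal A * of_bool (enat n < hit f B s \<omega> \<and> run f s (Suc n) \<omega> \<in> B) \<partial>S)"
      unfolding Y_def by (subst nn_integral_add) (auto simp del: run.simps)
    also have "\<dots> \<le> (\<integral>\<^sup>+\<omega>. y (run f s (Suc n) \<omega>) * of_bool (enat n < hit f B s \<omega>) \<partial>S)"
      unfolding Suc_less using large by (intro nn_integral_mono) (auto simp: of_bool_def simp del: run.simps)
    also have "\<dots> = (\<integral>\<^sup>+\<omega>. (\<integral>\<^sup>+x. y (f (run f s n \<omega>) x) \<partial>M) * of_bool (enat n < hit f B s \<omega>) \<partial>S)"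
      by (rule run_next) measurable
    also have "\<dots> \<le> (\<integral>\<^sup>+\<omega>. y (run f s n \<omega>) * of_bool (enat n < hit f B s \<omega>) + of_bool (enat n < hit f B s \<omega>) \<partial>S)"
    proof (rule nn_integral_mono)
      fix \<omega>
      have "run f s n \<omega> \<notin> B" if "enat n < hit f B s \<omega>"
        using that s unfolding hit_def less_first_time_iff by (cases n) (auto simp del: run.simps(2))
      then show "(\<integral>\<^sup>+x. y (f (run f s n \<omega>) x) \<partial>M) * of_bool (enat n < hit f B s \<omega>)
         \<le> y (run f s n \<omega>) * of_bool (enat n < hit f B s \<omega>) + of_bool (enat n < hit f B s \<omega>)"
        using drift[of "run f s n \<omega>"] by (auto simp: of_bool_def add.commute)
    qed
    also have "\<dots> = Y n + ennreal (p n)"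
      unfolding Y_def by (subst nn_integral_add) (auto simp: ep[symmetric] nn_integral_of_bool)
    finally show ?thesis .
  qed
  have p0: "p 0 = 1"
    by (simp add: p_def hit_def less_first_time_iff P.prob_space[simplified])
  \<comment> \<open>Stopping truncated at time \<open>n\<close>: the paths of total probability
    \<open>1 - p n\<close> that have already hit contribute \<open>A\<close> each.\<close>
  have main: "Y n + ennreal (A * (1 - p n)) \<le> ennreal (\<Sum>j<n. p j)" for n
  proof (induction n)
    case 0
    show ?case by (auto simp: Y_def p0 s)
  next
    case (Suc n)
    have "Y (Suc n) + ennreal (A * (1 - p (Suc n)))
       = (Y (Suc n) + ennreal (A * (p n - p (Suc n)))) + ennreal (A * (1 - p n))"
    proof -
      have "ennreal (A * (1 - p (Suc n))) = ennreal (A * (p n - p (Suc n)) + A * (1 - p n))"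
        by (simp add: algebra_simps)
      also have "\<dots> = ennreal (A * (p n - p (Suc n))) + ennreal (A * (1 - p n))"
        using A mono[of n] p[of n] by (intro ennreal_plus) simp_all
      finally show ?thesis by (simp only: add.assoc)
    qed
    also have "\<dots> \<le> (Y n + ennreal (p n)) + ennreal (A * (1 - p n))"
      by (intro add_right_mono step)
    also have "\<dots> \<le> ennreal (\<Sum>j<n. p j) + ennreal (p n)"
      using add_right_mono[OF Suc.IH, of "ennreal (p n)"] by (simp add: ac_simps)
    also have "\<dots> = ennreal (\<Sum>j<Suc n. p j)"
      using p by (subst ennreal_plus[symmetric]) (auto intro!: sum_nonneg)
    finally show ?case .
  qed
  have E: "(\<integral>\<^sup>+\<omega>. ennreal_of_enat (hit f B s \<omega>) \<partial>S) = (\<Sum>j. ennreal (p j))"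
    unfolding expected_hit[OF f B] ep ..
  \<comment> \<open>A finite mean makes the tail probabilities summable, so \<open>p n\<close> tends
    to 0 and the bound \<open>A * (1 - p n)\<close> tends to \<open>A\<close>.\<close>
  then have sp: "summable p"
    using False p by (intro summable_suminf_not_top) auto
  have "A * (1 - p n) \<le> suminf p" for n
  proof -
    have "ennreal (A * (1 - p n)) \<le> ennreal (\<Sum>j<n. p j)"
      by (rule order_trans[OF _ main]) (simp add: add_increasing)
    then have "A * (1 - p n) \<le> (\<Sum>j<n. p j)"
      using p by (subst (asm) ennreal_le_iff) (auto intro!: sum_nonneg)
    also have "\<dots> \<le> suminf p"
      using sp p by (intro sum_le_suminf) auto
    finally show ?thesis .
  qed
  moreover have "(\<lambda>n. A * (1 - p n)) \<longlonglongrightarrow> A * (1 - 0)"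
    by (intro tendsto_intros summable_LIMSEQ_zero sp)
  ultimately have "A \<le> suminf p"
    by (intro LIMSEQ_le_const2[of "\<lambda>n. A * (1 - p n)"]) auto
  then show ?thesis
    unfolding E using p sp by (subst suminf_ennreal2) (auto intro: ennreal_leI)
qed simp

section \<open>Weak law of large numbers under a first moment\<close>

lemma prob_space_S: "prob_space S"
  by (intro prob_space_PiM) (rule prob_space_M)

lemma measurable_component [measurable]: "(\<lambda>\<omega>. \<omega> i) \<in> borel_measurable S"
proof -
  have "(\<lambda>\<omega>. \<omega> i) \<in> S \<rightarrow>\<^sub>M M" by (rule measurable_component_singleton) simp
  then show ?thesis by (simp add: measurable_cong_sets[OF refl sets_M])
qed

lemma borel_measurable_M: "h \<in> borel_measurable borel \<Longrightarrow> h \<in> borel_measurable M"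
  by (simp add: measurable_cong_sets[OF sets_M refl])

lemma indep_vars_component: "P.indep_vars (\<lambda>_. borel) (\<lambda>i \<omega>. \<omega> i) J"
proof (cases "J = {}")
  case False
  have "P.indep_vars (\<lambda>_. M) (\<lambda>i \<omega>. \<omega> i) J"
  proof (subst P.indep_vars_iff_distr_eq_PiM[OF False])
    show "distr S (PiM J (\<lambda>_. M)) (\<lambda>x. \<lambda>i\<in>J. x i) = PiM J (\<lambda>i. distr S M (\<lambda>\<omega>. \<omega> i))"
      by (simp add: distr_component distr_PiM_reindex[where f = "\<lambda>i. i"] prob_space_M)
  qed simp
  then show ?thesis
    by (rule P.indep_vars_compose2[where Y = "\<lambda>_ x. x"]) (simp add: measurable_cong_sets[OF sets_M refl])
qed (simp add: P.indep_vars_def P.indep_sets_def)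

lemma integral_component:
  fixes h :: "real \<Rightarrow> real"
  assumes [measurable]: "h \<in> borel_measurable borel"
  shows "(\<integral>\<omega>. h (\<omega> i) \<partial>S) = (\<integral>x. h x \<partial>M)"
  by (subst (2) distr_component[of i, symmetric], subst integral_distr) (auto simp: borel_measurable_M)

lemma Hoeffding_clamped:
  assumes g [measurable]: "g \<in> borel_measurable borel" and bd: "\<And>x. \<bar>g x\<bar> \<le> (b::real)" and b: "0 < b"
    and \<delta>: "0 < \<delta>" and n: "0 < n"
  shows "measure S {\<omega>. real n * ((\<integral>x. g x \<partial>M) + \<delta>) \<le> (\<Sum>i<n. g (\<omega> i))}
      \<le> exp (- \<delta>\<^sup>2 / (2 * b\<^sup>2)) ^ n"
proof -
  interpret H: Hoeffding_ineq S "{..<n}" "\<lambda>i \<omega>. g (\<omega> i)" "\<lambda>_. - b" "\<lambda>_. b" "\<Sum>i<n. P.expectation (\<lambda>\<omega>. g (\<omega> i))"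
  proof unfold_locales
    show "P.indep_vars (\<lambda>_. borel) (\<lambda>i \<omega>. g (\<omega> i)) {..<n}"
      by (rule P.indep_vars_compose2[OF indep_vars_component]) simp
    show "AE x in S. g (x i) \<in> {-b..b}" for i
      using bd by (auto simp: abs_le_iff minus_le_iff)
  qed auto
  have "measure S {\<omega>. real n * ((\<integral>x. g x \<partial>M) + \<delta>) \<le> (\<Sum>i<n. g (\<omega> i))}
     \<le> exp (-2 * (real n * \<delta>)\<^sup>2 / (\<Sum>i<n. (b - (-b))\<^sup>2))"
    using H.Hoeffding_ineq_ge[of "real n * \<delta>"] b \<delta> n
    by (simp add: integral_component distrib_left)
  also have "-2 * (real n * \<delta>)\<^sup>2 / (\<Sum>i<n. (b - (-b))\<^sup>2) = real n * (- \<delta>\<^sup>2 / (2 * b\<^sup>2))"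
    using b n by (simp add: power2_eq_square field_simps)
  finally show ?thesis by (simp only: exp_of_nat_mult)
qed

lemma clamp_approximation:
  assumes g [measurable]: "g \<in> borel_measurable borel" and int: "integrable M g" and e: "0 < (e::real)"
  shows "\<exists>b>0. (\<integral>x. \<bar>g x - max (-b) (min b (g x))\<bar> \<partial>M) < e"
proof -
  have "(\<lambda>n. \<integral>x. \<bar>g x - max (-real n) (min (real n) (g x))\<bar> \<partial>M) \<longlonglongrightarrow> (\<integral>x. 0 \<partial>M)"
  proof (rule integral_dominated_convergence[where w = "\<lambda>x. \<bar>g x\<bar>"])
    show "AE x in M. (\<lambda>n. \<bar>g x - max (-real n) (min (real n) (g x))\<bar>) \<longlonglongrightarrow> 0"
    proof (intro AE_I2 tendsto_eventually)
      fix x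
      obtain N where N: "\<bar>g x\<bar> \<le> real N" using real_arch_simple by blast
      show "\<forall>\<^sub>F n in sequentially. \<bar>g x - max (-real n) (min (real n) (g x))\<bar> = 0"
        using N by (intro eventually_sequentiallyI[of N]) (auto simp: max_def min_def)
    qed
    show "AE x in M. norm \<bar>g x - max (-real n) (min (real n) (g x))\<bar> \<le> \<bar>g x\<bar>" for n
      by (auto simp: max_def min_def)
  qed (use int in auto)
  then have "\<forall>\<^sub>F n in sequentially. (\<integral>x. \<bar>g x - max (-real n) (min (real n) (g x))\<bar> \<partial>M) < e"
    using e by (intro order_tendstoD(2)) auto
  then obtain n where "n > 0" "(\<integral>x. \<bar>g x - max (-real n) (min (real n) (g x))\<bar> \<partial>M) < e"
    by (metis (mono_tags, lifting) eventually_conj eventually_gt_at_top eventually_happens trivial_limit_sequentially)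
  then show ?thesis by (intro exI[of _ "real n"]) auto
qed

text \<open>Without a second moment the summands are clamped to \<open>[-b, b]\<close>: Hoeffding's
  inequality controls the clamped sum, Markov's inequality the remainder, whose mean is made small
  by the choice of \<open>b\<close>.\<close>

lemma weak_law_upper:
  assumes g [measurable]: "g \<in> borel_measurable borel" and int: "integrable M g" and \<delta>: "0 < \<delta>"
  shows "(\<lambda>n. measure S {\<omega>. real n * ((\<integral>x. g x \<partial>M) + \<delta>) \<le> (\<Sum>i<n. g (\<omega> i))}) \<longlonglongrightarrow> 0"
proof (rule order_tendstoI)
  let ?q = "\<lambda>n. measure S {\<omega>. real n * ((\<integral>x. g x \<partial>M) + \<delta>) \<le> (\<Sum>i<n. g (\<omega> i))}"
  fix \<epsilon> :: real assume "0 < \<epsilon>"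
  \<comment> \<open>The bound \<open>\<delta> / 4\<close> limits the shift of the mean caused by
    clamping; \<open>\<epsilon> * \<delta> / 4\<close> makes the Markov bound at threshold
    \<open>n * \<delta> / 2\<close> equal to at most \<open>\<epsilon> / 2\<close>.\<close>
  obtain b where b: "0 < b" and
    rest: "(\<integral>x. \<bar>g x - max (-b) (min b (g x))\<bar> \<partial>M) < min (\<delta> / 4) (\<epsilon> * \<delta> / 4)"
    using clamp_approximation[OF g int, of "min (\<delta> / 4) (\<epsilon> * \<delta> / 4)"] \<open>0 < \<epsilon>\<close> \<delta> by auto
  define Y where "Y x = max (-b) (min b (g x))" for x
  define R where "R x = \<bar>g x - Y x\<bar>" for x
  have [measurable]: "Y \<in> borel_measurable borel" "R \<in> borel_measurable borel"
    by (auto simp: Y_def[abs_def] R_def[abs_def])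
  have bdY: "\<bar>Y x\<bar> \<le> b" for x using b by (auto simp: Y_def)
  have intY: "integrable M Y"
    using bdY by (intro finite_measure.integrable_const_bound[OF finite_measure_M, where B = b])
        (auto simp: borel_measurable_M)
  have intR: "integrable M R"
    unfolding R_def using int intY by auto
  have R: "(\<integral>x. R x \<partial>M) < \<delta> / 4" "(\<integral>x. R x \<partial>M) < \<epsilon> * \<delta> / 4"
    using rest by (auto simp: R_def Y_def)
  have "(\<integral>x. Y x \<partial>M) \<le> (\<integral>x. g x + R x \<partial>M)"
    using intY int intR by (intro integral_mono) (auto simp: R_def)
  then have meanY: "(\<integral>x. Y x \<partial>M) \<le> (\<integral>x. g x \<partial>M) + \<delta> / 4"
    using int intR R by simp
  have intRi: "integrable S (\<lambda>\<omega>. R (\<omega> i))" for i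
  proof -
    have "integrable (distr S M (\<lambda>\<omega>. \<omega> i)) R" using intR by (simp add: distr_component)
    then show ?thesis by (rule integrable_distr[rotated]) simp
  qed
  define r where "r = exp (- (\<delta> / 4)\<^sup>2 / (2 * b\<^sup>2))"
  have bound: "?q n \<le> r ^ n + \<epsilon> / 2"
    if n: "0 < n" for n
  proof -
    let ?A = "{\<omega>. real n * ((\<integral>x. Y x \<partial>M) + \<delta> / 4) \<le> (\<Sum>i<n. Y (\<omega> i))}"
    let ?B = "{\<omega>\<in>space S. real n * (\<delta> / 2) \<le> (\<Sum>i<n. R (\<omega> i))}"
    have A: "?A \<in> sets S"
    proof -
      have "{\<omega>\<in>space S. real n * ((\<integral>x. Y x \<partial>M) + \<delta> / 4) \<le> (\<Sum>i<n. Y (\<omega> i))} \<in> sets S" by measurable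
      then show ?thesis by simp
    qed
    have B: "?B \<in> sets S" by measurable
    \<comment> \<open>The deviation \<open>\<delta>\<close> is spent as \<open>\<delta> / 4\<close>
      on the shift of the mean, \<open>\<delta> / 4\<close> on the clamped sum and
      \<open>\<delta> / 2\<close> on the remainder.\<close>
    have "?q n \<le> measure S (?A \<union> ?B)"
    proof (rule P.finite_measure_mono)
      show "{\<omega>. real n * ((\<integral>x. g x \<partial>M) + \<delta>) \<le> (\<Sum>i<n. g (\<omega> i))} \<subseteq> ?A \<union> ?B"
      proof (rule subsetI, rule ccontr)
        fix \<omega> assume g: "\<omega> \<in> {\<omega>. real n * ((\<integral>x. g x \<partial>M) + \<delta>) \<le> (\<Sum>i<n. g (\<omega> i))}"
          and no: "\<omega> \<notin> ?A \<union> ?B"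
        have "(\<Sum>i<n. g (\<omega> i)) \<le> (\<Sum>i<n. Y (\<omega> i) + R (\<omega> i))"
          by (intro sum_mono) (auto simp: R_def)
        also have "\<dots> < real n * ((\<integral>x. Y x \<partial>M) + \<delta> / 4) + real n * (\<delta> / 2)"
          using no by (simp add: sum.distrib)
        also have "\<dots> \<le> real n * ((\<integral>x. g x \<partial>M) + \<delta>)"
          unfolding distrib_left[symmetric] using meanY by (intro mult_left_mono) auto
        finally show False using g by simp
      qed
    qed (use A B in auto)
    also have "\<dots> \<le> measure S ?A + measure S ?B"
      using A B by (rule measure_Un_le)
    also have "measure S ?A \<le> r ^ n"
      unfolding r_def using bdY b \<delta> n by (intro Hoeffding_clamped) auto
    also have "measure S ?B \<le> (\<integral>\<omega>. (\<Sum>i<n. R (\<omega> i)) \<partial>S) / (real n * (\<delta> / 2))"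
      using intRi n \<delta> by (intro integral_Markov_inequality_measure[where A = "{}"])
        (auto simp: R_def intro!: sum_nonneg)
    also have "(\<integral>\<omega>. (\<Sum>i<n. R (\<omega> i)) \<partial>S) = real n * (\<integral>x. R x \<partial>M)"
      using intRi by (simp add: integral_component)
    also have "real n * (\<integral>x. R x \<partial>M) / (real n * (\<delta> / 2)) \<le> \<epsilon> / 2"
      using R(2) n \<delta> by (simp add: field_simps)
    finally show ?thesis by simp
  qed
  have "(\<lambda>n. r ^ n) \<longlonglongrightarrow> 0"
    unfolding r_def using b \<delta> by (intro LIMSEQ_power_zero) simp
  then have "\<forall>\<^sub>F n in sequentially. r ^ n < \<epsilon> / 2"
    using \<open>0 < \<epsilon>\<close> by (intro order_tendstoD(2)) auto
  then show "\<forall>\<^sub>F n in sequentially.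
      ?q n < \<epsilon>"
    using eventually_gt_at_top[of 0]
  proof eventually_elim
    case (elim n)
    then show ?case using bound[of n] by simp
  qed
qed (auto intro!: always_eventually intro: less_le_trans)

end

section \<open>Likelihood ratios\<close>

text \<open>A real-valued \<open>l\<close> makes the two laws mutually absolutely continuous; the
  signs of the two means say that both Kullback-Leibler divergences are positive.\<close>

locale likelihood_ratio =
  fixes M0 M1 :: "real measure" and l :: "real \<Rightarrow> real"
  assumes iid0: "iid M0" and iid1: "iid M1"
    and l [measurable]: "l \<in> borel_measurable borel"
    and M1_density: "M1 = density M0 (\<lambda>x. ennreal (exp (l x)))"
    and integrable_l0: "integrable M0 l" and integrable_l1: "integrable M1 l"
    and mean0: "(\<integral>x. l x \<partial>M0) < 0" and mean1: "0 < (\<integral>x. l x \<partial>M1)"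
begin

sublocale N0: iid M0 by (rule iid0)
sublocale N1: iid M1 by (rule iid1)

abbreviation "S0 \<equiv> PiM (UNIV :: nat set) (\<lambda>_. M0)"
abbreviation "S1 \<equiv> PiM (UNIV :: nat set) (\<lambda>_. M1)"

lemma sets_S1_S0 [measurable_cong]: "sets S1 = sets S0"
  by (intro sets_PiM_cong) (simp_all add: N0.sets_M N1.sets_M)

lemma nn_integral_M1:
  assumes [measurable]: "h \<in> borel_measurable borel"
  shows "(\<integral>\<^sup>+x. h x \<partial>M1) = (\<integral>\<^sup>+x. h x * ennreal (exp (l x)) \<partial>M0)"
  unfolding M1_density by (subst nn_integral_density) (auto simp: mult.commute intro!: N0.borel_measurable_M)

text \<open>Induction on \<open>n\<close>: the last coordinate is integrated out and transformed by
  the one-dimensional density, the others by the induction hypothesis.\<close>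

lemma nn_integral_change_measure:
  assumes "F \<in> borel_measurable S0" "depends_on_first n F"
  shows "(\<integral>\<^sup>+\<omega>. F \<omega> \<partial>S1) = (\<integral>\<^sup>+\<omega>. F \<omega> * ennreal (exp (\<Sum>i<n. l (\<omega> i))) \<partial>S0)"
  using assms
proof (induction n arbitrary: F)
  case 0
  then have "F = (\<lambda>_. F (\<lambda>_. 0))" by (intro ext) (auto simp: depends_on_first_def)
  then obtain c where "F = (\<lambda>_. c)" by blast
  then show ?case by (simp add: N0.P.emeasure_space_1[simplified] N1.P.emeasure_space_1[simplified])
next
  case (Suc n)
  note [measurable] = Suc.prems(1)
  have upd [measurable]: "(\<lambda>z. (fst z)(n := snd z)) \<in> S0 \<Otimes>\<^sub>M borel \<rightarrow>\<^sub>M S0"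
    by (rule measurable_fun_upd[where J = UNIV]) (auto simp: measurable_cong_sets[OF refl N0.sets_M])
  have [measurable]: "(\<lambda>\<omega>. \<integral>\<^sup>+x. F (fun_upd \<omega> n x) \<partial>M1) \<in> borel_measurable S0"
    using upd by (intro sigma_finite_measure.borel_measurable_nn_integral[OF N1.sigma_finite_measure_M])
      (simp add: split_beta', measurable)
  have dep: "depends_on_first n (\<lambda>\<omega>. F (fun_upd \<omega> n x))" for x
    unfolding depends_on_first_def
    by (intro allI impI depends_on_firstD[OF Suc.prems(2)]) (auto simp: less_Suc_eq)
  \<comment> \<open>Overwriting coordinate \<open>n\<close> by its own value changes nothing, but
    exhibits \<open>F\<close> as a function of the first \<open>n\<close> coordinates and a fresh
    one.\<close>
  have "(\<integral>\<^sup>+\<omega>. F \<omega> \<partial>S1) = (\<integral>\<^sup>+\<omega>. (\<lambda>\<omega> x. F (fun_upd \<omega> n x)) \<omega> (\<omega> n) \<partial>S1)"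
    by simp
  also have "\<dots> = (\<integral>\<^sup>+\<omega>. (\<integral>\<^sup>+x. F (fun_upd \<omega> n x) \<partial>M1) \<partial>S1)"
    by (rule N1.nn_integral_next) (simp_all add: split_beta' dep)
  also have "\<dots> = (\<integral>\<^sup>+\<omega>. (\<integral>\<^sup>+x. F (fun_upd \<omega> n x) \<partial>M1) * ennreal (exp (\<Sum>i<n. l (\<omega> i))) \<partial>S0)"
  proof (rule Suc.IH)
    show "depends_on_first n (\<lambda>\<omega>. \<integral>\<^sup>+x. F (fun_upd \<omega> n x) \<partial>M1)"
      unfolding depends_on_first_def
      by (intro allI impI nn_integral_cong depends_on_firstD[OF dep]) simp
  qed measurable
  also have "\<dots> = (\<integral>\<^sup>+\<omega>. (\<integral>\<^sup>+x. F (fun_upd \<omega> n x) * ennreal (exp (l x)) * ennreal (exp (\<Sum>i<n. l (\<omega> i))) \<partial>M0) \<partial>S0)"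
  proof (intro nn_integral_cong)
    fix \<omega>
    have [measurable]: "(\<lambda>x. F (fun_upd \<omega> n x)) \<in> borel_measurable borel"
    proof -
      have "(\<lambda>x. fun_upd \<omega> n x) \<in> borel \<rightarrow>\<^sub>M S0"
        by (rule measurable_fun_upd[where J = UNIV])
          (auto simp: measurable_cong_sets[OF refl N0.sets_M] space_PiM)
      then show ?thesis by measurable
    qed
    show "(\<integral>\<^sup>+x. F (fun_upd \<omega> n x) \<partial>M1) * ennreal (exp (\<Sum>i<n. l (\<omega> i)))
        = (\<integral>\<^sup>+x. F (fun_upd \<omega> n x) * ennreal (exp (l x)) * ennreal (exp (\<Sum>i<n. l (\<omega> i))) \<partial>M0)"
      by (subst nn_integral_M1[of "\<lambda>x. F (fun_upd \<omega> n x)"])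
        (auto intro!: nn_integral_multc[symmetric] N0.borel_measurable_M)
  qed
  also have "\<dots> = (\<integral>\<^sup>+\<omega>. (\<lambda>\<omega> x. F (fun_upd \<omega> n x) * ennreal (exp (l x)) * ennreal (exp (\<Sum>i<n. l (\<omega> i)))) \<omega> (\<omega> n) \<partial>S0)"
  proof (rule N0.nn_integral_next[symmetric])
    show "(\<lambda>(\<omega>, x). F (fun_upd \<omega> n x) * ennreal (exp (l x)) * ennreal (exp (\<Sum>i<n. l (\<omega> i))))
        \<in> borel_measurable (S0 \<Otimes>\<^sub>M borel)"
      unfolding split_beta' by measurable
    show "depends_on_first n (\<lambda>\<omega>. F (fun_upd \<omega> n x) * ennreal (exp (l x)) * ennreal (exp (\<Sum>i<n. l (\<omega> i))))" for x
      unfolding depends_on_first_def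
    proof (intro allI impI)
      fix \<omega> \<omega>' :: "nat \<Rightarrow> real" assume *: "\<forall>i<n. \<omega> i = \<omega>' i"
      then have "F (fun_upd \<omega> n x) = F (fun_upd \<omega>' n x)" "(\<Sum>i<n. l (\<omega> i)) = (\<Sum>i<n. l (\<omega>' i))"
        by (auto intro!: sum.cong depends_on_firstD[OF dep])
      then show "F (fun_upd \<omega> n x) * ennreal (exp (l x)) * ennreal (exp (\<Sum>i<n. l (\<omega> i)))
          = F (fun_upd \<omega>' n x) * ennreal (exp (l x)) * ennreal (exp (\<Sum>i<n. l (\<omega>' i)))"
        by simp
    qed
  qed
  also have "\<dots> = (\<integral>\<^sup>+\<omega>. F \<omega> * ennreal (exp (\<Sum>i<Suc n. l (\<omega> i))) \<partial>S0)"
    by (intro nn_integral_cong)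
      (simp add: exp_add ennreal_mult[symmetric] mult.assoc mult.commute[of "exp (l _)"])
  finally show ?case .
qed

lemma emeasure_change_measure:
  assumes A [measurable]: "Measurable.pred S0 Q" and dep: "depends_on_first n Q"
  shows "emeasure S1 {\<omega>. Q \<omega>} = (\<integral>\<^sup>+\<omega>. of_bool (Q \<omega>) * ennreal (exp (\<Sum>i<n. l (\<omega> i))) \<partial>S0)"
proof -
  have "emeasure S1 {\<omega>. Q \<omega>} = (\<integral>\<^sup>+\<omega>. of_bool (Q \<omega>) \<partial>S1)"
    by (subst nn_integral_of_bool) simp_all
  also have "\<dots> = (\<integral>\<^sup>+\<omega>. of_bool (Q \<omega>) * ennreal (exp (\<Sum>i<n. l (\<omega> i))) \<partial>S0)"
    using dep by (intro nn_integral_change_measure) (auto simp: depends_on_first_def)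
  finally show ?thesis .
qed

lemma emeasure_S0_le:
  assumes Q [measurable]: "Measurable.pred S0 Q" and dep: "depends_on_first n Q"
    and large: "\<And>\<omega>. Q \<omega> \<Longrightarrow> b \<le> (\<Sum>i<n. l (\<omega> i))"
  shows "emeasure S0 {\<omega>. Q \<omega>} \<le> ennreal (exp (-b)) * emeasure S1 {\<omega>. Q \<omega>}"
proof -
  have "emeasure S0 {\<omega>. Q \<omega>} = (\<integral>\<^sup>+\<omega>. of_bool (Q \<omega>) \<partial>S0)"
    by (subst nn_integral_of_bool) simp_all
  also have "\<dots> \<le> (\<integral>\<^sup>+\<omega>. ennreal (exp (-b)) * (of_bool (Q \<omega>) * ennreal (exp (\<Sum>i<n. l (\<omega> i)))) \<partial>S0)"
  proof (rule nn_integral_mono)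
    fix \<omega>
    have "1 \<le> ennreal (exp (-b)) * ennreal (exp (\<Sum>i<n. l (\<omega> i)))" if "Q \<omega>"
      using large[OF that] by (simp add: ennreal_mult[symmetric] exp_add[symmetric] del: ennreal_1)
    then show "of_bool (Q \<omega>) \<le> ennreal (exp (-b)) * (of_bool (Q \<omega>) * ennreal (exp (\<Sum>i<n. l (\<omega> i))))"
      by auto
  qed
  also have "\<dots> = ennreal (exp (-b)) * emeasure S1 {\<omega>. Q \<omega>}"
    unfolding emeasure_change_measure[OF Q dep] by (rule nn_integral_cmult) measurable
  finally show ?thesis .
qed

lemma emeasure_S1_le:
  assumes Q [measurable]: "Measurable.pred S0 Q" and dep: "depends_on_first n Q"
    and small: "\<And>\<omega>. Q \<omega> \<Longrightarrow> (\<Sum>i<n. l (\<omega> i)) \<le> b"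
  shows "emeasure S1 {\<omega>. Q \<omega>} \<le> ennreal (exp b) * emeasure S0 {\<omega>. Q \<omega>}"
proof -
  have "emeasure S1 {\<omega>. Q \<omega>} \<le> (\<integral>\<^sup>+\<omega>. ennreal (exp b) * of_bool (Q \<omega>) \<partial>S0)"
    unfolding emeasure_change_measure[OF Q dep]
    using small by (intro nn_integral_mono) (auto intro: ennreal_leI)
  also have "\<dots> = ennreal (exp b) * emeasure S0 {\<omega>. Q \<omega>}"
    by (subst nn_integral_cmult) (simp_all add: nn_integral_of_bool)
  finally show ?thesis .
qed

section \<open>Random walk and CuSum\<close>

abbreviation walk :: "nat \<Rightarrow> (nat \<Rightarrow> real) \<Rightarrow> real" where
  "walk \<equiv> run (\<lambda>s x. s + l x) 0"

abbreviation exit_walk :: "real \<Rightarrow> (nat \<Rightarrow> real) \<Rightarrow> enat" where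
  "exit_walk b \<equiv> hit (\<lambda>s x. s + l x) (- {0..b}) 0"

lemma walk_eq_sum: "walk n \<omega> = (\<Sum>i<n. l (\<omega> i))"
  by (induction n) auto

lemma measurable_walk_step [measurable]: "(\<lambda>(s, x). s + l x) \<in> borel_measurable (borel \<Otimes>\<^sub>M borel)"
  by measurable

text \<open>For \<open>b = a - a1\<close> with \<open>a1 > 0\<close>, the union over
  \<open>n\<close> is the conditioning event in \<open>E_arl\<close>.\<close>

definition down :: "real \<Rightarrow> nat \<Rightarrow> (nat \<Rightarrow> real) \<Rightarrow> bool" where
  "down b n \<omega> \<longleftrightarrow> exit_walk b \<omega> = enat n \<and> walk n \<omega> < 0"

lemma measurable_down [measurable]: "Measurable.pred S0 (down b n)"
  unfolding down_def by measurable

lemma depends_on_first_down: "depends_on_first n (down b n)"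
  unfolding down_def[abs_def]
  by (rule depends_on_first_map2[OF depends_on_first_hit_eq depends_on_first_run, where h = "\<lambda>u t. u \<and> t < 0"])

lemma emeasure_ex_down: "emeasure S0 {\<omega>. \<exists>n. down b n \<omega>} = (\<Sum>n. emeasure S0 {\<omega>. down b n \<omega>})"
proof -
  have "emeasure S0 {\<omega>. \<exists>n. down b n \<omega>} = emeasure S0 (\<Union>n. {\<omega>\<in>space S0. down b n \<omega>})"
    by (intro arg_cong[where f = "emeasure S0"]) auto
  also have "\<dots> = (\<Sum>n. emeasure S0 {\<omega>\<in>space S0. down b n \<omega>})"
  proof (rule suminf_emeasure[symmetric])
    show "disjoint_family (\<lambda>n. {\<omega>\<in>space S0. down b n \<omega>})"
      by (auto simp: disjoint_family_on_def down_def)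
    show "range (\<lambda>n. {\<omega>\<in>space S0. down b n \<omega>}) \<subseteq> sets S0"
      by (intro image_subsetI) measurable
  qed
  finally show ?thesis by simp
qed

text \<open>
  The likelihood ratio is at least \<open>exp b\<close> when the walk leaves \<open>[0, b]\<close> upwards, and by the weak law
  the walk does not stay in \<open>[0, b]\<close> for ever.
\<close>
lemma measure_never_down: "1 - measure S0 {\<omega>. \<exists>n. down b n \<omega>} \<le> exp (-b)"
proof -
  \<comment> \<open>Taking minus the mean as deviation puts the threshold at 0: \<open>q n\<close>
    is the probability of a nonnegative walk at time \<open>n\<close>.\<close>
  define q where "q n = measure S0 {\<omega>. real n * ((\<integral>x. l x \<partial>M0) + - (\<integral>x. l x \<partial>M0)) \<le> (\<Sum>i<n. l (\<omega> i))}" for n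
  have q: "q \<longlonglongrightarrow> 0"
    unfolding q_def using mean0 by (intro N0.weak_law_upper l integrable_l0) simp
  have setsD: "{\<omega>. \<exists>n. down b n \<omega>} \<in> sets S0"
  proof -
    have "{\<omega>\<in>space S0. \<exists>n. down b n \<omega>} \<in> sets S0" by measurable
    then show ?thesis by simp
  qed
  have up: "measure S0 {\<omega>. exit_walk b \<omega> = enat n \<and> b < walk n \<omega>} \<le> exp (-b) * measure S1 {\<omega>. exit_walk b \<omega> = enat n}" for n
  proof -
    have sets: "{\<omega>\<in>space S1. exit_walk b \<omega> = enat n} \<in> sets S1"
      by measurable
    have "emeasure S0 {\<omega>. exit_walk b \<omega> = enat n \<and> b < walk n \<omega>}
       \<le> ennreal (exp (-b)) * emeasure S1 {\<omega>. exit_walk b \<omega> = enat n \<and> b < walk n \<omega>}"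
    proof (rule emeasure_S0_le)
      show "depends_on_first n (\<lambda>\<omega>. exit_walk b \<omega> = enat n \<and> b < walk n \<omega>)"
        by (rule depends_on_first_map2[OF depends_on_first_hit_eq depends_on_first_run, where h = "\<lambda>u t. u \<and> b < t"])
    qed (auto simp: walk_eq_sum[symmetric])
    also have "\<dots> \<le> ennreal (exp (-b)) * emeasure S1 {\<omega>\<in>space S1. exit_walk b \<omega> = enat n}"
      by (intro mult_left_mono emeasure_mono[OF _ sets]) auto
    finally show ?thesis
      by (simp add: N0.P.emeasure_eq_measure N1.P.emeasure_eq_measure ennreal_mult[symmetric])
  qed
  have "1 - measure S0 {\<omega>. \<exists>n. down b n \<omega>} \<le> exp (-b) + q n" if n: "n \<ge> 1" for n
  proof -
    let ?D = "{\<omega>\<in>space S0. \<exists>n. down b n \<omega>}"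
    let ?U = "\<lambda>k. {\<omega>\<in>space S0. exit_walk b \<omega> = enat k \<and> b < walk k \<omega>}"
    let ?N = "{\<omega>\<in>space S0. 0 \<le> walk n \<omega>}"
    \<comment> \<open>By time \<open>n\<close> the walk has left downwards, has left upwards, or
      still lies in \<open>[0, b]\<close> and in particular is nonnegative.\<close>
    have cover: "space S0 \<subseteq> (?D \<union> (\<Union>k\<in>{..n}. ?U k)) \<union> ?N"
    proof
      fix \<omega>
      show "\<omega> \<in> (?D \<union> (\<Union>k\<in>{..n}. ?U k)) \<union> ?N"
      proof (cases "exit_walk b \<omega> \<le> enat n")
        case True
        then obtain k where k: "exit_walk b \<omega> = enat k" "k \<le> n"
          by (cases "exit_walk b \<omega>") auto
        then have "walk k \<omega> \<notin> {0..b}"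
          by (simp add: hit_def first_time_eq_iff)
        then show ?thesis using k by (auto simp: down_def)
      next
        case False
        then have "walk n \<omega> \<in> {0..b}"
          using n unfolding not_le hit_def less_first_time_iff by (auto dest: bspec[of _ _ n])
        then show ?thesis by auto
      qed
    qed
    \<comment> \<open>For different \<open>k\<close> the exit events are disjoint under
      \<open>S1\<close>, so the change of measure costs the factor \<open>exp (-b)\<close> only
      once.\<close>
    have "(\<Sum>k\<in>{..n}. measure S0 (?U k)) \<le> (\<Sum>k\<in>{..n}. exp (-b) * measure S1 {\<omega>. exit_walk b \<omega> = enat k})"
      using up by (intro sum_mono) simp
    also have "\<dots> = exp (-b) * (\<Sum>k\<in>{..n}. measure S1 {\<omega>\<in>space S1. exit_walk b \<omega> = enat k})"
      by (simp add: sum_distrib_left)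
    also have "(\<Sum>k\<in>{..n}. measure S1 {\<omega>\<in>space S1. exit_walk b \<omega> = enat k})
        = measure S1 (\<Union>k\<in>{..n}. {\<omega>\<in>space S1. exit_walk b \<omega> = enat k})"
    proof (intro N1.P.finite_measure_finite_Union[symmetric] image_subsetI)
      show "{\<omega>\<in>space S1. exit_walk b \<omega> = enat k} \<in> sets S1" for k
        by measurable
    qed (auto simp: disjoint_family_on_def)
    also have "exp (-b) * measure S1 (\<Union>k\<in>{..n}. {\<omega>\<in>space S1. exit_walk b \<omega> = enat k}) \<le> exp (-b) * 1"
      by (intro mult_left_mono N1.P.prob_le_1) simp
    finally have up_sum: "(\<Sum>k\<in>{..n}. measure S0 (?U k)) \<le> exp (-b)" by simp
    have "1 = measure S0 (space S0)" by (simp add: N0.P.prob_space[simplified])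
    also have "\<dots> \<le> measure S0 ((?D \<union> (\<Union>k\<in>{..n}. ?U k)) \<union> ?N)"
      by (rule N0.P.finite_measure_mono[OF cover]) measurable
    also have "\<dots> \<le> measure S0 (?D \<union> (\<Union>k\<in>{..n}. ?U k)) + measure S0 ?N"
      by (rule measure_Un_le) measurable
    also have "measure S0 (?D \<union> (\<Union>k\<in>{..n}. ?U k)) \<le> measure S0 ?D + measure S0 (\<Union>k\<in>{..n}. ?U k)"
      by (rule measure_Un_le) measurable
    also have "measure S0 (\<Union>k\<in>{..n}. ?U k) \<le> (\<Sum>k\<in>{..n}. measure S0 (?U k))"
      by (intro measure_UNION_le finite_atMost) measurable
    also note up_sum
    also have "measure S0 ?N = q n"
      by (simp add: q_def walk_eq_sum)
    finally show ?thesis by simp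
  qed
  moreover have "(\<lambda>n. exp (-b) + q n) \<longlonglongrightarrow> exp (-b) + 0"
    by (intro tendsto_intros q)
  ultimately show ?thesis
    by (intro LIMSEQ_le_const[of "\<lambda>n. exp (-b) + q n"]) auto
qed

text \<open>Since \<open>exp (l x)\<close> has mean 1 under \<open>M0\<close>, the mean of
  \<open>y\<close> after a step from \<open>s\<close> is at most \<open>exp s\<close>. This exceeds
  \<open>y s\<close> only for \<open>s \<le> 0\<close>, where \<open>exp s\<close> is at most the
  allowed increment 1. Setting \<open>y\<close> to 0 rather than 1 at the origin makes the start
  free.\<close>

lemma expected_cusum_time_ge:
  assumes a: "0 < a"
  shows "ennreal (exp a) \<le> (\<integral>\<^sup>+\<omega>. ennreal_of_enat (hit (\<lambda>s x. max 0 (s + l x)) {a<..} 0 \<omega>) \<partial>S0)"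
proof (rule N0.le_expected_hit[where y = "\<lambda>c. if 0 < c then ennreal (exp c) else 0"])
  fix s :: real assume "s \<notin> {a<..}"
  have "(\<integral>\<^sup>+x. (if 0 < max 0 (s + l x) then ennreal (exp (max 0 (s + l x))) else 0) \<partial>M0)
     \<le> (\<integral>\<^sup>+x. ennreal (exp s) * ennreal (exp (l x)) \<partial>M0)"
    by (intro nn_integral_mono) (auto simp: ennreal_mult[symmetric] exp_add[symmetric] max_def)
  also have "\<dots> = ennreal (exp s) * (\<integral>\<^sup>+x. 1 * ennreal (exp (l x)) \<partial>M0)"
    by (simp, intro nn_integral_cmult N0.borel_measurable_M) simp
  also have "(\<integral>\<^sup>+x. 1 * ennreal (exp (l x)) \<partial>M0) = 1"
    using nn_integral_M1[of "\<lambda>_. 1"] by (simp add: prob_space.emeasure_space_1[OF N1.prob_space_M, simplified])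
  also have "ennreal (exp s) * 1 \<le> 1 + (if 0 < s then ennreal (exp s) else 0)"
    by auto
  finally show "(\<integral>\<^sup>+x. (if 0 < max 0 (s + l x) then ennreal (exp (max 0 (s + l x))) else 0) \<partial>M0)
     \<le> 1 + (if 0 < s then ennreal (exp s) else 0)" .
next
  fix s :: real assume "s \<in> {a<..}"
  then show "ennreal (exp a) \<le> (if 0 < s then ennreal (exp s) else 0)"
    using a by (auto intro!: ennreal_leI)
qed (use a in auto)

section \<open>Average run length\<close>

text \<open>\<open>\<xi>\<close> stands for the censored log-likelihood ratio, used below \<open>a1\<close>.\<close>
definition ac_step :: "(real \<Rightarrow> real) \<Rightarrow> real \<Rightarrow> real \<Rightarrow> real \<Rightarrow> real" where
  "ac_step \<xi> a1 s x =
     (if s < a1 then (if a1 \<le> max 0 (s + \<xi> x) then a1 else max 0 (s + \<xi> x)) else max 0 (s + l x))"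

lemma ac_step_low:
  "s < a1 \<Longrightarrow> ac_step \<xi> a1 s x = (if a1 \<le> max 0 (s + \<xi> x) then a1 else max 0 (s + \<xi> x))"
  by (simp add: ac_step_def)

lemma ac_step_high: "a1 \<le> s \<Longrightarrow> ac_step \<xi> a1 s x = max 0 (s + l x)"
  by (simp add: ac_step_def)

abbreviation low_step :: "(real \<Rightarrow> real) \<Rightarrow> real \<Rightarrow> real \<Rightarrow> real" where
  "low_step \<xi> \<equiv> \<lambda>s x. max 0 (s + \<xi> x)"

lemma measurable_ac_step [measurable]:
  assumes [measurable]: "\<xi> \<in> borel_measurable borel"
  shows "(\<lambda>(s, x). ac_step \<xi> a1 s x) \<in> borel_measurable (borel \<Otimes>\<^sub>M borel)"
  unfolding ac_step_def by measurable

lemma measurable_low_step [measurable]: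
  assumes [measurable]: "\<xi> \<in> borel_measurable borel"
  shows "(\<lambda>(s, x). low_step \<xi> s x) \<in> borel_measurable (borel \<Otimes>\<^sub>M borel)"
  by measurable

lemma run_low_step_mono: "z \<le> z' \<Longrightarrow> run (low_step \<xi>) z k \<omega> \<le> run (low_step \<xi>) z' k \<omega>"
  by (induction k) auto

text \<open>Coupling along the same observations. It makes 0 the starting point with the longest
  return, which links the averaged condition of \<open>E_arl\<close> to the actual start of the
  algorithm.\<close>

lemma hit_low_step_antimono:
  assumes "z \<le> z'"
  shows "hit (low_step \<xi>) {a1..} z' \<omega> \<le> hit (low_step \<xi>) {a1..} z \<omega>"
proof (cases "hit (low_step \<xi>) {a1..} z \<omega>")
  case (enat n)
  then have "1 \<le> n" "a1 \<le> run (low_step \<xi>) z n \<omega>"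
    by (auto simp: hit_def first_time_eq_iff)
  then have "a1 \<le> run (low_step \<xi>) z' n \<omega>"
    using run_low_step_mono[OF assms] order_trans by blast
  then show ?thesis
    unfolding enat using \<open>1 \<le> n\<close> by (auto simp: hit_def first_time_le_iff)
qed simp

lemma run_ac_eq_run_low:
  assumes "z < a1" "\<And>j. 1 \<le> j \<Longrightarrow> j \<le> k \<Longrightarrow> run (low_step \<xi>) z j \<omega> < a1"
  shows "run (ac_step \<xi> a1) z k \<omega> = run (low_step \<xi>) z k \<omega>"
  using assms(2)
proof (induction k)
  case (Suc k)
  then have IH: "run (ac_step \<xi> a1) z k \<omega> = run (low_step \<xi>) z k \<omega>" by simp
  have "run (low_step \<xi>) z k \<omega> < a1"
    using Suc.prems[of k] assms(1) by (cases k) auto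
  moreover have "run (low_step \<xi>) z (Suc k) \<omega> < a1"
    by (rule Suc.prems) auto
  ultimately show ?case
    using IH by (simp add: ac_step_low max_def)
qed simp

text \<open>While the walk is nonnegative the statistic stays at or above \<open>a1 > 0\<close>, so
  it moves by \<open>l\<close> and reflection is inactive; it can act only at the last step.\<close>

lemma run_ac_eq_walk:
  assumes "0 < a1" "\<And>j. 1 \<le> j \<Longrightarrow> j < k \<Longrightarrow> 0 \<le> walk j \<omega>"
  shows "run (ac_step \<xi> a1) a1 k \<omega> = max 0 (a1 + walk k \<omega>)"
  using assms(2)
proof (induction k)
  case 0
  then show ?case using assms(1) by simp
next
  case (Suc k)
  then have IH: "run (ac_step \<xi> a1) a1 k \<omega> = max 0 (a1 + walk k \<omega>)" by simp
  have "0 \<le> walk k \<omega>"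
    using Suc.prems[of k] by (cases k) auto
  then show ?case
    using IH assms(1) by (simp add: ac_step_high add.assoc)
qed

text \<open>Strong Markov property at a downward exit, by summing the fixed-time version over the
  exit time. It serves both the return times in \<open>E_arl\<close> and the run length of
  CuSum-AC.\<close>

lemma first_passage_after_down:
  assumes [measurable]: "case_prod f \<in> borel_measurable (borel \<Otimes>\<^sub>M borel)" "B \<in> sets borel"
  shows "(\<Sum>n. \<integral>\<^sup>+\<omega>. of_bool (down b n \<omega>) *
      (\<integral>\<^sup>+\<omega>'. ennreal_of_enat (hit f B (max 0 (a1 + walk n \<omega>)) \<omega>') \<partial>S0) \<partial>S0)
    = (\<integral>\<^sup>+\<omega>. (\<Sum>n. of_bool (down b n \<omega>) *
        ennreal_of_enat (hit f B (max 0 (a1 + walk n \<omega>)) (shift n \<omega>))) \<partial>S0)"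
proof -
  let ?h = "\<lambda>n \<omega> \<omega>'. of_bool (down b n \<omega>) * ennreal_of_enat (hit f B (max 0 (a1 + walk n \<omega>)) \<omega>')"
  have m: "(\<lambda>z. ennreal_of_enat (hit f B (max 0 (a1 + walk n (fst z))) (snd z))) \<in> borel_measurable (S0 \<Otimes>\<^sub>M S0)" for n
    by measurable
  note [measurable] = m
  have "(\<Sum>n. \<integral>\<^sup>+\<omega>. of_bool (down b n \<omega>) *
      (\<integral>\<^sup>+\<omega>'. ennreal_of_enat (hit f B (max 0 (a1 + walk n \<omega>)) \<omega>') \<partial>S0) \<partial>S0)
     = (\<Sum>n. \<integral>\<^sup>+\<omega>. (\<integral>\<^sup>+\<omega>'. ?h n \<omega> \<omega>' \<partial>S0) \<partial>S0)"
    by (intro suminf_cong nn_integral_cong) (auto simp: of_bool_def)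
  also have "\<dots> = (\<Sum>n. \<integral>\<^sup>+\<omega>. ?h n \<omega> (shift n \<omega>) \<partial>S0)"
  proof (intro suminf_cong N0.nn_integral_shift[symmetric])
    fix n
    show "(\<lambda>(\<omega>, \<omega>'). ?h n \<omega> \<omega>')
        \<in> borel_measurable (S0 \<Otimes>\<^sub>M S0)"
      unfolding split_beta' by measurable
    show "depends_on_first n (\<lambda>\<omega>. ?h n \<omega> \<omega>')" for \<omega>'
      by (rule depends_on_first_map2[OF depends_on_first_down depends_on_first_run,
        where h = "\<lambda>u t. of_bool u * ennreal_of_enat (hit f B (max 0 (a1 + t)) \<omega>')"])
  qed
  also have "\<dots> = (\<integral>\<^sup>+\<omega>. (\<Sum>n. ?h n \<omega> (shift n \<omega>)) \<partial>S0)"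
    by (rule nn_integral_suminf[symmetric]) measurable
  finally show ?thesis .
qed

section \<open>Renewal inequality for the run length\<close>

context
  fixes \<xi> :: "real \<Rightarrow> real" and a1 a :: real
  assumes \<xi> [measurable]: "\<xi> \<in> borel_measurable borel" and a1: "0 < a1" "a1 < a"
begin

abbreviation "ac_hit \<equiv> hit (ac_step \<xi> a1) {a..}"
abbreviation "low_hit \<equiv> hit (low_step \<xi>) {a1..}"
abbreviation "V s \<equiv> (\<integral>\<^sup>+\<omega>. ennreal_of_enat (ac_hit s \<omega>) \<partial>S0)"
abbreviation "U z \<equiv> (\<integral>\<^sup>+\<omega>. ennreal_of_enat (low_hit z \<omega>) \<partial>S0)"

lemma U_antimono: "z \<le> z' \<Longrightarrow> U z' \<le> U z"
  by (intro nn_integral_mono ennreal_of_enat_le_iff[THEN iffD2] hit_low_step_antimono)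

text \<open>On crossing, the overshoot is discarded and the statistic set to \<open>a1\<close>, so
  every return is a renewal; it cannot be an alarm because \<open>a1 < a\<close>.\<close>

lemma ac_hit_after_low_hit:
  assumes "z < a1" "low_hit z \<omega> = enat n"
  shows "ac_hit z \<omega> = enat n + ac_hit a1 (shift n \<omega>)"
proof -
  have n: "1 \<le> n" "a1 \<le> run (low_step \<xi>) z n \<omega>" "\<And>j. 1 \<le> j \<Longrightarrow> j < n \<Longrightarrow> run (low_step \<xi>) z j \<omega> < a1"
    using assms(2) by (auto simp: hit_def first_time_eq_iff not_le)
  then obtain m where m: "n = Suc m" by (cases n) auto
  have eq: "run (ac_step \<xi> a1) z j \<omega> = run (low_step \<xi>) z j \<omega>" if "j < n" for j
    using n(3) that assms(1) by (intro run_ac_eq_run_low) auto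
  have "run (low_step \<xi>) z m \<omega> < a1"
    using n(3)[of m] assms(1) m by (cases m) auto
  then have last: "run (ac_step \<xi> a1) z n \<omega> = a1"
    using eq[of m] n(2) by (simp add: m ac_step_low)
  have "run (ac_step \<xi> a1) z j \<omega> < a" if "1 \<le> j" "j \<le> n" for j
    using that n(3)[of j] eq[of j] last a1 by (cases "j = n") auto
  then have "enat n < ac_hit z \<omega>"
    unfolding hit_def less_first_time_iff by (auto simp: not_le)
  from hit_shift[OF this] show ?thesis by (simp add: last)
qed

lemma ac_hit_ge_low_hit:
  assumes "z < a1" shows "low_hit z \<omega> \<le> ac_hit z \<omega>"
proof (cases "low_hit z \<omega>")
  case (enat n)
  then show ?thesis by (simp add: ac_hit_after_low_hit[OF assms])
next
  case infinity
  then have "enat j < low_hit z \<omega>" for j by simp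
  have low: "run (low_step \<xi>) z j \<omega> < a1" if "1 \<le> j" for j
    using that \<open>enat j < low_hit z \<omega>\<close> unfolding hit_def less_first_time_iff by (auto simp: not_le)
  have "run (ac_step \<xi> a1) z j \<omega> < a" if "1 \<le> j" for j
    using low low[OF that] assms a1 by (subst run_ac_eq_run_low) auto
  then have "enat j < ac_hit z \<omega>" for j
    unfolding hit_def less_first_time_iff by (auto simp: not_le)
  then have "ac_hit z \<omega> = \<infinity>"
    by (cases "ac_hit z \<omega>") auto
  then show ?thesis by simp
qed

text \<open>Strong Markov property at the return to \<open>a1\<close>. If \<open>U z\<close> is
  infinite, so is \<open>V z\<close>, as no alarm precedes the return; otherwise the return is
  almost surely finite and summing over its value loses nothing.\<close>

lemma V_low: "z < a1 \<Longrightarrow> U z + V a1 \<le> V z"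
proof (cases "U z = \<infinity>")
  case True
  assume z: "z < a1"
  have "U z \<le> V z"
    by (intro nn_integral_mono ennreal_of_enat_le_iff[THEN iffD2] ac_hit_ge_low_hit z)
  then show ?thesis using True by (simp add: top_unique)
next
  case False
  assume z: "z < a1"
  let ?c = "V a1"
  let ?h = "\<lambda>n \<omega> \<omega>'. of_bool (low_hit z \<omega> = enat n) * (of_nat n + ennreal_of_enat (ac_hit a1 \<omega>'))"
  have "AE \<omega> in S0. ennreal_of_enat (low_hit z \<omega>) \<noteq> \<infinity>"
    using False by (intro nn_integral_noteq_infinite) measurable
  then have fin: "AE \<omega> in S0. low_hit z \<omega> \<noteq> \<infinity>"
  proof eventually_elim
    case (elim \<omega>)
    then show ?case by (cases "low_hit z \<omega>") auto
  qed
  have "U z + ?c = (\<integral>\<^sup>+\<omega>. ennreal_of_enat (low_hit z \<omega>) + ?c \<partial>S0)"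
    by (subst nn_integral_add) (auto simp: N0.P.emeasure_space_1[simplified])
  also have "\<dots> = (\<integral>\<^sup>+\<omega>. (\<Sum>n. of_bool (low_hit z \<omega> = enat n) * (of_nat n + ?c)) \<partial>S0)"
  proof (rule nn_integral_cong_AE, use fin in eventually_elim)
    case (elim \<omega>)
    then obtain m where m: "low_hit z \<omega> = enat m" by (cases "low_hit z \<omega>") auto
    show ?case
      by (subst suminf_of_bool_unique[where m = m]) (auto simp: m)
  qed
  also have "\<dots> = (\<Sum>n. \<integral>\<^sup>+\<omega>. of_bool (low_hit z \<omega> = enat n) * (of_nat n + ?c) \<partial>S0)"
    by (rule nn_integral_suminf) measurable
  also have "\<dots> = (\<Sum>n. \<integral>\<^sup>+\<omega>. (\<integral>\<^sup>+\<omega>'. ?h n \<omega> \<omega>' \<partial>S0) \<partial>S0)"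
    by (intro suminf_cong nn_integral_cong)
      (auto simp: of_bool_def nn_integral_add N0.P.emeasure_space_1[simplified])
  also have "\<dots> = (\<Sum>n. \<integral>\<^sup>+\<omega>. ?h n \<omega> (shift n \<omega>) \<partial>S0)"
  proof (intro suminf_cong N0.nn_integral_shift[symmetric])
    fix n
    show "(\<lambda>(\<omega>, \<omega>'). ?h n \<omega> \<omega>')
        \<in> borel_measurable (S0 \<Otimes>\<^sub>M S0)"
      unfolding split_beta' by measurable
    show "depends_on_first n (\<lambda>\<omega>. ?h n \<omega> \<omega>')" for \<omega>'
      by (rule depends_on_first_map2[OF depends_on_first_hit_eq depends_on_first_hit_eq,
        where h = "\<lambda>u _. of_bool u * (of_nat n + ennreal_of_enat (ac_hit a1 \<omega>'))"])
  qed
  also have "\<dots> = (\<integral>\<^sup>+\<omega>. (\<Sum>n. ?h n \<omega> (shift n \<omega>)) \<partial>S0)"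
    by (rule nn_integral_suminf[symmetric]) measurable
  also have "\<dots> \<le> V z"
  proof (rule nn_integral_mono)
    fix \<omega>
    show "(\<Sum>n. ?h n \<omega> (shift n \<omega>))
        \<le> ennreal_of_enat (ac_hit z \<omega>)"
    proof (cases "low_hit z \<omega>")
      case (enat m)
      show ?thesis
        by (subst suminf_of_bool_unique[where m = m])
          (auto simp: enat ac_hit_after_low_hit[OF z enat] ennreal_of_enat_add)
    qed simp
  qed
  finally show ?thesis .
qed

text \<open>Until the downward exit the walk is at most \<open>b < a - a1\<close>, so no alarm
  occurs. With \<open>b = a - a1\<close> the walk could sit at \<open>b\<close>, inside the closed
  exit interval, when the alarm is already raised. Paths without a downward exit are
  dropped.\<close>

lemma V_a1:
  assumes b: "0 < b" "b < a - a1"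
  shows "(\<Sum>n. \<integral>\<^sup>+\<omega>. of_bool (down b n \<omega>) * V (max 0 (a1 + walk n \<omega>)) \<partial>S0) \<le> V a1"
proof -
  have "(\<Sum>n. \<integral>\<^sup>+\<omega>. of_bool (down b n \<omega>) * V (max 0 (a1 + walk n \<omega>)) \<partial>S0)
     = (\<integral>\<^sup>+\<omega>. (\<Sum>n. of_bool (down b n \<omega>) * ennreal_of_enat (ac_hit (max 0 (a1 + walk n \<omega>)) (shift n \<omega>))) \<partial>S0)"
    by (rule first_passage_after_down) measurable
  also have "\<dots> \<le> V a1"
  proof (rule nn_integral_mono)
    fix \<omega>
    show "(\<Sum>n. of_bool (down b n \<omega>) * ennreal_of_enat (ac_hit (max 0 (a1 + walk n \<omega>)) (shift n \<omega>)))
        \<le> ennreal_of_enat (ac_hit a1 \<omega>)"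
    proof (cases "\<exists>n. down b n \<omega>")
      case True
      then obtain n where n: "down b n \<omega>" by blast
      then have walk_n: "walk n \<omega> < 0" "1 \<le> n"
        and walk_j: "\<And>j. 1 \<le> j \<Longrightarrow> j < n \<Longrightarrow> 0 \<le> walk j \<omega> \<and> walk j \<omega> \<le> b"
        by (auto simp: down_def hit_def first_time_eq_iff)
      have eq: "run (ac_step \<xi> a1) a1 j \<omega> = max 0 (a1 + walk j \<omega>)" if "j \<le> n" for j
        using walk_j that a1 by (intro run_ac_eq_walk) auto
      have "run (ac_step \<xi> a1) a1 j \<omega> < a" if "1 \<le> j" "j \<le> n" for j
        using walk_j[of j] walk_n that a1 b by (cases "j = n") (auto simp: eq)
      then have "enat n < ac_hit a1 \<omega>"
        unfolding hit_def less_first_time_iff by (auto simp: not_le)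
      from hit_shift[OF this] have "ac_hit a1 \<omega> = enat n + ac_hit (max 0 (a1 + walk n \<omega>)) (shift n \<omega>)"
        by (simp add: eq)
      moreover have "m = n" if "down b m \<omega>" for m
        using that n by (auto simp: down_def)
      ultimately show ?thesis
        by (subst suminf_of_bool_unique[where m = n]) (auto simp: n ennreal_of_enat_add add_increasing)
    qed simp
  qed
  finally show ?thesis .
qed

text \<open>With \<open>p\<close> the probability of a downward exit,
  \<open>V a1 \<ge> p * (t + V a1)\<close>; since \<open>1 - p \<le> exp (-b)\<close>, this gives
  \<open>t + V a1 \<ge> t * exp b\<close>, and the left side is at most \<open>V 0\<close>.\<close>

lemma expected_ac_hit_ge:
  assumes b: "0 < b" "b < a - a1" and t: "ennreal (exp a1) \<le> t"
    and pos: "0 < emeasure S0 {\<omega>. \<exists>n. down b n \<omega>}"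
    and return: "t * emeasure S0 {\<omega>. \<exists>n. down b n \<omega>}
       \<le> (\<Sum>n. \<integral>\<^sup>+\<omega>. of_bool (down b n \<omega>) * U (max 0 (a1 + walk n \<omega>)) \<partial>S0)"
  shows "ennreal (exp (a1 + b)) \<le> V 0"
proof -
  let ?u = "\<lambda>n. \<integral>\<^sup>+\<omega>. of_bool (down b n \<omega>) * U (max 0 (a1 + walk n \<omega>)) \<partial>S0"
  let ?v = "\<lambda>n. \<integral>\<^sup>+\<omega>. of_bool (down b n \<omega>) * V (max 0 (a1 + walk n \<omega>)) \<partial>S0"
  let ?N = "\<Sum>n. ?u n"
  define p where "p = measure S0 {\<omega>. \<exists>n. down b n \<omega>}"
  have ep: "emeasure S0 {\<omega>. \<exists>n. down b n \<omega>} = ennreal p"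
    by (simp add: p_def N0.P.emeasure_eq_measure)
  have p: "0 < p" "p \<le> 1" using pos ep by (auto simp: p_def)
  have V0: "U 0 + V a1 \<le> V 0"
    using a1 by (intro V_low) auto
  \<comment> \<open>Every return time in the average is dominated by the one from 0; since
    \<open>p > 0\<close> it cancels and leaves \<open>t \<le> U 0\<close>.\<close>
  have "?N \<le> (\<Sum>n. \<integral>\<^sup>+\<omega>. U 0 * of_bool (down b n \<omega>) \<partial>S0)"
    by (intro suminf_le nn_integral_mono) (auto simp: mult.commute intro!: mult_right_mono U_antimono)
  also have "\<dots> = U 0 * ennreal p"
    by (subst nn_integral_cmult) (auto simp: nn_integral_of_bool emeasure_ex_down ep[symmetric])
  finally have "t * ennreal p \<le> U 0 * ennreal p"
    using return unfolding ep by (rule order_trans[rotated])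
  then have t0: "t \<le> U 0"
    using p by (subst (asm) (1 2) mult.commute) (simp add: ennreal_mult_le_mult_iff)
  have "?N + V a1 * ennreal p = (\<Sum>n. ?u n
      + (\<integral>\<^sup>+\<omega>. V a1 * of_bool (down b n \<omega>) \<partial>S0))"
    by (subst suminf_add[symmetric], (auto)[2], subst nn_integral_cmult)
      (auto simp: nn_integral_of_bool emeasure_ex_down ep[symmetric])
  also have "\<dots> \<le> (\<Sum>n. ?v n)"
  proof (rule suminf_le)
    fix n
    have "?u n + (\<integral>\<^sup>+\<omega>. V a1 * of_bool (down b n \<omega>) \<partial>S0)
       = (\<integral>\<^sup>+\<omega>. of_bool (down b n \<omega>) * (U (max 0 (a1 + walk n \<omega>)) + V a1) \<partial>S0)"
      by (subst nn_integral_add[symmetric]) (auto simp: distrib_left mult.commute)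
    also have "\<dots> \<le> ?v n"
    proof (rule nn_integral_mono)
      fix \<omega>
      show "of_bool (down b n \<omega>) * (U (max 0 (a1 + walk n \<omega>)) + V a1) \<le> of_bool (down b n \<omega>) * V (max 0 (a1 + walk n \<omega>))"
        using a1 by (cases "down b n \<omega>") (auto simp: down_def intro!: V_low)
    qed
    finally show "?u n + (\<integral>\<^sup>+\<omega>. V a1 * of_bool (down b n \<omega>) \<partial>S0)
      \<le> ?v n" .
  qed auto
  also have "\<dots> \<le> V a1" by (rule V_a1[OF b])
  finally have "?N + V a1 * ennreal p \<le> V a1" .
  then have "t * ennreal p + V a1 * ennreal p \<le> V a1"
    using order_trans[OF add_right_mono[OF return]] unfolding ep by blast
  moreover have "t + V a1 \<le> V 0"
    using order_trans[OF add_right_mono[OF t0] V0] .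
  ultimately show ?thesis
  \<comment> \<open>If either term is infinite, so is \<open>V 0\<close>; otherwise the renewal
    inequality can be rearranged in the reals.\<close>
  proof (cases "t = \<infinity> \<or> V a1 = \<infinity>")
    case False
    then obtain t' c where tc: "t = ennreal t'" "0 \<le> t'" "V a1 = ennreal c" "0 \<le> c"
      by (cases t; cases "V a1") auto
    have "t' * p + c * p \<le> c"
      using \<open>t * ennreal p + V a1 * ennreal p \<le> V a1\<close> tc p
      by (simp add: ennreal_mult[symmetric] ennreal_plus[symmetric] del: ennreal_plus)
    then have "t' \<le> (t' + c) * (1 - p)" by (simp add: algebra_simps)
    also have "\<dots> \<le> (t' + c) * exp (-b)"
      using measure_never_down[of b] tc by (intro mult_left_mono) (auto simp: p_def)
    finally have "t' * exp b \<le> t' + c"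
      by (simp add: exp_minus field_simps)
    moreover have "exp a1 \<le> t'"
      using t tc by simp
    then have "exp a1 * exp b \<le> t' * exp b" by (rule mult_right_mono) simp
    ultimately have "exp (a1 + b) \<le> t' + c" unfolding exp_add by linarith
    then have "ennreal (exp (a1 + b)) \<le> t + V a1"
      using tc by (simp add: ennreal_plus[symmetric] ennreal_leI del: ennreal_plus)
    then show ?thesis using \<open>t + V a1 \<le> V 0\<close> by (rule order_trans)
  qed (auto simp: top_unique)
qed

end

section \<open>Detection delay from an arbitrary state\<close>

lemma pos_of_mean_pos:
  fixes h :: "real \<Rightarrow> real"
  assumes [measurable]: "h \<in> borel_measurable borel" and int: "integrable M1 h" and mean: "0 < (\<integral>x. h x \<partial>M1)"
  shows "0 < measure M1 {x. 0 < h x}"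
proof (rule ccontr)
  assume "\<not> 0 < measure M1 {x. 0 < h x}"
  then have "emeasure M1 {x\<in>space M1. 0 < h x} = 0"
    by (simp add: N1.emeasure_M not_less
        measure_le_0_iff)
  then have "AE x in M1. h x \<le> 0"
    by (subst (asm) AE_iff_measurable[symmetric, where P = "\<lambda>x. h x \<le> 0"])
      (auto simp: not_le intro!: borel_measurable_le N1.borel_measurable_M)
  then have "(\<integral>x. h x \<partial>M1) \<le> (\<integral>x. 0 \<partial>M1)"
    by (intro integral_mono_AE int) auto
  then show False using mean by simp
qed

lemma pos_step:
  fixes \<xi> :: "real \<Rightarrow> real"
  assumes [measurable]: "\<xi> \<in> borel_measurable borel" and pos: "0 < measure M1 {x. 0 < \<xi> x}"
  obtains c where "0 < c" "0 < measure M1 {x. c \<le> \<xi> x}"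
proof (rule ccontr)
  note result = that
  assume "\<not> thesis"
  then have null: "measure M1 {x. c \<le> \<xi> x} = 0" if "0 < c" for c
    using result[OF that] by (auto simp: zero_less_measure_iff)
  have "{x. 0 < \<xi> x} = (\<Union>n. {x. inverse (real (Suc n)) \<le> \<xi> x})"
  proof (intro set_eqI iffI)
    fix x assume "x \<in> {x. 0 < \<xi> x}"
    then obtain n where "inverse (real (Suc n)) < \<xi> x"
      using reals_Archimedean by blast
    then show "x \<in> (\<Union>n. {x. inverse (real (Suc n)) \<le> \<xi> x})"
      by (auto intro: less_imp_le)
  next
    fix x assume "x \<in> (\<Union>n. {x. inverse (real (Suc n)) \<le> \<xi> x})"
    then obtain n where "inverse (real (Suc n)) \<le> \<xi> x" by auto
    then show "x \<in> {x. 0 < \<xi> x}"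
      using less_le_trans[of 0 "inverse (real (Suc n))" "\<xi> x"] by simp
  qed
  moreover have "emeasure M1 (\<Union>n. {x. inverse (real (Suc n)) \<le> \<xi> x}) = 0"
  proof (rule emeasure_UN_eq_0)
    fix n
    show "emeasure M1 {x. inverse (real (Suc n)) \<le> \<xi> x} = 0"
      using null[of "inverse (real (Suc n))"]
      by (simp add: N1.emeasure_M)
    show "range (\<lambda>n. {x. inverse (real (Suc n)) \<le> \<xi> x}) \<subseteq> sets M1"
      by (auto simp: N1.sets_M)
  qed
  ultimately have "emeasure M1 {x. 0 < \<xi> x} = 0" by simp
  then show False using pos by (simp add: measure_def)
qed

lemma nn_integral_exp_minus_l: "(\<integral>\<^sup>+x. ennreal (exp (- l x)) \<partial>M1) = 1"
proof -
  have "(\<integral>\<^sup>+x. ennreal (exp (- l x)) \<partial>M1) = (\<integral>\<^sup>+x. 1 \<partial>M0)"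
    by (subst nn_integral_M1) (auto simp: ennreal_mult[symmetric] exp_add[symmetric] simp del: nn_integral_const)
  then show ?thesis by (simp add: prob_space.emeasure_space_1[OF N0.prob_space_M, simplified])
qed

lemma integrable_exp_minus_l: "integrable M1 (\<lambda>x. exp (- l x))"
  using nn_integral_exp_minus_l
  by (intro integrableI_nonneg) (auto intro!: N1.borel_measurable_M)

lemma integral_exp_minus_l: "(\<integral>x. exp (- l x) \<partial>M1) = 1"
  using nn_integral_exp_minus_l
  by (subst integral_eq_nn_integral) (auto intro!: N1.borel_measurable_M)

lemma integrable_min_l: "integrable M1 (\<lambda>x. min (l x) B)"
  by (intro integrable_min integrable_l1 N1.integrable_const_M)

lemma tendsto_mean_min_l: "(\<lambda>n. \<integral>x. min (l x) (real n) \<partial>M1) \<longlonglongrightarrow> (\<integral>x. l x \<partial>M1)"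
proof (rule integral_dominated_convergence[where w = "\<lambda>x. \<bar>l x\<bar>"])
  show "AE x in M1. (\<lambda>n. min (l x) (real n)) \<longlonglongrightarrow> l x"
  proof (intro AE_I2 tendsto_eventually)
    fix x
    obtain N where N: "l x \<le> real N" using real_arch_simple by blast
    show "\<forall>\<^sub>F n in sequentially. min (l x) (real n) = l x"
      using N by (intro eventually_sequentiallyI[of N]) (auto simp: min_def)
  qed
  show "AE x in M1. norm (min (l x) (real n)) \<le> \<bar>l x\<bar>" for n
    by (auto simp: min_def)
qed (use integrable_l1 integrable_min_l in auto)

text \<open>
  The Lyapunov function is, up to the constant \<open>m\<close>, the distance \<open>a - s\<close> divided by the truncated
  drift.  The superharmonic part \<open>m * survive s\<close> pays for the excursions below \<open>a1\<close>: it is constant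
  below \<open>a1\<close> and has dropped by the factor \<open>survive a1 < 1\<close> on return to \<open>a1\<close>.
\<close>
definition survive :: "real \<Rightarrow> real \<Rightarrow> real" where
  "survive a1 s = (\<integral>x. min 1 (exp (a1 - (s + l x))) \<partial>M1)"

lemma integrable_survive: "integrable M1 (\<lambda>x. min 1 (exp (a1 - (s + l x))))"
  by (rule finite_measure.integrable_const_bound[OF N1.finite_measure_M, where B = 1])
    (auto intro!: N1.borel_measurable_M)

lemma measurable_survive [measurable]: "survive a1 \<in> borel_measurable borel"
proof -
  have "(\<lambda>s. \<integral>x. min 1 (exp (a1 - (s + l x))) \<partial>M1) \<in> borel_measurable borel"
    by (rule sigma_finite_measure.borel_measurable_lebesgue_integral[OF N1.sigma_finite_measure_M])
      measurable
  then show ?thesis by (simp add: survive_def[abs_def])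
qed

lemma survive_nonneg: "0 \<le> survive a1 s"
  unfolding survive_def by (intro integral_nonneg_AE) auto

text \<open>The function \<open>min 1 (exp (a1 - s))\<close> is superharmonic for the post-change
  walk, since \<open>exp (- l x)\<close> has mean 1 under \<open>M1\<close>.\<close>

lemma survive_le: "survive a1 s \<le> min 1 (exp (a1 - s))"
proof -
  have "survive a1 s \<le> (\<integral>x. 1 \<partial>M1)"
    unfolding survive_def by (intro integral_mono integrable_survive)
      (auto intro!: N1.integrable_const_M)
  moreover have "survive a1 s \<le> (\<integral>x. exp (a1 - s) * exp (- l x) \<partial>M1)"
    unfolding survive_def by (intro integral_mono integrable_survive integrable_mult_right integrable_exp_minus_l)
      (simp add: exp_add[symmetric] algebra_simps)
  ultimately show ?thesis
    by (simp add: integral_exp_minus_l N1.measure_M_UNIV)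
qed

text \<open>Equality would force \<open>l \<le> 0\<close> almost surely under \<open>M1\<close>,
  against its positive mean.\<close>

lemma survive_less_1: "survive a1 a1 < 1"
proof (rule ccontr)
  assume "\<not> survive a1 a1 < 1"
  then have "survive a1 a1 = 1" using survive_le[of a1 a1] by simp
  then have "(\<integral>x. 1 - min 1 (exp (a1 - (a1 + l x))) \<partial>M1) = 0"
    using integrable_survive[of a1 a1]
    by (subst Bochner_Integration.integral_diff)
      (auto simp: survive_def N1.measure_M_UNIV
        intro!: N1.integrable_const_M)
  then have "AE x in M1. 1 - min 1 (exp (a1 - (a1 + l x))) = 0"
    using integrable_survive[of a1 a1]
    by (subst (asm) integral_nonneg_eq_0_iff_AE)
      (auto intro!: N1.integrable_const_M)
  then have "AE x in M1. \<not> 0 < l x"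
    by eventually_elim (auto simp: min_def split: if_splits)
  then have "emeasure M1 {x\<in>space M1. \<not> \<not> 0 < l x} = 0"
    by (subst (asm) AE_iff_measurable[OF _ refl]) (auto simp: N1.sets_M)
  then have "measure M1 {x. 0 < l x} = 0"
    by (simp add: measure_def)
  then show False using pos_of_mean_pos[OF l integrable_l1 mean1] by simp
qed

lemma expected_ac_hit_le:
  assumes \<xi> [measurable]: "\<xi> \<in> borel_measurable borel" and pos: "0 < measure M1 {x. 0 < \<xi> x}"
    and a1: "0 < a1"
  obtains K where "\<And>a B s. a1 < a \<Longrightarrow> 0 \<le> B \<Longrightarrow> 0 < (\<integral>x. min (l x) B \<partial>M1) \<Longrightarrow> 0 \<le> s \<Longrightarrow> s < a \<Longrightarrow>
    (\<integral>\<^sup>+\<omega>. ennreal_of_enat (hit (ac_step \<xi> a1) {a..} s \<omega>) \<partial>S1) \<le> ennreal ((a + B) / (\<integral>x. min (l x) B \<partial>M1) + K)"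
proof -
  obtain c where c: "0 < c" and pc: "0 < measure M1 {x. c \<le> \<xi> x}"
    using pos_step[OF \<xi> pos] by blast
  define p where "p = measure M1 {x. c \<le> \<xi> x}"
  have p: "0 < p" "p \<le> 1" using pc prob_space.prob_le_1[OF N1.prob_space_M] by (auto simp: p_def)
  \<comment> \<open>Chosen so that \<open>exp (\<beta> * c) * p = 2\<close>: a rise by
    \<open>c\<close>, which has probability \<open>p\<close>, then outweighs in \<open>q\<close> the
    total loss of everything gained so far.\<close>
  define \<beta> where "\<beta> = ln (2 / p) / c"
  have \<beta>: "0 < \<beta>" "exp (\<beta> * c) * p = 2"
    using p c by (auto simp: \<beta>_def field_simps)
  define q where "q z = exp (\<beta> * z) - 1" for z
  have q_mono: "q z \<le> q z'" if "z \<le> z'" for z z'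
    using that \<beta> by (simp add: q_def)
  have q_nonneg: "0 \<le> q z" if "0 \<le> z" for z
    using q_mono[OF that] by (simp add: q_def)
  have q_step: "q z + 1 \<le> p * q (z + c)" if "0 \<le> z" for z
  proof -
    have "p * q (z + c) = exp (\<beta> * z) * (exp (\<beta> * c) * p) - p"
      by (simp add: q_def exp_add algebra_simps)
    also have "\<dots> = 2 * exp (\<beta> * z) - p" by (simp add: \<beta>)
    also have "\<dots> \<ge> q z + 1"
    proof -
      have "1 \<le> exp (\<beta> * z)" using that \<beta> by simp
      then show ?thesis unfolding q_def using p by linarith
    qed
    finally show ?thesis .
  qed
  have [measurable]: "q \<in> borel_measurable borel" by (simp add: q_def[abs_def])
  \<comment> \<open>An upper bound of \<open>q (s + c)\<close> over all \<open>s < a1\<close>; it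
    keeps the Lyapunov function and its majorant nonnegative below \<open>a1\<close>.\<close>
  define D where "D = q (a1 + c)"
  define \<kappa> where "\<kappa> = 1 - survive a1 a1"
  have \<kappa>: "0 < \<kappa>" using survive_less_1 by (simp add: \<kappa>_def)
  have D: "0 \<le> D" using q_nonneg a1 c by (simp add: D_def)
  \<comment> \<open>The solution of \<open>m * survive a1 a1 + D = m\<close>: the extra cost
    \<open>D\<close> of an excursion is exactly what the superharmonic part loses by the return to
    \<open>a1\<close>.\<close>
  define m where "m = D / \<kappa>"
  have m: "0 \<le> m" "m * survive a1 a1 + D = m"
    using \<kappa> D by (auto simp: m_def \<kappa>_def field_simps)
  show ?thesis
  \<comment> \<open>\<open>m\<close> is fixed before \<open>a\<close> and \<open>B\<close>, which
    makes the additive constant uniform in both.\<close>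
  proof (rule that[of m])
    fix a B s :: real
    assume a: "a1 < a" and B: "0 \<le> B" and I: "0 < (\<integral>x. min (l x) B \<partial>M1)" and s: "0 \<le> s" "s < a"
    define I where "I = (\<integral>x. min (l x) B \<partial>M1)"
    have I0: "0 < I" using I by (simp add: I_def)
    \<comment> \<open>The value of \<open>G\<close> at \<open>a1\<close>.\<close>
    define base where "base = (a + B - a1) / I + m * survive a1 a1"
    have base: "0 \<le> base" using a B I0 m survive_nonneg by (auto simp: base_def)
    define G where "G s = (if s < a1 then base + D - q s else (a + B - s) / I + m * survive a1 s)" for s
    \<comment> \<open>Negative states are never entered from nonnegative ones; the value
      \<open>\<infinity>\<close> makes the drift condition trivial there.\<close>
    define g where "g s = (if s < 0 then \<infinity> else ennreal (G s))" for s
    let ?next = "\<lambda>s. \<integral>\<^sup>+x. g (ac_step \<xi> a1 s x) * of_bool (ac_step \<xi> a1 s x \<notin> {a..}) \<partial>M1"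
    have [measurable]: "g \<in> borel_measurable borel"
      unfolding g_def[abs_def] G_def by measurable
    have high: "1 + ?next s \<le> g s"
      if s: "a1 \<le> s" "s < a" for s
    proof -
      \<comment> \<open>A majorant of \<open>G\<close> at the next state in which the increment is
        cut off at \<open>B\<close>. The summand \<open>B\<close> in the numerator keeps it
        nonnegative for \<open>s < a\<close>, and its mean is exactly
        \<open>G s - 1\<close>.\<close>
      define H where "H x = (a + B - s - min (l x) B) / I + m * min 1 (exp (a1 - (s + l x)))" for x
      have H_nonneg: "0 \<le> H x" for x
      proof -
        have "0 \<le> a + B - s - min (l x) B" using s by (auto simp: min_def)
        then show ?thesis using I0 m by (auto simp: H_def)
      qed
      have int1: "integrable M1 (\<lambda>x. (a + B - s - min (l x) B) / I)"
        by (intro integrable_divide Bochner_Integration.integrable_diff integrable_min_l N1.integrable_const_M)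
      have int2: "integrable M1 (\<lambda>x. m * min 1 (exp (a1 - (s + l x))))"
        by (intro integrable_mult_right integrable_survive)
      have intH: "integrable M1 H"
        unfolding H_def[abs_def] by (intro Bochner_Integration.integrable_add int1 int2)
      have "(\<integral>x. H x \<partial>M1) = (\<integral>x. (a + B - s - min (l x) B) / I \<partial>M1) + (\<integral>x. m * min 1 (exp (a1 - (s + l x))) \<partial>M1)"
        unfolding H_def[abs_def] by (rule Bochner_Integration.integral_add[OF int1 int2])
      also have "(\<integral>x. (a + B - s - min (l x) B) / I \<partial>M1) = (a + B - s - I) / I"
        by (simp add: I_def Bochner_Integration.integral_diff integrable_min_l N1.integrable_const_M
            N1.measure_M_UNIV)
      also have "(\<integral>x. m * min 1 (exp (a1 - (s + l x))) \<partial>M1) = m * survive a1 s"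
        by (simp add: survive_def)
      finally have "(\<integral>x. H x \<partial>M1) + 1 = G s"
        using I0 s by (simp add: G_def field_simps)
      have "?next s \<le> (\<integral>\<^sup>+x. ennreal (H x) \<partial>M1)"
      proof (rule nn_integral_mono)
        fix x
        let ?s' = "ac_step \<xi> a1 s x"
        have s': "?s' = max 0 (s + l x)" using s by (simp add: ac_step_high)
        have "G ?s' \<le> H x" if "?s' < a"
        proof (cases "?s' < a1")
          case True
          then have lx: "s + l x < a1" using s' by simp
          have "a + B - a1 \<le> a + B - s - min (l x) B" using lx by (auto simp: min_def)
          then have "(a + B - a1) / I \<le> (a + B - s - min (l x) B) / I"
            using I0 by (intro divide_right_mono) auto
          moreover have "min 1 (exp (a1 - (s + l x))) = 1" using lx by (simp add: min_def)
          moreover have "0 \<le> q ?s'" using s' by (intro q_nonneg) simp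
          ultimately show ?thesis
            using True m by (simp add: G_def H_def base_def)
        next
          case False
          then have eq: "?s' = s + l x" using s' a1 by (auto simp: max_def split: if_splits)
          have "(a + B - (s + l x)) / I \<le> (a + B - s - min (l x) B) / I"
            using I0 by (intro divide_right_mono) (auto simp: min_def)
          moreover have "m * survive a1 (s + l x) \<le> m * min 1 (exp (a1 - (s + l x)))"
            using m survive_le by (intro mult_left_mono) auto
          ultimately show ?thesis
            using False by (simp add: G_def H_def eq)
        qed
        then show "g ?s' * of_bool (?s' \<notin> {a..}) \<le> ennreal (H x)"
          using s' a a1 by (auto simp: g_def intro: ennreal_leI)
      qed
      also have "\<dots> = ennreal (\<integral>x. H x \<partial>M1)"
        using H_nonneg by (intro nn_integral_eq_integral intH) auto
      finally have "1 + ?next s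
         \<le> 1 + ennreal (\<integral>x. H x \<partial>M1)" by (rule add_left_mono)
      also have "\<dots> = ennreal (G s)"
        using H_nonneg by (subst \<open>(\<integral>x. H x \<partial>M1) + 1 = G s\<close>[symmetric], subst ennreal_plus) (auto simp: add.commute)
      finally show ?thesis using s a1 by (simp add: g_def)
    qed
    have low: "1 + ?next s \<le> g s"
      if s: "0 \<le> s" "s < a1" for s
    proof -
      \<comment> \<open>Below \<open>a1\<close> only steps with \<open>\<xi> x \<ge> c\<close> are
        credited, with the value \<open>q (s + c)\<close>; on all others \<open>q\<close> is bounded
        below by 0.\<close>
      define H where "H x = base + D - q (s + c) * indicat_real {x. c \<le> \<xi> x} x" for x
      have qD: "q (s + c) \<le> D" using s unfolding D_def by (intro q_mono) simp
      have H_nonneg: "0 \<le> H x" for x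
        using qD D base by (auto simp: H_def indicator_def)
      have sets: "{x. c \<le> \<xi> x} \<in> sets M1" by (simp add: N1.sets_M)
      have int1: "integrable M1 (\<lambda>x. q (s + c) * indicat_real {x. c \<le> \<xi> x} x)"
        using sets by (intro integrable_mult_right) (simp add: finite_measure.emeasure_finite[OF N1.finite_measure_M] less_top[symmetric])
      have intH: "integrable M1 H"
        unfolding H_def[abs_def] by (intro Bochner_Integration.integrable_diff int1 N1.integrable_const_M)
      have "(\<integral>x. H x \<partial>M1) = base + D - q (s + c) * p"
        unfolding H_def[abs_def] using sets
        by (subst Bochner_Integration.integral_diff[OF _ int1])
          (auto simp: N1.integrable_const_M p_def N1.measure_M_UNIV)
      then have H_int: "(\<integral>x. H x \<partial>M1) + 1 \<le> G s"
        using q_step[OF s(1)] s by (simp add: G_def mult.commute)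
      have "?next s \<le> (\<integral>\<^sup>+x. ennreal (H x) \<partial>M1)"
      proof (rule nn_integral_mono)
        fix x
        let ?s' = "ac_step \<xi> a1 s x"
        have "0 \<le> ?s'" using s a1 by (auto simp: ac_step_low)
        have "G ?s' \<le> H x"
        proof (cases "a1 \<le> max 0 (s + \<xi> x)")
          case True
          then have "?s' = a1" using s by (simp add: ac_step_low)
          then show ?thesis using qD D by (auto simp: G_def H_def base_def indicator_def)
        next
          case False
          then have eq: "?s' = max 0 (s + \<xi> x)" using s by (simp add: ac_step_low)
          have "0 \<le> q ?s'" using eq by (intro q_nonneg) simp
          moreover have "q (s + c) \<le> q ?s'" if "c \<le> \<xi> x"
            using eq that by (intro q_mono) simp
          ultimately show ?thesis
            using False eq by (auto simp: G_def H_def indicator_def)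
        qed
        then show "g ?s' * of_bool (?s' \<notin> {a..}) \<le> ennreal (H x)"
          using \<open>0 \<le> ?s'\<close> by (auto simp: g_def intro: ennreal_leI)
      qed
      also have "\<dots> = ennreal (\<integral>x. H x \<partial>M1)"
        using H_nonneg by (intro nn_integral_eq_integral intH) auto
      finally have "1 + ?next s
         \<le> 1 + ennreal (\<integral>x. H x \<partial>M1)" by (rule add_left_mono)
      also have "\<dots> = ennreal ((\<integral>x. H x \<partial>M1) + 1)"
        using H_nonneg by (subst ennreal_plus) (auto simp: add.commute)
      also have "\<dots> \<le> ennreal (G s)" using H_int by (rule ennreal_leI)
      finally show ?thesis using s by (simp add: g_def)
    qed
    have "(\<integral>\<^sup>+\<omega>. ennreal_of_enat (hit (ac_step \<xi> a1) {a..} s \<omega>) \<partial>S1) \<le> g s"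
    proof (rule N1.expected_hit_le)
      fix s assume "s \<notin> {a..}"
      then show "1 + ?next s \<le> g s"
        using high[of s] low[of s] by (cases "s < 0"; cases "s < a1") (auto simp: g_def)
    qed (use s in auto)
    also have "g s \<le> ennreal ((a + B) / I + m)"
    proof -
      have "G s \<le> (a + B) / I + m"
      proof (cases "s < a1")
        case True
        have "(a + B - a1) / I \<le> (a + B) / I" using I0 a1 by (intro divide_right_mono) auto
        then show ?thesis
          using True q_nonneg[OF s(1)] m(2) by (simp add: G_def base_def)
      next
        case False
        have "(a + B - s) / I \<le> (a + B) / I" using I0 s by (intro divide_right_mono) auto
        moreover have "m * survive a1 s \<le> m * 1"
          using m survive_le[of a1 s] by (intro mult_left_mono) auto
        ultimately show ?thesis using False by (simp add: G_def)
      qed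
      then show ?thesis using s by (auto simp: g_def intro: ennreal_leI)
    qed
    finally show "(\<integral>\<^sup>+\<omega>. ennreal_of_enat (hit (ac_step \<xi> a1) {a..} s \<omega>) \<partial>S1)
       \<le> ennreal ((a + B) / (\<integral>x. min (l x) B \<partial>M1) + m)"
      by (simp add: I_def)
  qed
qed

section \<open>Information of censored observations\<close>

definition cens :: "strategy \<Rightarrow> real \<Rightarrow> real" where
  "cens \<psi> x = of_bool (\<psi> x) * l x + (1 - of_bool (\<psi> x)) * ln (measure M1 {x. \<not> \<psi> x} / measure M0 {x. \<not> \<psi> x})"

lemma measurable_cens [measurable]:
  assumes [measurable]: "Measurable.pred borel \<psi>"
  shows "cens \<psi> \<in> borel_measurable borel"
  unfolding cens_def[abs_def] by measurable

lemma null_M0_of_null_M1: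
  assumes Q: "Q \<in> sets borel" and null: "measure M1 Q = 0"
  shows "measure M0 Q = 0"
proof -
  have "Q \<in> null_sets M1"
    using Q null by (simp add: null_sets_def N1.sets_M N1.emeasure_M)
  then have "AE x in M0. x \<notin> Q"
    unfolding M1_density by (subst (asm) null_sets_density_iff) (auto intro!: N0.borel_measurable_M)
  then have "Q \<in> null_sets M0"
    using Q by (subst AE_iff_null_sets) (auto simp: N0.sets_M)
  then show ?thesis by (auto simp: measure_def)
qed

lemma null_M1_of_null_M0:
  assumes Q: "Q \<in> sets borel" and null: "measure M0 Q = 0"
  shows "measure M1 Q = 0"
proof -
  have "Q \<in> null_sets M0"
    using Q null by (simp add: null_sets_def N0.sets_M N0.emeasure_M)
  then have "Q \<in> null_sets M1"
    unfolding M1_density using AE_not_in[of Q M0]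
    by (subst null_sets_density_iff) (auto intro!: N0.borel_measurable_M)
  then show ?thesis by (auto simp: measure_def)
qed

lemma integrable_cens:
  assumes [measurable]: "Measurable.pred borel \<psi>"
  shows "integrable M1 (cens \<psi>)"
proof (rule Bochner_Integration.integrable_bound)
  show "integrable M1 (\<lambda>x. \<bar>l x\<bar> + \<bar>ln (measure M1 {x. \<not> \<psi> x} / measure M0 {x. \<not> \<psi> x})\<bar>)"
    by (intro Bochner_Integration.integrable_add integrable_abs integrable_l1 N1.integrable_const_M)
  show "cens \<psi> \<in> borel_measurable M1"
    by (intro N1.borel_measurable_M) measurable
qed (auto simp: cens_def)

text \<open>\<open>exp (- cens \<psi> x)\<close> is the likelihood ratio of \<open>M0\<close> to
  \<open>M1\<close> for the censored observation: transmitted points contribute their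
  \<open>M0\<close> mass, and the constant on the censored set rescales its \<open>M1\<close> mass
  to its \<open>M0\<close> mass.\<close>

lemma nn_integral_exp_minus_cens:
  assumes [measurable]: "Measurable.pred borel \<psi>"
  shows "(\<integral>\<^sup>+x. ennreal (exp (- cens \<psi> x)) \<partial>M1) = 1"
proof -
  let ?m0 = "measure M0 {x. \<not> \<psi> x}" and ?m1 = "measure M1 {x. \<not> \<psi> x}"
  let ?r = "exp (- ln (?m1 / ?m0))"
  have sets [measurable]: "{x. \<psi> x} \<in> sets M0" "{x. \<not> \<psi> x} \<in> sets M0"
      "{x. \<psi> x} \<in> sets M1" "{x. \<not> \<psi> x} \<in> sets M1" "{x. \<not> \<psi> x} \<in> sets borel"
    by (auto simp: N0.sets_M N1.sets_M)
  have "(\<integral>\<^sup>+x. ennreal (exp (- cens \<psi> x)) \<partial>M1)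
      = (\<integral>\<^sup>+x. of_bool (\<psi> x) * ennreal (exp (- l x)) + ennreal ?r * of_bool (\<not> \<psi> x) \<partial>M1)"
    by (intro nn_integral_cong) (auto simp: cens_def)
  also have "\<dots> = (\<integral>\<^sup>+x. of_bool (\<psi> x) * ennreal (exp (- l x)) \<partial>M1) + (\<integral>\<^sup>+x. ennreal ?r * of_bool (\<not> \<psi> x) \<partial>M1)"
    by (intro nn_integral_add N1.borel_measurable_M) measurable
  also have "(\<integral>\<^sup>+x. of_bool (\<psi> x) * ennreal (exp (- l x)) \<partial>M1) = (\<integral>\<^sup>+x. of_bool (\<psi> x) \<partial>M0)"
    by (subst nn_integral_M1) (auto simp: mult.assoc ennreal_mult[symmetric] exp_add[symmetric])
  also have "\<dots> = emeasure M0 {x. \<psi> x}"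
    by (subst nn_integral_of_bool) (auto simp: pred_def N0.sets_M)
  also have "(\<integral>\<^sup>+x. ennreal ?r * of_bool (\<not> \<psi> x) \<partial>M1) = ennreal ?r * emeasure M1 {x. \<not> \<psi> x}"
    by (subst nn_integral_cmult) (auto simp: nn_integral_of_bool pred_def N1.sets_M intro!: N1.borel_measurable_M)
  also have "emeasure M1 {x. \<not> \<psi> x} = ennreal ?m1"
    by (rule N1.emeasure_M)
  also have "ennreal ?r * ennreal ?m1 = ennreal ?m0"
  \<comment> \<open>If the censored set is null, it is so under both laws and the conventional value
    of the logarithm has no effect.\<close>
  proof (cases "?m0 = 0")
    case True
    then show ?thesis using null_M1_of_null_M0[of "{x. \<not> \<psi> x}"] by simp
  next
    case False
    moreover from this have "?m1 \<noteq> 0" using null_M0_of_null_M1[of "{x. \<not> \<psi> x}"] by auto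
    ultimately have "0 < ?m0" "0 < ?m1" by (simp_all add: zero_less_measure_iff)
    then show ?thesis by (simp add: exp_minus ennreal_mult[symmetric])
  qed
  also have "ennreal ?m0 = emeasure M0 {x. \<not> \<psi> x}"
    by (rule N0.emeasure_M[symmetric])
  also have "emeasure M0 {x. \<psi> x} + emeasure M0 {x. \<not> \<psi> x} = emeasure M0 ({x. \<psi> x} \<union> {x. \<not> \<psi> x})"
    by (rule plus_emeasure) auto
  also have "{x. \<psi> x} \<union> {x. \<not> \<psi> x} = space M0" by auto
  finally show ?thesis using prob_space.emeasure_space_1[OF N0.prob_space_M] by simp
qed

text \<open>Gibbs' inequality, strict because \<open>1 - y < exp (- y)\<close> for \<open>y \<noteq> 0\<close>.\<close>
lemma mean_cens_pos:
  assumes \<psi> [measurable]: "Measurable.pred borel \<psi>" and pos: "0 < measure M1 {x. \<psi> x \<and> l x \<noteq> 0}"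
  shows "0 < (\<integral>x. cens \<psi> x \<partial>M1)"
proof -
  let ?h = "\<lambda>x. exp (- cens \<psi> x) - (1 - cens \<psi> x)"
  have intE: "integrable M1 (\<lambda>x. exp (- cens \<psi> x))"
    using nn_integral_exp_minus_cens[OF \<psi>] by (intro integrableI_nonneg) (auto intro!: N1.borel_measurable_M)
  have E: "(\<integral>x. exp (- cens \<psi> x) \<partial>M1) = 1"
    using nn_integral_exp_minus_cens[OF \<psi>] by (subst integral_eq_nn_integral) (auto intro!: N1.borel_measurable_M)
  have int1: "integrable M1 (\<lambda>x. 1 - cens \<psi> x)"
    by (intro Bochner_Integration.integrable_diff integrable_cens \<psi> N1.integrable_const_M)
  have inth: "integrable M1 ?h"
    by (intro Bochner_Integration.integrable_diff intE int1)
  have h_nonneg: "0 \<le> ?h x" for x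
    using exp_ge_add_one_self[of "- cens \<psi> x"] by simp
  have "(\<integral>x. ?h x \<partial>M1) = (\<integral>x. cens \<psi> x \<partial>M1)"
    using integrable_cens[OF \<psi>] N1.integrable_const_M
    by (subst Bochner_Integration.integral_diff[OF intE int1], subst Bochner_Integration.integral_diff)
      (auto simp: E N1.measure_M_UNIV)
  moreover have "(\<integral>x. ?h x \<partial>M1) \<noteq> 0"
  proof
    assume "(\<integral>x. ?h x \<partial>M1) = 0"
    then have "AE x in M1. ?h x = 0"
      using inth h_nonneg by (subst (asm) integral_nonneg_eq_0_iff_AE) auto
    then have "AE x in M1. \<not> (\<psi> x \<and> l x \<noteq> 0)"
    proof eventually_elim
      case (elim x)
      then have "cens \<psi> x = 0" using exp_minus_greater[of "cens \<psi> x"] by auto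
      then show ?case by (auto simp: cens_def)
    qed
    then have "emeasure M1 {x\<in>space M1. \<not> \<not> (\<psi> x \<and> l x \<noteq> 0)} = 0"
      by (subst (asm) AE_iff_measurable[OF _ refl]) (auto simp: N1.sets_M)
    then show False using pos by (simp add: measure_def)
  qed
  moreover have "0 \<le> (\<integral>x. ?h x \<partial>M1)"
    using h_nonneg by (intro integral_nonneg_AE) auto
  ultimately show ?thesis by simp
qed

lemma pos_measure_l_nonzero: "0 < measure M0 {x. l x \<noteq> 0}"
proof (rule ccontr)
  assume "\<not> 0 < measure M0 {x. l x \<noteq> 0}"
  then have "emeasure M0 {x\<in>space M0. l x \<noteq> 0} = 0"
    by (simp add: N0.emeasure_M zero_less_measure_iff)
  then have "AE x in M0. l x = 0"
    by (subst (asm) AE_iff_measurable[symmetric, where P = "\<lambda>x. l x = 0"]) (auto simp: N0.sets_M)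
  then have "(\<integral>x. l x \<partial>M0) = (\<integral>x. 0 \<partial>M0)"
    by (intro integral_cong_AE) (auto intro!: N0.borel_measurable_M)
  then show False using mean0 by simp
qed

end

text \<open>Intermediate value theorem for the mass of \<open>A\<close> together with the part of
  \<open>B - A\<close> up to \<open>t\<close>, as a function of \<open>t\<close>; atomlessness makes
  it continuous.\<close>

lemma (in iid) exists_intermediate_measure:
  assumes atomless: "\<And>x. emeasure M {x} = 0"
    and AB: "A \<in> sets borel" "B \<in> sets borel" "A \<subseteq> B" and e: "measure M A \<le> e" "e \<le> measure M B"
  shows "\<exists>E\<in>sets borel. A \<subseteq> E \<and> E \<subseteq> B \<and> measure M E = e"
proof (cases "e = measure M A \<or> e = measure M B")
  case False
  have fin: "finite_measure M" by (rule finite_measure_M)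
  define D where "D = B - A"
  have D: "D \<in> sets M" using AB by (simp add: D_def sets_M)
  define N where "N = density M (indicator D)"
  have N: "emeasure N Q = emeasure M (D \<inter> Q)" if "Q \<in> sets borel" for Q
    unfolding N_def using D that by (intro emeasure_restricted) (simp_all add: sets_M)
  have mN: "measure N Q = measure M (D \<inter> Q)" if "Q \<in> sets borel" for Q
    using N[OF that] by (simp add: measure_def)
  interpret N: finite_borel_measure N
  proof (intro finite_borel_measure.intro finite_measureI finite_borel_measure_axioms.intro)
    show "emeasure N (space N) \<noteq> \<infinity>"
      using N[of UNIV] finite_measure.emeasure_finite[OF fin, of D] by (simp add: N_def)
    show "sets N = sets borel" by (simp add: N_def sets_M)
  qed
  have sp: "measure N (space N) = measure M B - measure M A"
    using mN[of UNIV] AB finite_measure.finite_measure_Diff[OF fin, of B A] by (simp add: N_def D_def sets_M)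
  have cont: "isCont (cdf N) x" for x
  proof -
    have "emeasure N {x} \<le> emeasure M {x}"
      unfolding N[of "{x}", simplified] by (intro emeasure_mono) (auto simp: sets_M)
    then show ?thesis using atomless[of x] by (simp add: N.isCont_cdf measure_def)
  qed
  have e': "0 < e - measure M A" "e - measure M A < measure N (space N)"
    using False e unfolding sp by auto
  obtain u where u: "cdf N u < e - measure M A"
    using order_tendstoD(2)[OF N.cdf_lim_at_bot e'(1)] by (auto simp: eventually_at_bot_linorder)
  obtain v where v: "e - measure M A < cdf N v"
    using order_tendstoD(1)[OF N.cdf_lim_at_top e'(2)] by (auto simp: eventually_at_top_linorder)
  have "u \<le> v"
    using N.cdf_nondecreasing[of v u] u v by (cases "u \<le> v") auto
  then obtain t where t: "cdf N t = e - measure M A"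
    using IVT[of "cdf N" u "e - measure M A" v] u v cont by auto
  have "measure M (A \<union> (D \<inter> {..t})) = measure M A + measure M (D \<inter> {..t})"
    using AB D by (intro finite_measure.finite_measure_Union[OF fin]) (auto simp: sets_M D_def)
  also have "\<dots> = e"
    using t mN[of "{..t}"] by (simp add: cdf_def)
  finally show ?thesis
    using AB by (intro bexI[of _ "A \<union> (D \<inter> {..t})"]) (auto simp: D_def)
qed (use AB in blast)

section \<open>The change-point model\<close>

locale change_model =
  fixes f0 f1 :: "real \<Rightarrow> real"
  assumes d0: "prob_density f0" and d1: "prob_density f1"
    and KL1: "0 < KL f1 f0" "KL f1 f0 < \<infinity>"
    and KL0: "0 < KL f0 f1" "KL f0 f1 < \<infinity>"
begin

abbreviation "F0 \<equiv> density lborel (\<lambda>x. ennreal (f0 x))"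
abbreviation "F1 \<equiv> density lborel (\<lambda>x. ennreal (f1 x))"

lemma measurable_f [measurable]: "f0 \<in> borel_measurable borel" "f1 \<in> borel_measurable borel"
  using d0 d1 by (auto simp: prob_density_def)

lemma f_nonneg: "0 \<le> f0 x" "0 \<le> f1 x"
  using d0 d1 by (auto simp: prob_density_def)

lemma measurable_llr [measurable]: "llr f0 f1 \<in> borel_measurable borel"
  unfolding llr_def[abs_def] by measurable

lemma AE_abs_cont: "AE x in lborel. f0 x = 0 \<longleftrightarrow> f1 x = 0"
proof -
  have "AE x in lborel. f0 x = 0 \<longrightarrow> f1 x = 0" "AE x in lborel. f1 x = 0 \<longrightarrow> f0 x = 0"
    using KL1 KL0 by (auto simp: KL_def split: if_splits)
  then show ?thesis by eventually_elim auto
qed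

lemma integrable_f1_llr: "integrable lborel (\<lambda>x. f1 x * llr f0 f1 x)"
  using KL1 by (auto simp: KL_def llr_def split: if_splits)

lemma f0_llr: "f0 x * llr f0 f1 x = - (f0 x * ln (f0 x / f1 x))"
  using ln_inverse[of "f0 x / f1 x"] by (simp add: llr_def inverse_divide)

lemma integrable_f0_llr: "integrable lborel (\<lambda>x. f0 x * llr f0 f1 x)"
  using KL0 unfolding f0_llr by (auto simp: KL_def split: if_splits)

lemma mean_llr1: "(\<integral>x. llr f0 f1 x \<partial>F1) = real_of_ereal (KL f1 f0)"
proof -
  have "(\<integral>x. llr f0 f1 x \<partial>F1) = (\<integral>x. f1 x * llr f0 f1 x \<partial>lborel)"
    using f_nonneg by (subst integral_density) auto
  then show ?thesis using KL1 by (auto simp: KL_def llr_def split: if_splits)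
qed

lemma mean_llr0: "(\<integral>x. llr f0 f1 x \<partial>F0) = - real_of_ereal (KL f0 f1)"
proof -
  have "(\<integral>x. llr f0 f1 x \<partial>F0) = (\<integral>x. f0 x * llr f0 f1 x \<partial>lborel)"
    using f_nonneg by (subst integral_density) auto
  then show ?thesis using KL0 unfolding f0_llr by (auto simp: KL_def split: if_splits)
qed

lemma iid_F: "iid F0" "iid F1"
  using d0 d1 by (auto simp: prob_density_def emeasure_density iid_def iid_axioms_def intro!: prob_spaceI)

text \<open>Almost everywhere \<open>f1\<close> vanishes where \<open>f0\<close> does, so the
  conventional value of \<open>llr\<close> at such points carries no mass.\<close>

lemma F1_density: "F1 = density F0 (\<lambda>x. ennreal (exp (llr f0 f1 x)))"
proof -
  have "density F0 (\<lambda>x. ennreal (exp (llr f0 f1 x))) = density lborel (\<lambda>x. ennreal (f0 x) * ennreal (exp (llr f0 f1 x)))"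
    by (rule density_density_eq) auto
  also have "\<dots> = F1"
  proof (rule density_cong)
    show "AE x in lborel. ennreal (f0 x) * ennreal (exp (llr f0 f1 x)) = ennreal (f1 x)"
      using AE_abs_cont
    proof eventually_elim
      case (elim x)
      show ?case
      proof (cases "f0 x = 0")
        case False
        then have "0 < f0 x" "0 < f1 x" using f_nonneg[of x] elim by auto
        then show ?thesis by (simp add: llr_def ennreal_mult[symmetric])
      qed (use elim in auto)
    qed
  qed auto
  finally show ?thesis ..
qed

sublocale LR: likelihood_ratio F0 F1 "llr f0 f1"
proof (rule likelihood_ratio.intro)
  show "integrable F0 (llr f0 f1)"
    using f_nonneg integrable_f0_llr by (subst integrable_density) auto
  show "integrable F1 (llr f0 f1)"
    using f_nonneg integrable_f1_llr by (subst integrable_density) auto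
  show "(\<integral>x. llr f0 f1 x \<partial>F0) < 0"
    unfolding mean_llr0 using KL0 by (cases "KL f0 f1") auto
  show "0 < (\<integral>x. llr f0 f1 x \<partial>F1)"
    unfolding mean_llr1 using KL1 by (cases "KL f1 f0") auto
qed (rule iid_F F1_density measurable_llr)+

abbreviation "I1 \<equiv> real_of_ereal (KL f1 f0)"

lemma I1_pos: "0 < I1"
  using LR.mean1 by (simp add: mean_llr1)

lemma P_infinity: "P f0 f1 \<infinity> = LR.S0"
  unfolding P_def by simp

lemma P_1: "P f0 f1 1 = LR.S1"
  unfolding P_def by (simp add: one_enat_def)

lemma sets_P: "sets (P f0 f1 \<nu>) = sets LR.S0"
  unfolding P_def by (intro sets_PiM_cong) auto

lemma space_P [simp]: "space (P f0 f1 \<nu>) = UNIV"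
  by (simp add: P_def space_PiM)

lemma prob_space_P: "prob_space (P f0 f1 \<nu>)"
  by (rule observations(1)[OF d0 d1])

lemma P_enat:
  assumes "1 \<le> \<nu>"
  shows "P f0 f1 (enat \<nu>) = distr (LR.S0 \<Otimes>\<^sub>M LR.S1) LR.S0 (\<lambda>(\<omega>, \<omega>'). comb_seq (\<nu> - 1) \<omega> \<omega>')"
proof -
  have "P f0 f1 (enat \<nu>) = PiM UNIV (\<lambda>i. if i < \<nu> - 1 then F0 else F1)"
    unfolding P_def using assms by (intro PiM_cong) (auto simp: less_diff_conv)
  then show ?thesis
    using PiM_comb_seq_two[OF LR.N0.prob_space_M LR.N1.prob_space_M] by simp
qed

lemma nn_integral_P_enat:
  assumes [measurable]: "h \<in> borel_measurable LR.S0" and \<nu>: "1 \<le> \<nu>"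
  shows "(\<integral>\<^sup>+\<omega>. h \<omega> \<partial>P f0 f1 (enat \<nu>)) = (\<integral>\<^sup>+\<omega>. (\<integral>\<^sup>+\<omega>'. h (comb_seq (\<nu> - 1) \<omega> \<omega>') \<partial>LR.S1) \<partial>LR.S0)"
proof -
  have m [measurable]: "(\<lambda>(\<omega>, \<omega>'). comb_seq (\<nu> - 1) \<omega> \<omega>') \<in> LR.S0 \<Otimes>\<^sub>M LR.S1 \<rightarrow>\<^sub>M LR.S0"
    using measurable_comb_seq[of "\<nu> - 1" F0]
    by (simp add: measurable_cong_sets[OF sets_pair_measure_cong[OF refl LR.sets_S1_S0] refl])
  have "(\<integral>\<^sup>+\<omega>. h \<omega> \<partial>P f0 f1 (enat \<nu>)) = (\<integral>\<^sup>+z. h (case z of (\<omega>, \<omega>') \<Rightarrow> comb_seq (\<nu> - 1) \<omega> \<omega>') \<partial>(LR.S0 \<Otimes>\<^sub>M LR.S1))"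
    unfolding P_enat[OF \<nu>] by (rule nn_integral_distr) measurable
  also have "\<dots> = (\<integral>\<^sup>+\<omega>. (\<integral>\<^sup>+\<omega>'. h (comb_seq (\<nu> - 1) \<omega> \<omega>') \<partial>LR.S1) \<partial>LR.S0)"
    by (subst sigma_finite_measure.nn_integral_fst[OF prob_space_imp_sigma_finite[OF LR.N1.prob_space_S], symmetric]) auto
  finally show ?thesis .
qed

lemma prob_first_observation:
  assumes [measurable]: "Measurable.pred borel Q"
  shows "\<P>(\<omega> in P f0 f1 1. Q (X 1 \<omega>)) = measure F1 {x. Q x}"
    and "\<P>(\<omega> in P f0 f1 \<infinity>. Q (X 1 \<omega>)) = measure F0 {x. Q x}"
proof -
  have "measure LR.S1 ((\<lambda>\<omega>. \<omega> 0) -` {x. Q x} \<inter> space LR.S1) = measure (distr LR.S1 F1 (\<lambda>\<omega>. \<omega> 0)) {x. Q x}"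
    by (rule measure_distr[symmetric]) (auto simp: LR.N1.sets_M)
  then show "\<P>(\<omega> in P f0 f1 1. Q (X 1 \<omega>)) = measure F1 {x. Q x}"
    unfolding LR.N1.distr_component by (simp add: P_1 X_def vimage_def)
  have "measure LR.S0 ((\<lambda>\<omega>. \<omega> 0) -` {x. Q x} \<inter> space LR.S0) = measure (distr LR.S0 F0 (\<lambda>\<omega>. \<omega> 0)) {x. Q x}"
    by (rule measure_distr[symmetric]) (auto simp: LR.N0.sets_M)
  then show "\<P>(\<omega> in P f0 f1 \<infinity>. Q (X 1 \<omega>)) = measure F0 {x. Q x}"
    unfolding LR.N0.distr_component by (simp add: P_infinity X_def vimage_def)
qed

lemma censored_llr_True: "censored_llr f0 f1 \<psi> True x = llr f0 f1 x"
  by (simp add: censored_llr_def llr_def)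

lemma censored_llr_eq_cens:
  assumes [measurable]: "Measurable.pred borel \<psi>"
  shows "censored_llr f0 f1 \<psi> (\<psi> x) x = LR.cens \<psi> x"
  using prob_first_observation[of "\<lambda>x. \<not> \<psi> x"] by (simp add: censored_llr_def LR.cens_def llr_def)

lemma censored_KL_eq:
  assumes [measurable]: "Measurable.pred borel \<psi>"
  shows "censored_KL f0 f1 \<psi> = (\<integral>x. LR.cens \<psi> x \<partial>F1)"
  unfolding censored_KL_def P_1 X_def censored_llr_eq_cens[OF assms]
  by (rule LR.N1.integral_component) measurable

text \<open>The optimum is compared with a strategy of the same rate that transmits with positive
  probability where \<open>llr\<close> is nonzero. Such a strategy has positive information by the
  strict Gibbs inequality, so the optimum has too. This lets the statistic climb to
  \<open>a1\<close> after the change.\<close>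

lemma optimal_strategy_informative:
  assumes opt: "optimal_strategy f0 f1 e \<psi>" and e: "0 < e" "e \<le> 1"
  shows "0 < measure F1 {x. 0 < LR.cens \<psi> x}"
proof -
  have \<psi> [measurable]: "Measurable.pred borel \<psi>"
    using opt by (auto simp: optimal_strategy_def strategies_of_rate_def)
  define N where "N = {x. llr f0 f1 x \<noteq> 0}"
  have N: "N \<in> sets borel" by (simp add: N_def)
  have atomless: "emeasure F0 {x} = 0" for x
  proof -
    have "{x} \<in> null_sets F0"
    proof -
      have f0: "(\<lambda>x. ennreal (f0 x)) \<in> borel_measurable lborel" by auto
      have "AE y in lborel. y \<in> {x} \<longrightarrow> ennreal (f0 y) = 0"
        using AE_lborel_singleton[of x] by eventually_elim auto
      then show ?thesis unfolding null_sets_density_iff[OF f0] by simp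
    qed
    then show ?thesis by auto
  qed
  have UNIV1: "measure F0 UNIV = 1"
    using prob_space.prob_space[OF LR.N0.prob_space_M] by simp
  have "\<exists>E\<in>sets borel. measure F0 E = e \<and> 0 < measure F0 (E \<inter> N)"
  \<comment> \<open>A set of rate \<open>e\<close> is cut out of \<open>N\<close> if
    \<open>N\<close> is large enough, and otherwise obtained by enlarging \<open>N\<close>.\<close>
  proof (cases "e \<le> measure F0 N")
    case True
    obtain E where "E \<in> sets borel" "E \<subseteq> N" "measure F0 E = e"
      using LR.N0.exists_intermediate_measure[OF atomless, of "{}" N e] N e True by auto
    then show ?thesis using e by (intro bexI[of _ E]) (auto simp: Int_absorb2)
  next
    case False
    obtain E where "E \<in> sets borel" "N \<subseteq> E" "measure F0 E = e"
      using LR.N0.exists_intermediate_measure[OF atomless, of N UNIV e] N e False UNIV1 by auto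
    then show ?thesis using LR.pos_measure_l_nonzero
      by (intro bexI[of _ E]) (auto simp: Int_absorb1 N_def)
  qed
  then obtain E where E: "E \<in> sets borel" "measure F0 E = e" "0 < measure F0 (E \<inter> N)" by blast
  have predE [measurable]: "Measurable.pred borel (\<lambda>x. x \<in> E)" using E by simp
  have "measure F1 (E \<inter> N) \<noteq> 0"
    using LR.null_M0_of_null_M1[of "E \<inter> N"] E N by auto
  then have "0 < measure F1 {x. x \<in> E \<and> llr f0 f1 x \<noteq> 0}"
    by (simp add: N_def zero_less_measure_iff Int_def)
  then have "0 < censored_KL f0 f1 (\<lambda>x. x \<in> E)"
    unfolding censored_KL_eq[OF predE] by (rule LR.mean_cens_pos[OF predE])
  also have "\<dots> \<le> censored_KL f0 f1 \<psi>"
    using opt E prob_first_observation(2)[OF predE]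
    by (auto simp: optimal_strategy_def strategies_of_rate_def)
  finally have "0 < (\<integral>x. LR.cens \<psi> x \<partial>F1)"
    by (simp add: censored_KL_eq)
  then show ?thesis
    by (intro LR.pos_of_mean_pos LR.integrable_cens) measurable
qed

lemma cusum_eq_run: "cusum f0 f1 k \<omega> = run (\<lambda>s x. max 0 (s + llr f0 f1 x)) 0 k \<omega>"
  by (induction k) (auto simp: X_def)

lemma arl_cusum_ge:
  assumes "0 < a1"
  shows "ennreal (exp a1) \<le> arl f0 f1 (cusum_time f0 f1 a1)"
  using LR.expected_cusum_time_ge[OF assms]
  by (simp add: arl_def P_infinity cusum_time_def cusum_eq_run hit_def)

lemma sum_llr_eq_walk: "(\<Sum>k=1..n. llr f0 f1 (X k \<omega>)) = LR.walk n \<omega>"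
  unfolding LR.walk_eq_sum by (simp add: X_def sum.atLeast1_atMost_eq lessThan_Suc_atMost)

lemma exit_time_eq: "exit_time f0 f1 a1 a \<omega> = LR.exit_walk (a - a1) \<omega>"
  by (simp add: exit_time_def hit_def sum_llr_eq_walk[unfolded One_nat_def])

lemma exit_stat_eq:
  "exit_time f0 f1 a1 a \<omega> = enat n \<Longrightarrow> exit_stat f0 f1 a1 a \<omega> = max 0 (a1 + LR.walk n \<omega>)"
  by (simp add: exit_stat_def sum_llr_eq_walk[unfolded One_nat_def])

lemma exit_below_iff:
  assumes "0 < a1"
  shows "exit_time f0 f1 a1 a \<omega> < \<infinity> \<and> exit_stat f0 f1 a1 a \<omega> < a1 \<longleftrightarrow> (\<exists>n. LR.down (a - a1) n \<omega>)"
proof (cases "exit_time f0 f1 a1 a \<omega>")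
  case (enat n)
  then show ?thesis
    using assms by (auto simp: exit_stat_eq[OF enat] LR.down_def exit_time_eq[symmetric])
next
  case infinity
  then show ?thesis by (simp add: LR.down_def exit_time_eq[symmetric])
qed

lemma return_time_eq:
  assumes "Measurable.pred borel \<psi>"
  shows "return_time f0 f1 \<psi> a1 z \<omega> = hit (LR.low_step (LR.cens \<psi>)) {a1..} z \<omega>"
proof -
  have "low_stat f0 f1 \<psi> z k \<omega> = run (LR.low_step (LR.cens \<psi>)) z k \<omega>" for k
    by (induction k) (auto simp: X_def censored_llr_eq_cens[OF assms])
  then show ?thesis by (simp add: return_time_def hit_def)
qed

end

section \<open>The CuSum-AC statistic and its run length in the change-point model\<close>

locale ac_model = change_model +
  fixes \<psi>s :: "real \<Rightarrow> strategy" and \<epsilon> a1 \<epsilon>1 :: real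
  assumes opt: "\<And>e. 0 < e \<Longrightarrow> e \<le> 1 \<Longrightarrow> optimal_strategy f0 f1 e (\<psi>s e)"
    and \<psi>s_1: "\<psi>s 1 = (\<lambda>_. True)"
    and \<epsilon>: "0 < \<epsilon>" "\<epsilon> \<le> 1" and a1: "0 < a1"
    and E_star: "\<epsilon>1 \<in> E_star f0 f1 \<psi>s a1 \<epsilon>"
begin

abbreviation "\<xi> \<equiv> LR.cens (\<psi>s \<epsilon>1)"
abbreviation "stat \<equiv> run (LR.ac_step \<xi> a1) 0"
abbreviation "Tc a \<equiv> ac_time f0 f1 \<psi>s a1 \<epsilon>1 (ereal a)"
abbreviation "pol \<equiv> ac_policy f0 f1 \<psi>s a1 \<epsilon>1"

lemma \<epsilon>1: "0 < \<epsilon>1" "\<epsilon>1 \<le> 1"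
  using E_star by (auto simp: E_star_def E_comm_def)

lemma measurable_\<psi>s [measurable]: "Measurable.pred borel (\<psi>s \<epsilon>1)"
  using opt[OF \<epsilon>1] by (simp add: optimal_strategy_def strategies_of_rate_def)

lemma measurable_\<xi> [measurable]: "\<xi> \<in> borel_measurable borel"
  by measurable

lemma ac_stat_eq: "ac_stat f0 f1 \<psi>s a1 \<epsilon>1 k \<omega> = stat k \<omega>"
proof (induction k)
  case (Suc k)
  show ?case
  proof (cases "stat k \<omega> < a1")
    case True
    then show ?thesis
      by (simp add: Suc Let_def ac_strategy_def X_def censored_llr_eq_cens LR.ac_step_low)
  next
    case False
    then have "ac_strategy \<psi>s a1 \<epsilon>1 (stat k \<omega>) = (\<lambda>_. True)"
      by (simp add: ac_strategy_def \<psi>s_1)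
    then show ?thesis
      using False by (simp add: Suc Let_def X_def LR.ac_step_high censored_llr_True)
  qed
qed simp

lemma ac_time_eq: "Tc a \<omega> = hit (LR.ac_step \<xi> a1) {a..} 0 \<omega>"
  by (simp add: ac_time_def hit_def ac_stat_eq)

text \<open>The condition of \<open>E_arl\<close>, multiplied out, at level \<open>a1 + b\<close> in
  place of the alarm level; it is available for every \<open>b > 0\<close> because
  \<open>E_arl\<close> quantifies over all levels above \<open>a1\<close>.\<close>

lemma return_hypothesis:
  assumes b: "0 < b"
  shows "arl f0 f1 (cusum_time f0 f1 a1) * emeasure LR.S0 {\<omega>. \<exists>n. LR.down b n \<omega>}
       \<le> (\<Sum>n. \<integral>\<^sup>+\<omega>. of_bool (LR.down b n \<omega>) *
           (\<integral>\<^sup>+\<omega>'. ennreal_of_enat (hit (LR.low_step \<xi>) {a1..} (max 0 (a1 + LR.walk n \<omega>)) \<omega>') \<partial>LR.S0) \<partial>LR.S0)"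
    and "0 < emeasure LR.S0 {\<omega>. \<exists>n. LR.down b n \<omega>}"
proof -
  let ?low = "\<lambda>n \<omega>. hit (LR.low_step \<xi>) {a1..} (max 0 (a1 + LR.walk n \<omega>))"
  let ?t = "arl f0 f1 (cusum_time f0 f1 a1)"
  let ?A = "{\<omega>. \<exists>n. LR.down b n \<omega>}"
  let ?R = "\<lambda>\<omega>. ennreal_of_enat (return_time f0 f1 (\<psi>s \<epsilon>1) a1 (exit_stat f0 f1 a1 (a1 + b) \<omega>)
      (shift (the_enat (exit_time f0 f1 a1 (a1 + b) \<omega>)) \<omega>))"
  have A: "{\<omega>. exit_time f0 f1 a1 (a1 + b) \<omega> < \<infinity> \<and> exit_stat f0 f1 a1 (a1 + b) \<omega> < a1} = ?A"
    using exit_below_iff[OF a1, of "a1 + b"] by simp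
  have num: "(\<integral>\<^sup>+\<omega>\<in>?A. ?R \<omega> \<partial>LR.S0) = (\<Sum>n. \<integral>\<^sup>+\<omega>. of_bool (LR.down b n \<omega>) *
           (\<integral>\<^sup>+\<omega>'. ennreal_of_enat (?low n \<omega> \<omega>') \<partial>LR.S0) \<partial>LR.S0)"
  proof (subst LR.first_passage_after_down)
    show "(\<integral>\<^sup>+\<omega>\<in>?A. ?R \<omega> \<partial>LR.S0) = (\<integral>\<^sup>+\<omega>. (\<Sum>n. of_bool (LR.down b n \<omega>) *
        ennreal_of_enat (?low n \<omega> (shift n \<omega>))) \<partial>LR.S0)"
    proof (intro nn_integral_cong)
      fix \<omega>
      show "?R \<omega> * indicator ?A \<omega> = (\<Sum>n. of_bool (LR.down b n \<omega>) *
        ennreal_of_enat (?low n \<omega> (shift n \<omega>)))"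
      proof (cases "\<exists>n. LR.down b n \<omega>")
        case True
        then obtain n where n: "LR.down b n \<omega>" by blast
        then have ex: "exit_time f0 f1 a1 (a1 + b) \<omega> = enat n"
          by (simp add: LR.down_def exit_time_eq)
        have "m = n" if "LR.down b m \<omega>" for m using that n by (auto simp: LR.down_def)
        then have "(\<Sum>n. of_bool (LR.down b n \<omega>) *
          ennreal_of_enat (?low n \<omega> (shift n \<omega>)))
          = of_bool (LR.down b n \<omega>) * ennreal_of_enat (?low n \<omega> (shift n \<omega>))"
          by (rule suminf_of_bool_unique)
        also have "\<dots> = ?R \<omega> * indicator ?A \<omega>"
          using n by (auto simp: ex exit_stat_eq[OF ex] return_time_eq indicator_def)
        finally show ?thesis ..
      qed auto
    qed
  qed measurable
  have le: "?t \<le> (\<integral>\<^sup>+\<omega>\<in>?A. ?R \<omega> \<partial>LR.S0) / emeasure LR.S0 ?A"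
  proof -
    have "\<epsilon>1 \<in> E_arl f0 f1 \<psi>s a1" "a1 < a1 + b"
      using E_star b by (simp_all add: E_star_def)
    then have "?t \<le> cond_expect (P f0 f1 \<infinity>) ?R
        {\<omega>. exit_time f0 f1 a1 (a1 + b) \<omega> < \<infinity> \<and> exit_stat f0 f1 a1 (a1 + b) \<omega> < a1}"
      unfolding E_arl_def by blast
    then show ?thesis unfolding A P_infinity cond_expect_def .
  qed
  have t: "0 < ?t"
    using arl_cusum_ge[OF a1] by (rule less_le_trans[rotated]) simp
  \<comment> \<open>On a null event \<open>cond_expect\<close> is \<open>0 / 0 = 0\<close>, whereas
    \<open>E_arl\<close> bounds it below by the positive CuSum run length; membership in
    \<open>E_arl\<close> thus forces positive probability.\<close>
  show pos: "0 < emeasure LR.S0 ?A"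
  proof (rule ccontr)
    assume "\<not> 0 < emeasure LR.S0 ?A"
    then have zero: "emeasure LR.S0 ?A = 0" by simp
    have "(\<integral>\<^sup>+\<omega>\<in>?A. ?R \<omega> \<partial>LR.S0) = 0"
    proof -
      have "?A \<in> null_sets LR.S0"
      proof -
        have "{\<omega>\<in>space LR.S0. \<exists>n. LR.down b n \<omega>} \<in> sets LR.S0" by measurable
        then show ?thesis using zero by auto
      qed
      then show ?thesis by (rule nn_integral_null_set)
    qed
    then show False using le t zero by simp
  qed
  have fin: "emeasure LR.S0 ?A \<noteq> \<infinity>"
    by (simp add: LR.N0.P.emeasure_eq_measure)
  have "?t * emeasure LR.S0 ?A \<le> (\<integral>\<^sup>+\<omega>\<in>?A. ?R \<omega> \<partial>LR.S0) / emeasure LR.S0 ?A * emeasure LR.S0 ?A"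
    using le by (rule mult_right_mono) simp
  also have "\<dots> = (\<integral>\<^sup>+\<omega>\<in>?A. ?R \<omega> \<partial>LR.S0)"
    using pos fin by (simp add: ennreal_divide_times ennreal_divide_self less_top[symmetric])
  finally show "?t * emeasure LR.S0 ?A \<le> (\<Sum>n. \<integral>\<^sup>+\<omega>. of_bool (LR.down b n \<omega>) *
           (\<integral>\<^sup>+\<omega>'. ennreal_of_enat (?low n \<omega> \<omega>') \<partial>LR.S0) \<partial>LR.S0)"
    unfolding num .
qed

text \<open>The bound \<open>exp (a1 + b)\<close> is available for every \<open>b\<close> strictly
  below \<open>a - a1\<close>; the claim follows in the limit.\<close>

lemma arl_ge:
  assumes a: "a1 < a"
  shows "ennreal (exp a) \<le> arl f0 f1 (Tc a)"
proof -
  have V: "arl f0 f1 (Tc a) = (\<integral>\<^sup>+\<omega>. ennreal_of_enat (hit (LR.ac_step \<xi> a1) {a..} 0 \<omega>) \<partial>LR.S0)"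
    unfolding arl_def ac_time_eq P_infinity ..
  have ge: "ennreal (exp (a1 + b)) \<le> arl f0 f1 (Tc a)" if b: "0 < b" "b < a - a1" for b
    unfolding V using return_hypothesis[OF b(1)]
    by (intro LR.expected_ac_hit_ge[OF measurable_\<xi> a1 a b arl_cusum_ge[OF a1]])
  show ?thesis
  proof (cases "arl f0 f1 (Tc a)")
    case (real r)
    \<comment> \<open>The widths \<open>b = (a - a1) * (1 - 1 / (n + 2))\<close> increase to
      \<open>a - a1\<close>; the offset 2 keeps them positive at \<open>n = 0\<close>.\<close>
    have "exp a \<le> r"
    proof (rule LIMSEQ_le_const2)
      show "(\<lambda>n. exp (a1 + (a - a1) * (1 - inverse (real (Suc (Suc n)))))) \<longlonglongrightarrow> exp a"
      proof -
        have "(\<lambda>n. exp (a1 + (a - a1) * (1 - inverse (real (Suc (Suc n)))))) \<longlonglongrightarrow> exp (a1 + (a - a1) * (1 - 0))"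
          by (intro tendsto_intros LIMSEQ_Suc[OF LIMSEQ_inverse_real_of_nat])
        then show ?thesis by simp
      qed
      have "exp (a1 + (a - a1) * (1 - inverse (real (Suc (Suc n))))) \<le> r" for n
      proof -
        have "0 < inverse (real (Suc (Suc n)))" "inverse (real (Suc (Suc n))) < 1"
          by (auto simp: field_simps)
        then have "0 < (a - a1) * (1 - inverse (real (Suc (Suc n))))"
          "(a - a1) * (1 - inverse (real (Suc (Suc n)))) < a - a1"
          using a by auto
        from ge[OF this] show ?thesis using real by simp
      qed
      then show "\<exists>N. \<forall>n\<ge>N. exp (a1 + (a - a1) * (1 - inverse (real (Suc (Suc n))))) \<le> r" by blast
    qed
    then show ?thesis using real by (simp add: ennreal_leI)
  qed simp
qed

lemma comm_rate_le: "a1 < a \<Longrightarrow> comm_rate f0 f1 (Tc a) pol \<le> ennreal \<epsilon>"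
  using E_star by (auto simp: E_star_def E_comm_def)

end

section \<open>Information available to the fusion centre\<close>

abbreviation borel_seq :: "(nat \<Rightarrow> real) measure" where
  "borel_seq \<equiv> PiM UNIV (\<lambda>_. borel)"

abbreviation info_fun :: "policy \<Rightarrow> enat \<Rightarrow> (nat \<Rightarrow> real) \<Rightarrow> nat \<Rightarrow> bool \<times> real" where
  "info_fun \<Psi> t \<omega> \<equiv> \<lambda>k\<in>{k. 1 \<le> k \<and> enat k \<le> t}. (transmit \<Psi> k \<omega>, of_bool (transmit \<Psi> k \<omega>) * X k \<omega>)"

lemma space_info [simp]: "space (info \<Psi> t) = UNIV"
  by (simp add: info_def)

lemma measurable_info_fun:
  "info_fun \<Psi> t \<in> info \<Psi> t \<rightarrow>\<^sub>M (\<Pi>\<^sub>M k\<in>{k. 1 \<le> k \<and> enat k \<le> t}. count_space UNIV \<Otimes>\<^sub>M borel)"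
  unfolding info_def by (rule measurable_vimage_algebra1) (auto simp: space_PiM space_pair_measure)

lemma measurable_transmitted:
  assumes "1 \<le> k" "enat k \<le> t"
  shows "Measurable.pred (info \<Psi> t) (transmit \<Psi> k)"
    and "(\<lambda>\<omega>. of_bool (transmit \<Psi> k \<omega>) * X k \<omega>) \<in> borel_measurable (info \<Psi> t)"
proof -
  have "(\<lambda>\<omega>. info_fun \<Psi> t \<omega> k) \<in> info \<Psi> t \<rightarrow>\<^sub>M count_space UNIV \<Otimes>\<^sub>M borel"
    using assms by (intro measurable_compose[OF measurable_info_fun measurable_component_singleton]) simp
  then have *: "(\<lambda>\<omega>. (transmit \<Psi> k \<omega>, of_bool (transmit \<Psi> k \<omega>) * X k \<omega>)) \<in> info \<Psi> t \<rightarrow>\<^sub>M count_space UNIV \<Otimes>\<^sub>M borel"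
    using assms by simp
  show "Measurable.pred (info \<Psi> t) (transmit \<Psi> k)"
    using measurable_compose[OF * measurable_fst] by simp
  show "(\<lambda>\<omega>. of_bool (transmit \<Psi> k \<omega>) * X k \<omega>) \<in> borel_measurable (info \<Psi> t)"
    using measurable_compose[OF * measurable_snd] by simp
qed

lemma sets_infoE:
  assumes "A \<in> sets (info \<Psi> t)"
  obtains A' where "A' \<in> sets (\<Pi>\<^sub>M k\<in>{k. 1 \<le> k \<and> enat k \<le> t}. count_space UNIV \<Otimes>\<^sub>M borel)"
    "A = info_fun \<Psi> t -` A'"
proof -
  have "info_fun \<Psi> t \<in> UNIV \<rightarrow> space (\<Pi>\<^sub>M k\<in>{k. 1 \<le> k \<and> enat k \<le> t}. count_space UNIV \<Otimes>\<^sub>M borel)"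
    by (auto simp: space_PiM space_pair_measure)
  from sets_vimage_algebra2[OF this] show ?thesis
    using assms that unfolding info_def by auto
qed

lemma depends_on_first_info:
  assumes A: "A \<in> sets (info \<Psi> (enat n))"
    and dep: "\<And>k. 1 \<le> k \<Longrightarrow> k \<le> n \<Longrightarrow> depends_on_first k (transmit \<Psi> k)"
  shows "depends_on_first n (\<lambda>\<omega>. \<omega> \<in> A)"
proof -
  obtain A' where A': "A = info_fun \<Psi> (enat n) -` A'" using sets_infoE[OF A] by blast
  show ?thesis
    unfolding depends_on_first_def
  proof (intro allI impI)
    fix \<omega> \<omega>' :: "nat \<Rightarrow> real" assume *: "\<forall>i<n. \<omega> i = \<omega>' i"
    have "transmit \<Psi> k \<omega> = transmit \<Psi> k \<omega>' \<and> X k \<omega> = X k \<omega>'" if "1 \<le> k" "k \<le> n" for k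
      using * that depends_on_firstD[OF dep[OF that], of \<omega> \<omega>'] by (auto simp: X_def)
    then have "info_fun \<Psi> (enat n) \<omega> = info_fun \<Psi> (enat n) \<omega>'"
      by (intro restrict_ext) auto
    then show "(\<omega> \<in> A) = (\<omega>' \<in> A)" by (simp add: A')
  qed
qed

lemma measurable_X [measurable]: "X k \<in> borel_measurable borel_seq"
  unfolding X_def[abs_def] by measurable

lemma sets_info_subset:
  assumes meas: "\<And>k. 1 \<le> k \<Longrightarrow> k \<le> n \<Longrightarrow> Measurable.pred borel_seq (transmit \<Psi> k)"
  shows "sets (info \<Psi> (enat n)) \<subseteq> sets borel_seq"
proof
  fix A assume "A \<in> sets (info \<Psi> (enat n))"
  then obtain A' where A': "A' \<in> sets (\<Pi>\<^sub>M k\<in>{k. 1 \<le> k \<and> enat k \<le> enat n}. count_space UNIV \<Otimes>\<^sub>M borel)"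
    "A = info_fun \<Psi> (enat n) -` A'" by (rule sets_infoE)
  have "info_fun \<Psi> (enat n) \<in> borel_seq \<rightarrow>\<^sub>M (\<Pi>\<^sub>M k\<in>{k. 1 \<le> k \<and> enat k \<le> enat n}. count_space UNIV \<Otimes>\<^sub>M borel)"
  proof (rule measurable_restrict)
    fix k assume "k \<in> {k. 1 \<le> k \<and> enat k \<le> enat n}"
    then have [measurable]: "Measurable.pred borel_seq (transmit \<Psi> k)" using meas by simp
    show "(\<lambda>\<omega>. (transmit \<Psi> k \<omega>, of_bool (transmit \<Psi> k \<omega>) * X k \<omega>)) \<in> borel_seq \<rightarrow>\<^sub>M count_space UNIV \<Otimes>\<^sub>M borel"
      by measurable
  qed
  from measurable_sets[OF this A'(1)] show "A \<in> sets borel_seq"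
    by (simp add: A'(2) space_PiM)
qed

text \<open>Strong induction: the decision at time \<open>k\<close> is measurable with respect to
  the information at \<open>k - 1\<close>, which is generated by earlier transmissions, and these
  are adapted by the induction hypothesis.\<close>

lemma transmit_adapted:
  assumes \<Psi>: "censoring_policy \<Psi>" and k: "1 \<le> k"
  shows "depends_on_first k (transmit \<Psi> k) \<and> Measurable.pred borel_seq (transmit \<Psi> k)"
  using k
proof (induction k rule: less_induct)
  case (less k)
  then obtain n where k: "k = Suc n" by (cases k) auto
  have pred: "Measurable.pred (info \<Psi> (enat n) \<Otimes>\<^sub>M borel) (\<lambda>(\<omega>, x). \<Psi> k \<omega> x)"
    using \<Psi> k unfolding censoring_policy_def by auto
  have IH: "depends_on_first j (transmit \<Psi> j)" "Measurable.pred borel_seq (transmit \<Psi> j)" if "1 \<le> j" "j \<le> n" for j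
    using less.IH[of j] that k by auto
  have sub: "sets (info \<Psi> (enat n)) \<subseteq> sets borel_seq"
    by (rule sets_info_subset) (rule IH)
  show ?case
  proof
    show "depends_on_first k (transmit \<Psi> k)"
      unfolding depends_on_first_def
    proof (intro allI impI)
      fix \<omega> \<omega>' :: "nat \<Rightarrow> real" assume *: "\<forall>i<k. \<omega> i = \<omega>' i"
      \<comment> \<open>Fixing the current observation turns joint measurability into an event of
        the information at time \<open>n\<close>, to which \<open>depends_on_first_info\<close>
        applies.\<close>
      have "(\<lambda>\<omega>. (\<omega>, \<omega>' n)) \<in> info \<Psi> (enat n) \<rightarrow>\<^sub>M info \<Psi> (enat n) \<Otimes>\<^sub>M borel"
        by (intro measurable_Pair measurable_ident measurable_const) auto
      from measurable_compose[OF this pred] have "{\<omega> \<in> space (info \<Psi> (enat n)). \<Psi> k \<omega> (\<omega>' n)} \<in> sets (info \<Psi> (enat n))"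
        by (simp add: pred_def)
      then have "depends_on_first n (\<lambda>\<omega>. \<omega> \<in> {\<omega>. \<Psi> k \<omega> (\<omega>' n)})"
        by (intro depends_on_first_info[OF _ IH(1)]) auto
      from depends_on_firstD[OF this, of \<omega> \<omega>'] have "\<Psi> k \<omega> (\<omega>' n) = \<Psi> k \<omega>' (\<omega>' n)"
        using * k by auto
      then show "transmit \<Psi> k \<omega> = transmit \<Psi> k \<omega>'"
        using * k by (simp add: transmit_def X_def)
    qed
    have "(\<lambda>\<omega>. \<omega>) \<in> borel_seq \<rightarrow>\<^sub>M info \<Psi> (enat n)"
      using sub by (intro measurableI) (auto simp: space_PiM vimage_def)
    then have "(\<lambda>\<omega>. (\<omega>, X k \<omega>)) \<in> borel_seq \<rightarrow>\<^sub>M info \<Psi> (enat n) \<Otimes>\<^sub>M borel"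
      by (intro measurable_Pair measurable_X)
    from measurable_compose[OF this pred] show "Measurable.pred borel_seq (transmit \<Psi> k)"
      by (simp add: transmit_def[abs_def])
  qed
qed

lemma info_adapted:
  assumes \<Psi>: "censoring_policy \<Psi>" and A: "A \<in> sets (info \<Psi> (enat n))"
  shows "depends_on_first n (\<lambda>\<omega>. \<omega> \<in> A)" and "A \<in> sets borel_seq"
  using depends_on_first_info[OF A] sets_info_subset[of n \<Psi>] transmit_adapted[OF \<Psi>] A by auto

lemma stopping_time_adapted:
  assumes \<Psi>: "censoring_policy \<Psi>" and T: "stopping_time (info \<Psi>) T"
  shows "{\<omega>. enat n < T \<omega>} \<in> sets (info \<Psi> (enat n))"
    and "depends_on_first n (\<lambda>\<omega>. enat n < T \<omega>)"
    and "Measurable.pred borel_seq (\<lambda>\<omega>. enat n < T \<omega>)"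
proof -
  have "Measurable.pred (info \<Psi> (enat n)) (\<lambda>\<omega>. T \<omega> \<le> enat n)"
    using T by (simp add: stopping_time_def)
  then have "{\<omega> \<in> space (info \<Psi> (enat n)). \<not> T \<omega> \<le> enat n} \<in> sets (info \<Psi> (enat n))"
    by measurable
  then show *: "{\<omega>. enat n < T \<omega>} \<in> sets (info \<Psi> (enat n))"
    by (simp add: not_le)
  show "depends_on_first n (\<lambda>\<omega>. enat n < T \<omega>)"
    using info_adapted(1)[OF \<Psi> *] by simp
  show "Measurable.pred borel_seq (\<lambda>\<omega>. enat n < T \<omega>)"
    using info_adapted(2)[OF \<Psi> *] by (simp add: pred_def space_PiM)
qed

text \<open>Testing on the set where the conditional expectation exceeds \<open>c\<close>, itself a
  set of \<open>F\<close>: the excess has integral 0. Finiteness of the measure permits the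
  cancellation in \<open>ennreal\<close>.\<close>

lemma AE_nn_cond_exp_le:
  assumes sub: "sigma_finite_subalgebra M F" and f [measurable]: "f \<in> borel_measurable M" and fin: "finite_measure M"
    and le: "\<And>A. A \<in> sets F \<Longrightarrow> (\<integral>\<^sup>+x\<in>A. f x \<partial>M) \<le> ennreal c * emeasure M A"
  shows "AE x in M. nn_cond_exp M F f x \<le> ennreal c"
proof -
  interpret sigma_finite_subalgebra M F by fact
  let ?N = "nn_cond_exp M F f"
  define A where "A = {x \<in> space F. ennreal c < ?N x}"
  have A: "A \<in> sets F" unfolding A_def by measurable
  then have AM [measurable]: "A \<in> sets M" using subalg by (auto simp: subalgebra_def)
  have "(\<integral>\<^sup>+x. (?N x - ennreal c) * indicator A x \<partial>M) + ennreal c * emeasure M A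
      = (\<integral>\<^sup>+x. (?N x - ennreal c) * indicator A x + ennreal c * indicator A x \<partial>M)"
    by (subst nn_integral_add) (auto simp: nn_integral_cmult_indicator)
  also have "\<dots> = (\<integral>\<^sup>+x. indicator A x * ?N x \<partial>M)"
    by (intro nn_integral_cong) (auto simp: A_def indicator_def diff_add_cancel_ennreal)
  also have "\<dots> = (\<integral>\<^sup>+x. indicator A x * f x \<partial>M)"
    using A by (intro nn_cond_exp_intg) auto
  also have "\<dots> \<le> ennreal c * emeasure M A"
    using le[OF A] by (simp add: mult.commute)
  finally have "(\<integral>\<^sup>+x. (?N x - ennreal c) * indicator A x \<partial>M) + ennreal c * emeasure M A \<le> 0 + ennreal c * emeasure M A"
    by simp
  moreover have "ennreal c * emeasure M A \<noteq> \<infinity>"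
    using finite_measure.emeasure_finite[OF fin] by (simp add: ennreal_mult_eq_top_iff)
  ultimately have "(\<integral>\<^sup>+x. (?N x - ennreal c) * indicator A x \<partial>M) = 0"
    unfolding add.commute[of _ "ennreal c * emeasure M A"] ennreal_add_left_cancel_le by simp
  then have "AE x in M. (?N x - ennreal c) * indicator A x = 0"
    by (subst (asm) nn_integral_0_iff_AE) auto
  then show ?thesis
    using AE_space
  proof eventually_elim
    case (elim x)
    then show ?case
      using subalg by (auto simp: A_def indicator_def subalgebra_def not_less split: if_splits)
        (metis diff_eq_0_iff_ennreal not_less)
  qed
qed

context change_model
begin

lemma sets_borel_seq: "sets borel_seq = sets LR.S0"
  by (intro sets_PiM_cong) auto

lemma sigma_finite_subalgebra_info:
  assumes "censoring_policy \<Psi>"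
  shows "sigma_finite_subalgebra (P f0 f1 \<nu>) (info \<Psi> (enat n))"
proof -
  have "finite_measure_subalgebra (P f0 f1 \<nu>) (info \<Psi> (enat n))"
    using prob_space.axioms(1)[OF prob_space_P[of \<nu>]] info_adapted(2)[OF assms, of _ n]
    by (auto simp: finite_measure_subalgebra_def finite_measure_subalgebra_axioms_def subalgebra_def
        sets_P sets_borel_seq[symmetric])
  then show ?thesis
    by (rule finite_measure_subalgebra_is_sigma_finite)
qed

lemma emeasure_P_past:
  assumes A: "A \<in> sets borel_seq" and dep: "depends_on_first n (\<lambda>\<omega>. \<omega> \<in> A)"
  shows "emeasure (P f0 f1 (enat (Suc n))) A = emeasure LR.S0 A"
proof -
  have [measurable]: "A \<in> sets LR.S0" using A by (simp add: sets_borel_seq)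
  have "emeasure (P f0 f1 (enat (Suc n))) A = (\<integral>\<^sup>+\<omega>. indicator A \<omega> \<partial>P f0 f1 (enat (Suc n)))"
    by (rule nn_integral_indicator[symmetric]) (simp add: sets_P)
  also have "\<dots> = (\<integral>\<^sup>+\<omega>. (\<integral>\<^sup>+\<omega>'. indicator A (comb_seq n \<omega> \<omega>') \<partial>LR.S1) \<partial>LR.S0)"
    by (subst nn_integral_P_enat) auto
  also have "\<dots> = (\<integral>\<^sup>+\<omega>. indicator A \<omega> \<partial>LR.S0)"
    using depends_on_first_comb_seq[OF dep] by (intro nn_integral_cong) (simp add: indicator_def LR.N1.P.emeasure_space_1[simplified])
  finally show ?thesis by simp
qed

section \<open>Lower bound for the detection delay\<close>

text \<open>Otherwise summing over \<open>n\<close> would give \<open>2 * m \<le> m\<close>, as \<open>n < T \<le> n + m\<close> for at most \<open>m\<close> values of \<open>n\<close>.\<close>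
lemma exists_quiet_window:
  assumes meas: "\<And>n. Measurable.pred borel_seq (\<lambda>\<omega>. enat n < T \<omega>)"
    and arl: "ennreal \<zeta> \<le> arl f0 f1 T" and \<zeta>: "0 < \<zeta>" and m: "1 \<le> (m::nat)"
  shows "\<exists>n. 0 < emeasure LR.S0 {\<omega>. enat n < T \<omega>} \<and>
    emeasure LR.S0 {\<omega>. enat n < T \<omega> \<and> T \<omega> \<le> enat (n + m)} \<le> ennreal (2 * real m / \<zeta>) * emeasure LR.S0 {\<omega>. enat n < T \<omega>}"
proof (rule ccontr)
  assume no: "\<nexists>n. 0 < emeasure LR.S0 {\<omega>. enat n < T \<omega>} \<and>
    emeasure LR.S0 {\<omega>. enat n < T \<omega> \<and> T \<omega> \<le> enat (n + m)} \<le> ennreal (2 * real m / \<zeta>) * emeasure LR.S0 {\<omega>. enat n < T \<omega>}"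
  have [measurable]: "Measurable.pred LR.S0 (\<lambda>\<omega>. enat n < T \<omega>)" for n
    using meas[of n] by (simp add: measurable_cong_sets[OF sets_borel_seq refl])
  have K: "Measurable.pred LR.S0 (\<lambda>\<omega>. enat n < T \<omega> \<and> T \<omega> \<le> enat (n + m))" for n
    unfolding not_less[symmetric] by measurable
  note [measurable] = K
  have le: "ennreal (2 * real m / \<zeta>) * emeasure LR.S0 {\<omega>. enat n < T \<omega>}
      \<le> emeasure LR.S0 {\<omega>. enat n < T \<omega> \<and> T \<omega> \<le> enat (n + m)}" for n
    using no by (cases "emeasure LR.S0 {\<omega>. enat n < T \<omega>} = 0") (auto simp: not_le zero_less_iff_neq_zero intro: less_imp_le)
  have pointwise: "(\<Sum>n. of_bool (enat n < T \<omega> \<and> T \<omega> \<le> enat (n + m))) \<le> (of_nat m :: ennreal)" for \<omega>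
    proof (cases "T \<omega>")
      case (enat t)
      have "(\<Sum>n. of_bool (enat n < T \<omega> \<and> T \<omega> \<le> enat (n + m)))
        = (\<Sum>n\<in>{t - m..<t}. of_bool (enat n < T \<omega> \<and> T \<omega> \<le> enat (n + m)) :: ennreal)"
        by (rule suminf_finite) (auto simp: enat)
      also have "\<dots> \<le> (\<Sum>n\<in>{t - m..<t}. 1)"
        by (intro sum_mono) auto
      also have "\<dots> \<le> of_nat m" by (auto intro!: of_nat_mono)
      finally show ?thesis .
    qed auto
  have "ennreal (2 * real m / \<zeta>) * ennreal \<zeta> \<le> ennreal (2 * real m / \<zeta>) * arl f0 f1 T"
    using arl by (rule mult_left_mono) simp
  also have "arl f0 f1 T = (\<Sum>n. emeasure LR.S0 {\<omega>. enat n < T \<omega>})"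
    unfolding arl_def P_infinity ennreal_of_enat_eq_suminf
    by (subst nn_integral_suminf) (auto simp: nn_integral_of_bool)
  also have "ennreal (2 * real m / \<zeta>) * \<dots> = (\<Sum>n. ennreal (2 * real m / \<zeta>) * emeasure LR.S0 {\<omega>. enat n < T \<omega>})"
    by (rule ennreal_suminf_cmult[symmetric])
  also have "\<dots> \<le> (\<Sum>n. emeasure LR.S0 {\<omega>. enat n < T \<omega> \<and> T \<omega> \<le> enat (n + m)})"
    by (intro suminf_le le) auto
  also have "\<dots> = (\<integral>\<^sup>+\<omega>. (\<Sum>n. of_bool (enat n < T \<omega> \<and> T \<omega> \<le> enat (n + m))) \<partial>LR.S0)"
    by (subst nn_integral_suminf) (auto simp: nn_integral_of_bool)
  also have "\<dots> \<le> (\<integral>\<^sup>+\<omega>. of_nat m \<partial>LR.S0)"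
    by (intro nn_integral_mono pointwise)
  also have "\<dots> = of_nat m"
    by (simp add: LR.N0.P.emeasure_space_1[simplified])
  finally have "ennreal (2 * real m) \<le> ennreal (real m)"
    using \<zeta> by (simp add: ennreal_mult[symmetric] ennreal_of_nat_eq_real_of_nat)
  then show False using m by simp
qed

text \<open>The change is placed at time \<open>n + 1\<close>, at the start of the quiet window.
  \<open>H\<close> is the absence of an alarm by time \<open>n\<close>, \<open>K\<close> an alarm
  inside the window, and \<open>C\<close> the threshold for the log-likelihood ratio of the window.
  Given \<open>H\<close>, the delay is at least \<open>m\<close> except with probability
  \<open>r\<close>.\<close>

lemma lorden_delay_ge:
  assumes feas: "(T, \<Psi>) \<in> feasible f0 f1 \<epsilon> \<zeta>" and \<zeta>: "0 < \<zeta>" and m: "1 \<le> (m::nat)"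
  shows "ennreal (real m * (1 - exp C * (2 * real m / \<zeta>) - measure LR.S1 {\<omega>. C \<le> LR.walk m \<omega>})) \<le> lorden_delay f0 f1 T \<Psi>"
proof -
  have \<Psi>: "censoring_policy \<Psi>" and T: "stopping_time (info \<Psi>) T" and arl: "ennreal \<zeta> \<le> arl f0 f1 T"
    using feas by (auto simp: feasible_def)
  note adapted = stopping_time_adapted[OF \<Psi> T]
  have mT [measurable]: "Measurable.pred LR.S0 (\<lambda>\<omega>. enat n < T \<omega>)" for n
    using adapted(3)[of n] by (simp add: measurable_cong_sets[OF sets_borel_seq refl])
  obtain n where h0: "0 < emeasure LR.S0 {\<omega>. enat n < T \<omega>}" and
    K0: "emeasure LR.S0 {\<omega>. enat n < T \<omega> \<and> T \<omega> \<le> enat (n + m)} \<le> ennreal (2 * real m / \<zeta>) * emeasure LR.S0 {\<omega>. enat n < T \<omega>}"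
    using exists_quiet_window[OF adapted(3) arl \<zeta> m] by blast
  define H where "H = {\<omega>. enat n < T \<omega>}"
  define K where "K \<omega> \<longleftrightarrow> enat n < T \<omega> \<and> T \<omega> \<le> enat (n + m)" for \<omega>
  let ?K0 = "\<lambda>\<omega>. emeasure LR.S0 {\<omega>'. K (comb_seq n \<omega> \<omega>')}"
  have mK [measurable]: "Measurable.pred LR.S0 K"
    unfolding K_def[abs_def] not_less[symmetric] by measurable
  have H: "H \<in> sets (info \<Psi> (enat n))" using adapted(1) by (simp add: H_def)
  have HS [measurable]: "H \<in> sets LR.S0"
    using info_adapted(2)[OF \<Psi> H] by (simp add: sets_borel_seq)
  have depH: "depends_on_first n (\<lambda>\<omega>. enat n < T \<omega>)" by (rule adapted(2))
  define h where "h = measure LR.S0 H"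
  have eh: "emeasure LR.S0 H = ennreal h" by (simp add: h_def LR.N0.P.emeasure_eq_measure)
  have h: "0 < h" using h0 eh by (simp add: H_def)
  define q where "q = measure LR.S1 {\<omega>. C \<le> LR.walk m \<omega>}"
  let ?P = "P f0 f1 (enat (Suc n))"
  have sub: "sigma_finite_subalgebra ?P (info \<Psi> (enat n))" by (rule sigma_finite_subalgebra_info[OF \<Psi>])
  interpret PP: prob_space ?P by (rule prob_space_P)
  have [measurable_cong]: "sets ?P = sets LR.S0" by (rule sets_P)
  have PH: "emeasure ?P H = ennreal h"
    using emeasure_P_past[OF info_adapted(2,1)[OF \<Psi> H]] eh by simp
  have combK: "emeasure LR.S0 {\<omega>. K \<omega>} = (\<integral>\<^sup>+\<omega>. ?K0 \<omega> \<partial>LR.S0)"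
  proof -
    have "emeasure LR.S0 {\<omega>. K \<omega>} = (\<integral>\<^sup>+\<omega>. (\<lambda>\<omega> \<omega>'. of_bool (K (comb_seq n \<omega> \<omega>'))) \<omega> (shift n \<omega>) \<partial>LR.S0)"
    proof -
      have "comb_seq n \<omega> (shift n \<omega>) = \<omega>" for \<omega> by (auto simp: comb_seq_def shift_def)
      moreover have "emeasure LR.S0 {\<omega>. K \<omega>} = (\<integral>\<^sup>+\<omega>. of_bool (K \<omega>) \<partial>LR.S0)"
        by (subst nn_integral_of_bool) auto
      ultimately show ?thesis by simp
    qed
    also have "\<dots> = (\<integral>\<^sup>+\<omega>. (\<integral>\<^sup>+\<omega>'. of_bool (K (comb_seq n \<omega> \<omega>')) \<partial>LR.S0) \<partial>LR.S0)"
    proof (rule LR.N0.nn_integral_shift)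
      show "(\<lambda>(\<omega>, \<omega>'). of_bool (K (comb_seq n \<omega> \<omega>'))) \<in> borel_measurable (LR.S0 \<Otimes>\<^sub>M LR.S0)"
        unfolding split_beta' by measurable
      show "depends_on_first n (\<lambda>\<omega>. of_bool (K (comb_seq n \<omega> \<omega>')))" for \<omega>'
        unfolding depends_on_first_def
      proof (intro allI impI)
        fix \<omega> \<omega>'' :: "nat \<Rightarrow> real" assume "\<forall>i<n. \<omega> i = \<omega>'' i"
        then have "comb_seq n \<omega> \<omega>' = comb_seq n \<omega>'' \<omega>'" by (auto simp: comb_seq_def)
        then show "of_bool (K (comb_seq n \<omega> \<omega>')) = of_bool (K (comb_seq n \<omega>'' \<omega>'))" by simp
      qed
    qed
    also have "\<dots> = (\<integral>\<^sup>+\<omega>. ?K0 \<omega> \<partial>LR.S0)"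
      by (intro nn_integral_cong) (subst nn_integral_of_bool, auto)
    finally show ?thesis .
  qed
  \<comment> \<open>For a fixed past, the part of \<open>K\<close> with log-likelihood ratio below
    \<open>C\<close> is compared with its pre-change probability; the rest has probability at most
    \<open>q\<close>, and is empty unless the past lies in \<open>H\<close>.\<close>
  have section_le: "emeasure LR.S1 {\<omega>'. K (comb_seq n \<omega> \<omega>')}
      \<le> ennreal (exp C) * ?K0 \<omega> + ennreal q * indicator H \<omega>" for \<omega>
  proof -
    let ?K = "\<lambda>\<omega>'. K (comb_seq n \<omega> \<omega>')"
    have m1 [measurable]: "Measurable.pred LR.S0 ?K" by measurable
    have m1' [measurable]: "Measurable.pred LR.S1 ?K"
      using m1 by (simp add: measurable_cong_sets[OF LR.sets_S1_S0 refl])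
    have depK: "depends_on_first m ?K"
      unfolding depends_on_first_def
    proof (intro allI impI)
      fix \<omega>' \<omega>'' :: "nat \<Rightarrow> real" assume *: "\<forall>i<m. \<omega>' i = \<omega>'' i"
      have "(enat n < T (comb_seq n \<omega> \<omega>')) = (enat n < T (comb_seq n \<omega> \<omega>''))"
        by (rule depends_on_firstD[OF depH]) (simp add: comb_seq_def)
      moreover have "(enat (n + m) < T (comb_seq n \<omega> \<omega>')) = (enat (n + m) < T (comb_seq n \<omega> \<omega>''))"
        by (rule depends_on_firstD[OF adapted(2)]) (use * in \<open>auto simp: comb_seq_def\<close>)
      ultimately show "?K \<omega>' = ?K \<omega>''" by (simp add: K_def not_less[symmetric])
    qed
    have s0: "{\<omega>'\<in>space LR.S0. ?K \<omega>'} \<in> sets LR.S0"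
      by measurable
    have s1: "{\<omega>'\<in>space LR.S1. ?K \<omega>' \<and> LR.walk m \<omega>' < C} \<in> sets LR.S1"
      "{\<omega>'\<in>space LR.S1. ?K \<omega>' \<and> C \<le> LR.walk m \<omega>'} \<in> sets LR.S1"
      by measurable
    have "emeasure LR.S1 {\<omega>'. ?K \<omega>'} \<le> emeasure LR.S1 ({\<omega>'. ?K \<omega>' \<and> LR.walk m \<omega>' < C} \<union> {\<omega>'. ?K \<omega>' \<and> C \<le> LR.walk m \<omega>'})"
      using s1 by (intro emeasure_mono) auto
    also have "\<dots> \<le> emeasure LR.S1 {\<omega>'. ?K \<omega>' \<and> LR.walk m \<omega>' < C} + emeasure LR.S1 {\<omega>'. ?K \<omega>' \<and> C \<le> LR.walk m \<omega>'}"
      using s1 by (intro emeasure_subadditive) auto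
    also have "emeasure LR.S1 {\<omega>'. ?K \<omega>' \<and> LR.walk m \<omega>' < C} \<le> ennreal (exp C) * emeasure LR.S0 {\<omega>'. ?K \<omega>' \<and> LR.walk m \<omega>' < C}"
    proof (rule LR.emeasure_S1_le)
      show "Measurable.pred LR.S0 (\<lambda>\<omega>'. ?K \<omega>' \<and> LR.walk m \<omega>' < C)" by measurable
      show "depends_on_first m (\<lambda>\<omega>'. ?K \<omega>' \<and> LR.walk m \<omega>' < C)"
        by (rule depends_on_first_map2[OF depK depends_on_first_run, where h = "\<lambda>u t. u \<and> t < C"])
    qed (auto simp: LR.walk_eq_sum)
    also have "emeasure LR.S0 {\<omega>'. ?K \<omega>' \<and> LR.walk m \<omega>' < C} \<le> emeasure LR.S0 {\<omega>'\<in>space LR.S0. ?K \<omega>'}"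
      using s0 by (intro emeasure_mono) auto
    also have "emeasure LR.S1 {\<omega>'. ?K \<omega>' \<and> C \<le> LR.walk m \<omega>'} \<le> ennreal q * indicator H \<omega>"
    proof (cases "\<omega> \<in> H")
      case True
      have "{\<omega>\<in>space LR.S1. C \<le> LR.walk m \<omega>} \<in> sets LR.S1" by measurable
      then have "emeasure LR.S1 {\<omega>'. ?K \<omega>' \<and> C \<le> LR.walk m \<omega>'} \<le> emeasure LR.S1 {\<omega>. C \<le> LR.walk m \<omega>}"
        by (intro emeasure_mono) auto
      then show ?thesis using True by (simp add: q_def LR.N1.P.emeasure_eq_measure)
    next
      case False
      then have "\<not> ?K \<omega>'" for \<omega>'
        using depends_on_first_comb_seq[OF depH, of \<omega> \<omega>'] by (auto simp: K_def H_def)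
      then show ?thesis by simp
    qed
    finally show ?thesis by (simp add: add_mono mult_left_mono)
  qed
  have PK: "emeasure ?P {\<omega>. K \<omega>} \<le> ennreal (h * (exp C * (2 * real m / \<zeta>) + q))"
  proof -
    have "emeasure ?P {\<omega>. K \<omega>} = (\<integral>\<^sup>+\<omega>. of_bool (K \<omega>) \<partial>?P)"
      by (subst nn_integral_of_bool) auto
    also have "\<dots> = (\<integral>\<^sup>+\<omega>. (\<integral>\<^sup>+\<omega>'. of_bool (K (comb_seq n \<omega> \<omega>')) \<partial>LR.S1) \<partial>LR.S0)"
      by (subst nn_integral_P_enat) auto
    also have "\<dots> = (\<integral>\<^sup>+\<omega>. emeasure LR.S1 {\<omega>'. K (comb_seq n \<omega> \<omega>')} \<partial>LR.S0)"
    proof (intro nn_integral_cong)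
      fix \<omega>
      have m1: "Measurable.pred LR.S0 (\<lambda>\<omega>'. K (comb_seq n \<omega> \<omega>'))" by measurable
      then have "Measurable.pred LR.S1 (\<lambda>\<omega>'. K (comb_seq n \<omega> \<omega>'))"
        by (simp add: measurable_cong_sets[OF LR.sets_S1_S0 refl])
      then show "(\<integral>\<^sup>+\<omega>'. of_bool (K (comb_seq n \<omega> \<omega>')) \<partial>LR.S1) = emeasure LR.S1 {\<omega>'. K (comb_seq n \<omega> \<omega>')}"
        by (subst nn_integral_of_bool) auto
    qed
    also have "\<dots> \<le> (\<integral>\<^sup>+\<omega>. ennreal (exp C) * ?K0 \<omega> + ennreal q * indicator H \<omega> \<partial>LR.S0)"
      by (intro nn_integral_mono section_le)
    also have "\<dots> = ennreal (exp C) * emeasure LR.S0 {\<omega>. K \<omega>} + ennreal q * ennreal h"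
    proof -
      have "(\<lambda>\<omega>. \<integral>\<^sup>+\<omega>'. of_bool (K (comb_seq n \<omega> \<omega>')) \<partial>LR.S0) \<in> borel_measurable LR.S0"
        by (rule sigma_finite_measure.borel_measurable_nn_integral[OF prob_space_imp_sigma_finite[OF LR.N0.prob_space_S]])
          (unfold split_beta', measurable)
      moreover have "(\<integral>\<^sup>+\<omega>'. of_bool (K (comb_seq n \<omega> \<omega>')) \<partial>LR.S0) = ?K0 \<omega>" for \<omega>
        by (subst nn_integral_of_bool) auto
      ultimately have m2 [measurable]: "(\<lambda>\<omega>. ?K0 \<omega>) \<in> borel_measurable LR.S0"
        by simp
      show ?thesis
        by (subst nn_integral_add) (auto simp: nn_integral_cmult combK eh)
    qed
    also have "\<dots> \<le> ennreal (exp C) * (ennreal (2 * real m / \<zeta>) * ennreal h) + ennreal q * ennreal h"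
      using K0 unfolding H_def[symmetric] eh K_def[symmetric] by (intro add_right_mono mult_left_mono) auto
    also have "\<dots> = ennreal (h * (exp C * (2 * real m / \<zeta>) + q))"
      using h \<zeta> by (simp add: ennreal_mult[symmetric] ennreal_plus[symmetric] q_def algebra_simps del: ennreal_plus)
    finally show ?thesis .
  qed
  define r where "r = exp C * (2 * real m / \<zeta>) + q"
  have r: "0 \<le> r" using \<zeta> by (simp add: r_def q_def)
  have pK: "measure ?P {\<omega>. K \<omega>} \<le> h * r"
    using PK h r unfolding PP.emeasure_eq_measure r_def[symmetric] by simp
  have late: "ennreal (h - h * r) \<le> emeasure ?P {\<omega>. enat (n + m) < T \<omega>}"
  proof -
    have sK: "{\<omega>\<in>space ?P. K \<omega>} \<in> sets ?P" by measurable
    have sL: "{\<omega>\<in>space ?P. enat (n + m) < T \<omega>} \<in> sets ?P" by measurable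
    have "H \<subseteq> {\<omega>. K \<omega>} \<union> {\<omega>. enat (n + m) < T \<omega>}"
      by (auto simp: H_def K_def not_le)
    then have "measure ?P H \<le> measure ?P ({\<omega>. K \<omega>} \<union> {\<omega>. enat (n + m) < T \<omega>})"
      using sK sL by (intro PP.finite_measure_mono) auto
    also have "\<dots> \<le> measure ?P {\<omega>. K \<omega>} + measure ?P {\<omega>. enat (n + m) < T \<omega>}"
      using sK sL by (intro measure_Un_le) auto
    finally have "h - h * r \<le> measure ?P {\<omega>. enat (n + m) < T \<omega>}"
      using pK PH h by (simp add: PP.emeasure_eq_measure)
    then show ?thesis by (simp add: PP.emeasure_eq_measure ennreal_leI)
  qed
  \<comment> \<open>As \<open>\<nu> = Suc n\<close>, this is the truncated difference of
    \<open>T\<close> and \<open>n\<close>; it is 0 off \<open>H\<close> and at least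
    \<open>m\<close> if there is no alarm by time \<open>n + m\<close>.\<close>
  let ?D = "\<lambda>\<omega>. ennreal_of_enat (T \<omega> + 1 - enat (Suc n))"
  let ?E = "esssup ?P (nn_cond_exp ?P (info \<Psi> (enat n)) ?D)"
  have D_eq: "?D \<omega> = (\<Sum>j. of_bool (enat (n + j) < T \<omega>))" for \<omega>
    unfolding ennreal_of_enat_eq_suminf
    by (intro suminf_cong) (cases "T \<omega>"; auto simp: one_enat_def)
  have mD [measurable]: "?D \<in> borel_measurable ?P"
    unfolding D_eq by measurable
  have "ennreal (real m) * ennreal (h - h * r) \<le> ennreal (real m) * emeasure ?P {\<omega>. enat (n + m) < T \<omega>}"
    by (intro mult_left_mono late) simp
  also have "\<dots> = (\<integral>\<^sup>+\<omega>. ennreal (real m) * of_bool (enat (n + m) < T \<omega>) \<partial>?P)"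
    by (subst nn_integral_cmult) (auto simp: nn_integral_of_bool)
  also have "\<dots> \<le> (\<integral>\<^sup>+\<omega>. indicator H \<omega> * ?D \<omega> \<partial>?P)"
  proof (rule nn_integral_mono)
    fix \<omega>
    show "ennreal (real m) * of_bool (enat (n + m) < T \<omega>) \<le> indicator H \<omega> * ?D \<omega>"
    proof (cases "enat (n + m) < T \<omega>")
      case True
      then have "\<omega> \<in> H" by (cases "T \<omega>") (auto simp: H_def)
      moreover have "ennreal (real m) \<le> ?D \<omega>"
        using True by (cases "T \<omega>") (auto simp: one_enat_def ennreal_of_nat_eq_real_of_nat intro!: ennreal_leI)
      ultimately show ?thesis using True by simp
    qed simp
  qed
  \<comment> \<open>\<open>H\<close> belongs to the information at time \<open>n\<close>, so the
    delay may be replaced by its conditional expectation, which is at most its essential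
    supremum.\<close>
  also have "\<dots> = (\<integral>\<^sup>+\<omega>. indicator H \<omega> * nn_cond_exp ?P (info \<Psi> (enat n)) ?D \<omega> \<partial>?P)"
    using H by (intro sigma_finite_subalgebra.nn_cond_exp_intg[OF sub, symmetric]) auto
  also have "\<dots> \<le> (\<integral>\<^sup>+\<omega>. ?E * indicator H \<omega> \<partial>?P)"
    using esssup_AE[of "nn_cond_exp ?P (info \<Psi> (enat n)) ?D" ?P]
    by (intro nn_integral_mono_AE) (auto simp: indicator_def elim: eventually_mono)
  also have "\<dots> = ?E * ennreal h"
    using PH by (simp add: nn_integral_cmult_indicator)
  finally have "ennreal (real m * (1 - r)) * ennreal h \<le> ?E * ennreal h"
    using h by (subst ennreal_mult''[symmetric]) (auto simp: ennreal_mult''[symmetric] ennreal_mult'[symmetric] algebra_simps)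
  then have "ennreal (real m * (1 - r)) \<le> ?E"
    using h by (subst (asm) (1 2) mult.commute) (simp add: ennreal_mult_le_mult_iff)
  also have "?E \<le> lorden_delay f0 f1 T \<Psi>"
    unfolding lorden_delay_def by (rule SUP_upper2[of "Suc n"]) auto
  finally show ?thesis by (simp add: r_def q_def algebra_simps)
qed

end

context ac_model
begin

section \<open>Feasibility and detection delay of CuSum-AC\<close>

lemma transmit_eq: "transmit pol (Suc k) \<omega> = (if stat k \<omega> < a1 then \<psi>s \<epsilon>1 (X (Suc k) \<omega>) else True)"
  by (simp add: transmit_def ac_policy_def ac_strategy_def ac_stat_eq \<psi>s_1)

text \<open>The fusion centre can compute the statistic: at or above \<open>a1\<close> everything is
  transmitted, and below it silence contributes the known constant \<open>c\<close>. This makes the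
  policy and the alarm time admissible.\<close>

lemma stat_Suc_from_info:
  fixes k \<omega>
  defines "\<gamma> \<equiv> transmit pol (Suc k) \<omega>" and "y \<equiv> of_bool (transmit pol (Suc k) \<omega>) * X (Suc k) \<omega>"
    and "c \<equiv> ln (measure F1 {x. \<not> \<psi>s \<epsilon>1 x} / measure F0 {x. \<not> \<psi>s \<epsilon>1 x})"
  shows "stat (Suc k) \<omega> = (let s = stat k \<omega>; s' = max 0 (s + (if \<gamma> then llr f0 f1 y else c))
    in if s < a1 \<and> a1 \<le> s' then a1 else s')"
proof (cases "stat k \<omega> < a1")
  case True
  then show ?thesis
    by (auto simp: \<gamma>_def y_def c_def transmit_eq LR.ac_step_low LR.cens_def X_def Let_def)
next
  case False
  then show ?thesis
    by (simp add: \<gamma>_def y_def transmit_eq LR.ac_step_high X_def Let_def)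
qed

lemma measurable_stat_info: "enat k \<le> t \<Longrightarrow> stat k \<in> borel_measurable (info pol t)"
proof (induction k)
  case 0
  show ?case by simp
next
  case (Suc k)
  have [measurable]: "stat k \<in> borel_measurable (info pol t)"
    by (rule Suc.IH) (use Suc.prems order_trans[of "enat k" "enat (Suc k)" t] in simp)
  define c where "c = ln (measure F1 {x. \<not> \<psi>s \<epsilon>1 x} / measure F0 {x. \<not> \<psi>s \<epsilon>1 x})"
  define y where "y \<omega> = of_bool (transmit pol (Suc k) \<omega>) * X (Suc k) \<omega>" for \<omega>
  have [measurable]: "y \<in> borel_measurable (info pol t)" "Measurable.pred (info pol t) (transmit pol (Suc k))"
    using measurable_transmitted[of "Suc k" t pol] Suc.prems by (auto simp: y_def[abs_def])
  have "stat (Suc k) = (\<lambda>\<omega>. let s = stat k \<omega>; s' = max 0 (s + (if transmit pol (Suc k) \<omega> then llr f0 f1 (y \<omega>) else c))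
    in if s < a1 \<and> a1 \<le> s' then a1 else s')"
    unfolding c_def y_def by (rule ext) (rule stat_Suc_from_info)
  also have "\<dots> \<in> borel_measurable (info pol t)"
    unfolding Let_def by measurable
  finally show ?case .
qed

lemma censoring_policy_ac: "censoring_policy pol"
  unfolding censoring_policy_def
proof (intro allI impI)
  fix k :: nat assume "1 \<le> k"
  have "stat (k - 1) \<in> borel_measurable (info pol (enat (k - 1)))"
    by (rule measurable_stat_info) simp
  then have [measurable]: "(\<lambda>z. stat (k - 1) (fst z)) \<in> borel_measurable (info pol (enat (k - 1)) \<Otimes>\<^sub>M borel)"
    by (rule measurable_compose[OF measurable_fst])
  have eq: "(\<lambda>(\<omega>, x). pol k \<omega> x) = (\<lambda>z. stat (k - 1) (fst z) < a1 \<longrightarrow> \<psi>s \<epsilon>1 (snd z))"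
    by (auto simp: ac_policy_def ac_strategy_def ac_stat_eq \<psi>s_1 fun_eq_iff)
  show "Measurable.pred (info pol (enat (k - 1)) \<Otimes>\<^sub>M borel) (\<lambda>(\<omega>, x). pol k \<omega> x)"
    unfolding eq by measurable
qed

lemma stopping_time_ac: "stopping_time (info pol) (Tc a)"
  unfolding stopping_time_def
proof
  fix t
  show "Measurable.pred (info pol t) (\<lambda>\<omega>. Tc a \<omega> \<le> t)"
  proof (cases t)
    case (enat n)
    \<comment> \<open>Keeping \<open>k \<in> {1..n}\<close> inside the predicate allows a countable
      union over all \<open>k\<close> although \<open>stat k\<close> is measurable only up to the
      current time.\<close>
    have Q: "Measurable.pred (info pol t) (\<lambda>\<omega>. k \<in> {1..n} \<and> a \<le> stat k \<omega>)" for k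
    proof (cases "k \<in> {1..n}")
      case True
      then have "stat k \<in> borel_measurable (info pol t)"
        using enat by (intro measurable_stat_info) simp
      then have "Measurable.pred (info pol t) (\<lambda>\<omega>. a \<le> stat k \<omega>)"
        by (rule measurable_compose[where g = "\<lambda>x. a \<le> x" and N = borel]) simp
      moreover have "(\<lambda>\<omega>. k \<in> {1..n} \<and> a \<le> stat k \<omega>) = (\<lambda>\<omega>. a \<le> stat k \<omega>)"
        using True by auto
      ultimately show ?thesis by (simp only:)
    next
      case False
      then have "(\<lambda>\<omega>. k \<in> {1..n} \<and> a \<le> stat k \<omega>) = (\<lambda>_. False)" by auto
      then show ?thesis by (simp only: measurable_const space_count_space UNIV_I)
    qed
    have "Measurable.pred (info pol t) (\<lambda>\<omega>. \<exists>k. k \<in> {1..n} \<and> a \<le> stat k \<omega>)"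
      by (rule pred_intros_countable(2)) (rule Q)
    then show ?thesis
      unfolding ac_time_eq hit_def enat first_time_le_iff Bex_def atLeast_iff .
  qed simp
qed

lemma feasible_ac: "a1 < ln \<zeta> \<Longrightarrow> 1 \<le> \<zeta> \<Longrightarrow> (Tc (ln \<zeta>), pol) \<in> feasible f0 f1 \<epsilon> \<zeta>"
  using arl_ge[of "ln \<zeta>"] comm_rate_le[of "ln \<zeta>"]
  by (simp add: feasible_def censoring_policy_ac stopping_time_ac)

lemma stat_nonneg: "0 \<le> stat k \<omega>"
  using a1 by (cases k) (auto simp: LR.ac_step_def[of _ _ "stat _ \<omega>" "\<omega> _"])

text \<open>The conditional delay is tested on events of the past. Given the past, the remaining
  observations follow \<open>S1\<close>; before an alarm the remaining delay is the hitting time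
  from the current state in \<open>[0, a)\<close>, and after it the delay is 0.\<close>

lemma lorden_delay_le:
  assumes a: "a1 < a" and C: "\<And>s. 0 \<le> s \<Longrightarrow> s < a \<Longrightarrow>
    (\<integral>\<^sup>+\<omega>. ennreal_of_enat (hit (LR.ac_step \<xi> a1) {a..} s \<omega>) \<partial>LR.S1) \<le> ennreal C"
  shows "lorden_delay f0 f1 (Tc a) pol \<le> ennreal C"
  unfolding lorden_delay_def
proof (rule SUP_least)
  fix \<nu> :: nat assume "\<nu> \<in> {1..}"
  then obtain n where \<nu>: "\<nu> = Suc n" by (cases \<nu>) auto
  let ?P = "P f0 f1 (enat \<nu>)" and ?D = "\<lambda>\<omega>. ennreal_of_enat (Tc a \<omega> + 1 - enat \<nu>)"
  let ?hit = "\<lambda>s \<omega>. ennreal_of_enat (hit (LR.ac_step \<xi> a1) {a..} s \<omega>)"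
  have [measurable_cong]: "sets ?P = sets LR.S0" by (rule sets_P)
  have mT: "Measurable.pred LR.S0 (\<lambda>\<omega>. enat j < Tc a \<omega>)" for j
    unfolding ac_time_eq by measurable
  note [measurable] = mT
  have D_eq: "?D \<omega> = (\<Sum>j. of_bool (enat (n + j) < Tc a \<omega>))" for \<omega>
    unfolding ennreal_of_enat_eq_suminf \<nu>
    by (intro suminf_cong) (cases "Tc a \<omega>"; auto simp: one_enat_def)
  have mD [measurable]: "?D \<in> borel_measurable LR.S0"
    unfolding D_eq by measurable
  note mD' [measurable] = mD[unfolded \<nu>]
  have sub: "sigma_finite_subalgebra ?P (info pol (enat n))"
    by (rule sigma_finite_subalgebra_info[OF censoring_policy_ac])
  have "AE \<omega> in ?P. nn_cond_exp ?P (info pol (enat n)) ?D \<omega> \<le> ennreal C"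
  proof (rule AE_nn_cond_exp_le[OF sub])
    show "finite_measure ?P" by (rule prob_space.axioms(1)[OF prob_space_P])
    fix A assume A: "A \<in> sets (info pol (enat n))"
    note depA = info_adapted(1)[OF censoring_policy_ac A]
    have AS [measurable]: "A \<in> sets LR.S0"
      using info_adapted(2)[OF censoring_policy_ac A] by (simp add: sets_borel_seq)
    have "(\<integral>\<^sup>+\<omega>\<in>A. ?D \<omega> \<partial>?P) = (\<integral>\<^sup>+\<omega>. (\<integral>\<^sup>+\<omega>'. ?D (comb_seq n \<omega> \<omega>') * indicator A (comb_seq n \<omega> \<omega>') \<partial>LR.S1) \<partial>LR.S0)"
      by (subst nn_integral_P_enat) (auto simp: \<nu>)
    also have "\<dots> \<le> (\<integral>\<^sup>+\<omega>. ennreal C * indicator A \<omega> \<partial>LR.S0)"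
    proof (rule nn_integral_mono)
      fix \<omega>
      have past: "(enat n < Tc a (comb_seq n \<omega> \<omega>')) = (enat n < Tc a \<omega>)" "stat n (comb_seq n \<omega> \<omega>') = stat n \<omega>"
        "indicator A (comb_seq n \<omega> \<omega>') = (indicator A \<omega> :: ennreal)" for \<omega>'
        using depends_on_first_comb_seq[OF depends_on_first_less_hit] depends_on_first_comb_seq[OF depends_on_first_run]
          depends_on_first_comb_seq[OF depA]
        by (auto simp: ac_time_eq indicator_def)
      show "(\<integral>\<^sup>+\<omega>'. ?D (comb_seq n \<omega> \<omega>') * indicator A (comb_seq n \<omega> \<omega>') \<partial>LR.S1) \<le> ennreal C * indicator A \<omega>"
      proof (cases "enat n < Tc a \<omega>")
        case True
        have "?D (comb_seq n \<omega> \<omega>') = ?hit (stat n \<omega>) \<omega>'" for \<omega>'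
        proof -
          have "Tc a (comb_seq n \<omega> \<omega>') = enat n + hit (LR.ac_step \<xi> a1) {a..} (stat n \<omega>) \<omega>'"
            using hit_shift[of n "LR.ac_step \<xi> a1" "{a..}" 0 "comb_seq n \<omega> \<omega>'"] True past
            by (simp add: ac_time_eq shift_comb_seq)
          then show ?thesis
            by (cases "hit (LR.ac_step \<xi> a1) {a..} (stat n \<omega>) \<omega>'") (auto simp: \<nu> one_enat_def)
        qed
        then have "(\<integral>\<^sup>+\<omega>'. ?D (comb_seq n \<omega> \<omega>') * indicator A (comb_seq n \<omega> \<omega>') \<partial>LR.S1)
          = (\<integral>\<^sup>+\<omega>'. ?hit (stat n \<omega>) \<omega>' \<partial>LR.S1) * indicator A \<omega>"
          unfolding past by (simp add: indicator_def)
        also have "\<dots> \<le> ennreal C * indicator A \<omega>"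
        proof (rule mult_right_mono[OF C])
          show "stat n \<omega> < a"
            using True a a1 unfolding ac_time_eq hit_def less_first_time_iff by (cases n) (auto simp: not_le simp del: run.simps(2))
        qed (auto simp: stat_nonneg)
        finally show ?thesis .
      next
        case False
        then have "?D (comb_seq n \<omega> \<omega>') = 0" for \<omega>'
          using past(1)[of \<omega>'] unfolding \<nu> by (cases "Tc a (comb_seq n \<omega> \<omega>')") (auto simp: one_enat_def)
        then show ?thesis by simp
      qed
    qed
    also have "\<dots> = ennreal C * emeasure ?P A"
      unfolding \<nu> emeasure_P_past[OF info_adapted(2,1)[OF censoring_policy_ac A]]
      by (rule nn_integral_cmult_indicator[OF AS])
    finally show "(\<integral>\<^sup>+\<omega>\<in>A. ?D \<omega> \<partial>?P) \<le> ennreal C * emeasure ?P A" .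
  qed measurable
  then show "esssup ?P (nn_cond_exp ?P (info pol (enat (\<nu> - 1))) ?D) \<le> ennreal C"
    unfolding \<nu> diff_Suc_1
    by (intro esssup_I borel_measurable_nn_cond_exp2)
qed

lemma eventually_lorden_delay_le:
  assumes \<delta>: "0 < \<delta>"
  shows "\<forall>\<^sub>F \<zeta> in at_top. lorden_delay f0 f1 (Tc (ln \<zeta>)) pol \<le> ennreal (ln \<zeta> / I1 * (1 + \<delta>))"
proof -
  \<comment> \<open>The truncation level is fixed first, with truncated mean \<open>J\<close> above
    \<open>I1 / (1 + \<delta>)\<close>; everything in the bound other than \<open>a / J\<close> then
    stays constant as \<open>a\<close> grows.\<close>
  have "I1 / (1 + \<delta>) < I1" using \<delta> I1_pos by (simp add: field_simps)
  then have "\<forall>\<^sub>F n in sequentially. I1 / (1 + \<delta>) < (\<integral>x. min (llr f0 f1 x) (real n) \<partial>F1)"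
    using LR.tendsto_mean_min_l unfolding mean_llr1 by (rule order_tendstoD(1)[rotated])
  then obtain n where n: "I1 / (1 + \<delta>) < (\<integral>x. min (llr f0 f1 x) (real n) \<partial>F1)"
    using eventually_happens'[OF sequentially_bot] by blast
  define J where "J = (\<integral>x. min (llr f0 f1 x) (real n) \<partial>F1)"
  have J: "0 < J" "I1 / J < 1 + \<delta>"
  proof -
    have "0 < I1 / (1 + \<delta>)" using \<delta> I1_pos by simp
    then show "0 < J" using n unfolding J_def by simp
    then show "I1 / J < 1 + \<delta>" using n \<delta> I1_pos by (simp add: J_def field_simps)
  qed
  obtain K where K: "\<And>a B s. a1 < a \<Longrightarrow> 0 \<le> B \<Longrightarrow> 0 < (\<integral>x. min (llr f0 f1 x) B \<partial>F1) \<Longrightarrow> 0 \<le> s \<Longrightarrow> s < a \<Longrightarrow>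
    (\<integral>\<^sup>+\<omega>. ennreal_of_enat (hit (LR.ac_step \<xi> a1) {a..} s \<omega>) \<partial>LR.S1) \<le> ennreal ((a + B) / (\<integral>x. min (llr f0 f1 x) B \<partial>F1) + K)"
    using LR.expected_ac_hit_le[OF measurable_\<xi> optimal_strategy_informative[OF opt[OF \<epsilon>1] \<epsilon>1] a1] by blast
  have le: "lorden_delay f0 f1 (Tc a) pol \<le> ennreal ((a + real n) / J + K)" if "a1 < a" for a
    using K[OF that, of "real n"] J unfolding J_def[symmetric] by (intro lorden_delay_le that) auto
  have "((\<lambda>a. ((a + real n) / J + K) / (a / I1)) \<longlongrightarrow> I1 / J) at_top"
  proof -
    have "((\<lambda>a. ((a + c) / j + K) / (a / i)) \<longlongrightarrow> inverse j * i) at_top" if "0 < i" "0 < j" for i j c K :: real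
      using that by real_asymp
    from this[OF I1_pos J(1)] show ?thesis by (simp only: divide_inverse mult.commute)
  qed
  then have "\<forall>\<^sub>F a in at_top. ((a + real n) / J + K) / (a / I1) < 1 + \<delta>"
    using J(2) by (rule order_tendstoD(2))
  then have "\<forall>\<^sub>F a in at_top. lorden_delay f0 f1 (Tc a) pol \<le> ennreal (a / I1 * (1 + \<delta>))"
    using eventually_gt_at_top[of a1]
  proof eventually_elim
    case (elim a)
    then have x: "0 < a / I1" using a1 I1_pos by simp
    have "(a + real n) / J + K < (1 + \<delta>) * (a / I1)"
      using elim(1) unfolding pos_divide_less_eq[OF x] .
    then have "(a + real n) / J + K \<le> a / I1 * (1 + \<delta>)"
      by (subst mult.commute) (rule less_imp_le)
    then show ?case by (rule order_trans[OF le[OF elim(2)] ennreal_leI])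
  qed
  then show ?thesis
    using ln_at_top by (rule eventually_compose_filterlim)
qed

end

context change_model
begin

text \<open>With \<open>x = ln \<zeta> / I1\<close>, the window has length about
  \<open>(1 - d) * x\<close> and the threshold is \<open>(1 + d) * I1\<close> per observation. Since
  \<open>(1 - d) * (1 + d) = 1 - d * d\<close>, the threshold stays below \<open>ln \<zeta>\<close>
  by at least \<open>d * d * ln \<zeta>\<close>, which beats the polynomial factor
  \<open>2 * m\<close>.\<close>

lemma eventually_lorden_delay_ge:
  assumes \<delta>: "0 < \<delta>"
  shows "\<forall>\<^sub>F \<zeta> in at_top. \<forall>(T, \<Psi>)\<in>feasible f0 f1 \<epsilon> \<zeta>. ennreal (ln \<zeta> / I1 * (1 - \<delta>)) \<le> lorden_delay f0 f1 T \<Psi>"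
proof (cases "\<delta> < 1")
  case False
  have "\<forall>\<^sub>F \<zeta> in at_top. 0 \<le> ln \<zeta> / I1"
    using eventually_ge_at_top[of "1::real"]
  proof eventually_elim
    case (elim \<zeta>)
    then show ?case using I1_pos by simp
  qed
  then show ?thesis
  proof eventually_elim
    case (elim \<zeta>)
    \<comment> \<open>For \<open>\<delta> \<ge> 1\<close> the bound is vacuous, as
      \<open>ennreal\<close> sends nonpositive reals to 0.\<close>
    then have "ln \<zeta> / I1 * (1 - \<delta>) \<le> 0" using False by (intro mult_nonneg_nonpos) auto
    then show ?case by (auto simp: ennreal_neg)
  qed
next
  case True
  define d where "d = \<delta> / 2"
  have d: "0 < d" "d < 1" using \<delta> True by (auto simp: d_def)
  define q where "q m = measure LR.S1 {\<omega>. real m * (I1 + d * I1) \<le> LR.walk m \<omega>}" for m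
  have q: "q \<longlonglongrightarrow> 0"
    using LR.N1.weak_law_upper[OF measurable_llr LR.integrable_l1, of "d * I1"] d I1_pos
    unfolding q_def LR.walk_eq_sum mean_llr1 by simp
  define M where "M x = nat \<lfloor>(1 - d) * x\<rfloor>" for x :: real
  have M_le: "real (M x) \<le> (1 - d) * x" if "0 < x" for x
    using that d by (simp add: M_def)
  have M_ge: "(1 - d) * x - 1 \<le> real (M x)" for x
    unfolding M_def by linarith
  have M_top: "filterlim M at_top at_top"
  proof -
    have "filterlim (\<lambda>x. (1 - d) * x - 1) at_top at_top" using d by real_asymp
    then have "filterlim (\<lambda>x. real (M x)) at_top at_top"
      by (rule filterlim_at_top_mono) (use M_ge in auto)
    then show ?thesis by (simp add: filterlim_sequentially_iff_filterlim_real)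
  qed
  have M_ratio: "((\<lambda>x. real (M x) / x) \<longlongrightarrow> 1 - d) at_top"
  proof (rule tendsto_sandwich)
    show "\<forall>\<^sub>F x in at_top. ((1 - d) * x - 1) / x \<le> real (M x) / x"
      using eventually_gt_at_top[of 0] by eventually_elim (intro divide_right_mono M_ge, simp)
    show "\<forall>\<^sub>F x in at_top. real (M x) / x \<le> 1 - d"
      using eventually_gt_at_top[of 0] by eventually_elim (use M_le in \<open>simp add: pos_divide_le_eq\<close>)
    show "((\<lambda>x. ((1 - d) * x - 1) / x) \<longlongrightarrow> 1 - d) at_top" by real_asymp
  qed simp
  \<comment> \<open>The term \<open>exp C * (2 * m / \<zeta>)\<close> of
    \<open>lorden_delay_ge\<close>, with \<open>m = M x\<close> and
    \<open>\<zeta> = exp (x * I1)\<close>.\<close>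
  let ?e = "\<lambda>x. exp (real (M x) * (I1 + d * I1)) * (2 * real (M x) / exp (x * I1))"
  define G where "G x = real (M x) * (1 - ?e x - q (M x))" for x
  have small: "((\<lambda>x. ?e x) \<longlongrightarrow> 0) at_top"
  proof (rule tendsto_sandwich[of "\<lambda>_. 0"])
    show "\<forall>\<^sub>F x in at_top. ?e x \<le> 2 * x * exp (- (d * d * I1) * x)"
      using eventually_gt_at_top[of 0]
    proof eventually_elim
      case (elim x)
      have "real (M x) * (I1 + d * I1) \<le> (1 - d) * x * (I1 + d * I1)"
        using M_le[OF elim] d I1_pos by (intro mult_right_mono) auto
      also have "\<dots> = x * I1 - d * d * I1 * x" by (simp add: algebra_simps)
      finally have e: "exp (real (M x) * (I1 + d * I1)) \<le> exp (x * I1 - d * d * I1 * x)" by simp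
      have "(1 - d) * x \<le> x" using d elim by (simp add: algebra_simps)
      then have "real (M x) \<le> x" using M_le[OF elim] by linarith
      then have "?e x
          \<le> exp (x * I1 - d * d * I1 * x) * (2 * x / exp (x * I1))"
        using e elim by (intro mult_mono divide_right_mono) auto
      also have "\<dots> = 2 * x * exp (- (d * d * I1) * x)"
        by (simp add: exp_diff exp_minus field_simps)
      finally show ?case .
    qed
    show "((\<lambda>x. 2 * x * exp (- (d * d * I1) * x)) \<longlongrightarrow> 0) at_top"
    proof -
      have "((\<lambda>x. 2 * x * exp (- k * x)) \<longlongrightarrow> 0) at_top" if "0 < k" for k :: real
        using that by real_asymp
      then show ?thesis using d I1_pos by simp
    qed
  qed auto
  have "((\<lambda>x. real (M x) / x * (1 - ?e x - q (M x))) \<longlongrightarrow> (1 - d) * (1 - 0 - 0)) at_top"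
    by (intro tendsto_intros M_ratio small filterlim_compose[OF q M_top])
  then have "((\<lambda>x. G x / x) \<longlongrightarrow> 1 - d) at_top"
    by (simp add: G_def)
  then have "\<forall>\<^sub>F x in at_top. 1 - \<delta> < G x / x"
    using \<delta> by (intro order_tendstoD(1)) (auto simp: d_def)
  moreover have "\<forall>\<^sub>F x in at_top. 1 \<le> M x"
    using M_top by (simp add: filterlim_at_top)
  ultimately have "\<forall>\<^sub>F x in at_top. 1 - \<delta> < G x / x \<and> 1 \<le> M x \<and> 0 < x"
    using eventually_gt_at_top[of 0] by eventually_elim simp
  moreover have "filterlim (\<lambda>\<zeta>. ln \<zeta> / I1) at_top at_top"
  proof -
    have "filterlim (\<lambda>\<zeta>. ln \<zeta> / i) at_top at_top" if "0 < i" for i :: real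
      using that by real_asymp
    then show ?thesis using I1_pos by blast
  qed
  ultimately have "\<forall>\<^sub>F \<zeta> in at_top. 1 - \<delta> < G (ln \<zeta> / I1) / (ln \<zeta> / I1) \<and> 1 \<le> M (ln \<zeta> / I1) \<and> 0 < ln \<zeta> / I1"
    by (rule eventually_compose_filterlim)
  then show ?thesis
    using eventually_gt_at_top[of 0]
  proof eventually_elim
    case (elim \<zeta>)
    let ?x = "ln \<zeta> / I1"
    have z: "exp (?x * I1) = \<zeta>" using elim I1_pos by simp
    have x: "0 < ?x" and g: "1 - \<delta> < G ?x / ?x" using elim by blast+
    have "(1 - \<delta>) * ?x < G ?x" using g unfolding pos_less_divide_eq[OF x] .
    then have "?x * (1 - \<delta>) \<le> G ?x" by (subst mult.commute) (rule less_imp_le)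
    moreover have "ennreal (G ?x) \<le> lorden_delay f0 f1 T \<Psi>" if "(T, \<Psi>) \<in> feasible f0 f1 \<epsilon> \<zeta>" for T \<Psi>
      using lorden_delay_ge[OF that, of "M ?x" "real (M ?x) * (I1 + d * I1)"] elim
      unfolding G_def z q_def by simp
    ultimately show ?case
      by (auto intro: order_trans[OF ennreal_leI])
  qed
qed

end

section \<open>First-order asymptotics and optimality\<close>

context ac_model
begin

text \<open>Real-valued, so that limits of quotients can be taken in the reals;
  \<open>enn2real\<close> loses nothing eventually, as the delays are then finite.\<close>

definition ratio :: "real \<Rightarrow> real" where
  "ratio \<zeta> = enn2real (lorden_delay f0 f1 (Tc (ln \<zeta>)) pol) / (ln \<zeta> / I1)"

definition opt_ratio :: "real \<Rightarrow> real" where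
  "opt_ratio \<zeta> = enn2real (INF (T, \<Psi>)\<in>feasible f0 f1 \<epsilon> \<zeta>. lorden_delay f0 f1 T \<Psi>) / (ln \<zeta> / I1)"

text \<open>CuSum-AC is feasible, so the optimal delay is at most its own; the lower bound holds for
  every feasible pair and hence for the infimum.\<close>

lemma eventually_sandwich:
  assumes \<delta>: "0 < \<delta>"
  shows "\<forall>\<^sub>F \<zeta> in at_top. 1 - \<delta> \<le> opt_ratio \<zeta> \<and> opt_ratio \<zeta> \<le> ratio \<zeta> \<and> ratio \<zeta> \<le> 1 + \<delta> \<and>
    lorden_delay f0 f1 (Tc (ln \<zeta>)) pol = ennreal (ln \<zeta> / I1 * ratio \<zeta>) \<and>
    (INF (T, \<Psi>)\<in>feasible f0 f1 \<epsilon> \<zeta>. lorden_delay f0 f1 T \<Psi>) = ennreal (ln \<zeta> / I1 * opt_ratio \<zeta>) \<and>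
    0 < ln \<zeta> / I1"
proof -
  have "\<forall>\<^sub>F \<zeta> in at_top. a1 < ln \<zeta>"
    using ln_at_top by (simp add: filterlim_at_top_dense)
  then show ?thesis
    using eventually_lorden_delay_le[OF \<delta>] eventually_lorden_delay_ge[OF \<delta>, of \<epsilon>] eventually_ge_at_top[of 1]
  proof eventually_elim
    case (elim \<zeta>)
    let ?x = "ln \<zeta> / I1" and ?L = "lorden_delay f0 f1 (Tc (ln \<zeta>)) pol"
      and ?O = "INF (T, \<Psi>)\<in>feasible f0 f1 \<epsilon> \<zeta>. lorden_delay f0 f1 T \<Psi>"
    have x: "0 < ?x" using elim(1) a1 I1_pos by (intro divide_pos_pos) linarith+
    have OL: "?O \<le> ?L"
      using feasible_ac[OF elim(1,4)] by (rule INF_lower2) simp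
    have Oge: "ennreal (?x * (1 - \<delta>)) \<le> ?O"
      using elim(3) by (intro INF_greatest) auto
    obtain L where L: "?L = ennreal L" "0 \<le> L"
      using elim(2) by (cases ?L) (auto simp: top_unique)
    obtain U where U: "?O = ennreal U" "0 \<le> U"
      using OL L by (cases ?O) (auto simp: top_unique)
    have scale: "1 - \<delta> \<le> U / x \<and> U / x \<le> L / x \<and> L / x \<le> 1 + \<delta> \<and> L = x * (L / x) \<and> U = x * (U / x)"
      if "0 < x" "U \<le> L" "x * (1 - \<delta>) \<le> U" "L \<le> x * (1 + \<delta>)" for x
      using that by (auto simp: pos_le_divide_eq pos_divide_le_eq divide_right_mono mult.commute)
    have "U \<le> L" using OL L U by simp
    moreover have "?x * (1 - \<delta>) \<le> U" using Oge ennreal_le_iff[OF U(2)] unfolding U(1) by blast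
    moreover have "L \<le> ?x * (1 + \<delta>)"
    proof -
      have "0 \<le> ?x * (1 + \<delta>)" using x \<delta> by (intro mult_nonneg_nonneg) linarith+
      then show ?thesis using elim(2) ennreal_le_iff unfolding L(1) by blast
    qed
    moreover have ratios: "ratio \<zeta> = L / ?x" "opt_ratio \<zeta> = U / ?x"
      unfolding ratio_def opt_ratio_def L(1) U(1) using L(2) U(2) by (simp_all only: enn2real_ennreal)
    ultimately show ?case
      using scale[OF x] x unfolding L(1) U(1) ratios by auto
  qed
qed

lemma tendsto_ratio: "(ratio \<longlongrightarrow> 1) at_top" and tendsto_opt_ratio: "(opt_ratio \<longlongrightarrow> 1) at_top"
proof -
  have "\<forall>\<^sub>F \<zeta> in at_top. dist (ratio \<zeta>) 1 < e \<and> dist (opt_ratio \<zeta>) 1 < e" if "0 < e" for e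
    using eventually_sandwich[of "e / 2"] that by (auto simp: dist_real_def elim!: eventually_mono)
  then show "(ratio \<longlongrightarrow> 1) at_top" "(opt_ratio \<longlongrightarrow> 1) at_top"
    unfolding tendsto_iff eventually_conj_iff by blast+
qed

lemma asymptotically_optimal_ac:
  "asymptotically_optimal f0 f1 \<epsilon> (\<lambda>\<zeta>. (Tc (ln \<zeta>), pol))"
  unfolding asymptotically_optimal_def
proof
  have "\<forall>\<^sub>F \<zeta> in at_top. a1 < ln \<zeta>"
    using ln_at_top by (simp add: filterlim_at_top_dense)
  then show "\<forall>\<^sub>F \<zeta> in at_top. (Tc (ln \<zeta>), pol) \<in> feasible f0 f1 \<epsilon> \<zeta>"
    using eventually_ge_at_top[of 1] by eventually_elim (rule feasible_ac)
  have "((\<lambda>\<zeta>. ratio \<zeta> / opt_ratio \<zeta>) \<longlongrightarrow> 1 / 1) at_top"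
    by (intro tendsto_divide tendsto_ratio tendsto_opt_ratio) simp
  then have "((\<lambda>\<zeta>. ennreal (ratio \<zeta> / opt_ratio \<zeta>)) \<longlongrightarrow> ennreal 1) at_top"
    by (intro tendsto_ennrealI) simp
  moreover have "\<forall>\<^sub>F \<zeta> in at_top. ennreal (ratio \<zeta> / opt_ratio \<zeta>) =
     case_prod (lorden_delay f0 f1) (Tc (ln \<zeta>), pol) /
            (INF (T, \<Psi>)\<in>feasible f0 f1 \<epsilon> \<zeta>. lorden_delay f0 f1 T \<Psi>)"
    \<comment> \<open>Any tolerance below 1 would do: it keeps \<open>opt_ratio\<close> away from 0,
      so that the common factor cancels in the \<open>ennreal\<close> quotient.\<close>
    using eventually_sandwich[OF half_gt_zero[OF zero_less_one]]
  proof eventually_elim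
    case (elim \<zeta>)
    then have pos: "0 < opt_ratio \<zeta>" "0 \<le> ratio \<zeta>" by auto
    from elim have L: "lorden_delay f0 f1 (Tc (ln \<zeta>)) pol = ennreal (ln \<zeta> / I1 * ratio \<zeta>)"
      and O: "(INF (T, \<Psi>)\<in>feasible f0 f1 \<epsilon> \<zeta>. lorden_delay f0 f1 T \<Psi>) = ennreal (ln \<zeta> / I1 * opt_ratio \<zeta>)"
      and x: "0 < ln \<zeta> / I1" by blast+
    have "ennreal (ln \<zeta> / I1 * ratio \<zeta>) / ennreal (ln \<zeta> / I1 * opt_ratio \<zeta>)
        = ennreal ((ln \<zeta> / I1 * ratio \<zeta>) / (ln \<zeta> / I1 * opt_ratio \<zeta>))"
      using pos x by (intro divide_ennreal mult_nonneg_nonneg mult_pos_pos) simp_all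
    also have "(ln \<zeta> / I1 * ratio \<zeta>) / (ln \<zeta> / I1 * opt_ratio \<zeta>) = ratio \<zeta> / opt_ratio \<zeta>"
      using x by (intro mult_divide_mult_cancel_left) linarith
    finally show ?case unfolding case_prod_conv L O ..
  qed
  ultimately show "((\<lambda>\<zeta>. case_prod (lorden_delay f0 f1) (Tc (ln \<zeta>), pol) /
            (INF (T, \<Psi>)\<in>feasible f0 f1 \<epsilon> \<zeta>. lorden_delay f0 f1 T \<Psi>)) \<longlongrightarrow> 1) at_top"
    unfolding ennreal_1 by (rule Lim_transform_eventually)
qed

lemma delay_expansion:
  "\<exists>h. (h \<longlongrightarrow> 0) at_top \<and>
    (\<forall>\<^sub>F \<zeta> in at_top. lorden_delay f0 f1 (Tc (ln \<zeta>)) pol = ennreal (ln \<zeta> / I1 * (1 + h \<zeta>)))"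
proof (intro exI conjI)
  show "((\<lambda>\<zeta>. ratio \<zeta> - 1) \<longlongrightarrow> 0) at_top"
    using tendsto_diff[OF tendsto_ratio tendsto_const[of 1]] by simp
  show "\<forall>\<^sub>F \<zeta> in at_top. lorden_delay f0 f1 (Tc (ln \<zeta>)) pol = ennreal (ln \<zeta> / I1 * (1 + (ratio \<zeta> - 1)))"
    using eventually_sandwich[of 1, simplified] by eventually_elim simp
qed

end

theorem theorem2:
  fixes f0 f1 :: "real \<Rightarrow> real" and \<psi>s :: "real \<Rightarrow> strategy" and \<epsilon> a1 \<epsilon>1 :: real
  assumes "prob_density f0" and "prob_density f1"
    and "0 < KL f1 f0" and "KL f1 f0 < \<infinity>"
    and "0 < KL f0 f1" and "KL f0 f1 < \<infinity>"
    and "\<And>e. 0 < e \<Longrightarrow> e \<le> 1 \<Longrightarrow> optimal_strategy f0 f1 e (\<psi>s e)"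
    and "\<psi>s 1 = (\<lambda>_. True)"
    and "0 < \<epsilon>" and "\<epsilon> \<le> 1" and "0 < a1"
    and "\<epsilon>1 \<in> E_star f0 f1 \<psi>s a1 \<epsilon>"
  shows
    "(\<forall>\<zeta>::real. 1 \<le> \<zeta> \<and> a1 < ln \<zeta> \<longrightarrow>
        ennreal \<zeta> \<le> arl f0 f1 (ac_time f0 f1 \<psi>s a1 \<epsilon>1 (ereal (ln \<zeta>))) \<and>
        comm_rate f0 f1 (ac_time f0 f1 \<psi>s a1 \<epsilon>1 (ereal (ln \<zeta>))) (ac_policy f0 f1 \<psi>s a1 \<epsilon>1)
          \<le> ennreal \<epsilon>) \<and>
     asymptotically_optimal f0 f1 \<epsilon>
       (\<lambda>\<zeta>. (ac_time f0 f1 \<psi>s a1 \<epsilon>1 (ereal (ln \<zeta>)), ac_policy f0 f1 \<psi>s a1 \<epsilon>1)) \<and>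
     (\<exists>h::real \<Rightarrow> real. (h \<longlongrightarrow> 0) at_top \<and>
        (\<forall>\<^sub>F \<zeta> in at_top.
           lorden_delay f0 f1 (ac_time f0 f1 \<psi>s a1 \<epsilon>1 (ereal (ln \<zeta>))) (ac_policy f0 f1 \<psi>s a1 \<epsilon>1)
             = ennreal (ln \<zeta> / real_of_ereal (KL f1 f0) * (1 + h \<zeta>))))"
proof -
  interpret ac_model f0 f1 \<psi>s \<epsilon> a1 \<epsilon>1
    using assms by unfold_locales
  have "ennreal \<zeta> \<le> arl f0 f1 (Tc (ln \<zeta>)) \<and> comm_rate f0 f1 (Tc (ln \<zeta>)) pol \<le> ennreal \<epsilon>"
    if "1 \<le> \<zeta> \<and> a1 < ln \<zeta>" for \<zeta>
    using that arl_ge[of "ln \<zeta>"] comm_rate_le[of "ln \<zeta>"] by simp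
  then show ?thesis
    using asymptotically_optimal_ac delay_expansion by blast
qed

end
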